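(* Let $V\ge 2$, let $s$ be a probability distribution on $\{1,\dots,V\}$ with $s(V)>0$, and let an initial LRU stack $\Lambda_0$ be given (all buffers initially empty). Then for an arbitrary trace of $N$ references, the numbers of misses incurred by the LPR policy associated with $s$ with a buffer of capacity $C$, simultaneously for all capacities $C=1,\dots,V$, can be computed in time $O(V+N\log V)$.
   Context: For a trace of references to $V$ items, the LRU stack $\Lambda_t$ lists all items in order of most recent access ($\Lambda_t(1)$ most recent); an access to item $\Lambda_t(d)$ moves it to the top and shifts positions $1,\dots,d-1$ down by one. Write $\bar s(i,j)=\frac{1}{j-i+1}\sum_{k=i}^{j}s(k)$. A buffer of capacity $C$ holds at most $C$ items; an access to an item not in the buffer is a miss, the item is brought in and, if the buffer was full, an item of the buffer (other than the accessed one) is evicted. The profit rate of the item at LRU depth $i\ge2$ is $\xi(i)=\max_{i\le j\le V}\bar s(i,j)$. The Least Profit Rate (LPR) policy, upon a miss with full buffer, evicts the buffered item whose current LRU depth $i$ minimizes $\xi(i)$, ties broken in favor of the item closest to the top of the LRU stack. *)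

theory Defs
  imports "HOL-Probability.Probability_Mass_Function"
begin

section \<open>LRU stack and profit rates\<close>

text \<open>
  A stack over \<open>V\<close> items is a function whose values at \<open>1, \<dots>, V\<close> list the items, position 1 being
  the most recently accessed one; its values outside \<open>{1..V}\<close> are irrelevant.
\<close>

definition depth :: "nat \<Rightarrow> (nat \<Rightarrow> 'a) \<Rightarrow> 'a \<Rightarrow> nat" where
  "depth V \<Lambda> x = inv_into {1..V} \<Lambda> x"

definition lru_access :: "nat \<Rightarrow> (nat \<Rightarrow> 'a) \<Rightarrow> 'a \<Rightarrow> nat \<Rightarrow> 'a" where
  "lru_access V \<Lambda> x = (\<lambda>i. if i = 1 then x
                          else if 2 \<le> i \<and> i \<le> depth V \<Lambda> x then \<Lambda> (i - 1)
                          else \<Lambda> i)"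

definition mean :: "(nat \<Rightarrow> real) \<Rightarrow> nat \<Rightarrow> nat \<Rightarrow> real" where
  "mean s i j = (\<Sum>k=i..j. s k) / real (j - i + 1)"

definition profit_rate :: "nat \<Rightarrow> (nat \<Rightarrow> real) \<Rightarrow> nat \<Rightarrow> real" where
  "profit_rate V s i = Max (mean s i ` {i..V})"


section \<open>The LPR policy\<close>

text \<open>
  \<open>\<Lambda>\<close> is the stack after the current access and \<open>B\<close> the buffer content before the missing item is
  brought in. So the accessed item, now at depth 1, is not in \<open>B\<close>, and all items of \<open>B\<close> have depth
  at least 2, where the profit rate is defined.
\<close>

definition lpr_victim :: "nat \<Rightarrow> (nat \<Rightarrow> real) \<Rightarrow> (nat \<Rightarrow> 'a) \<Rightarrow> 'a set \<Rightarrow> 'a" where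
  "lpr_victim V s \<Lambda> B =
     (let D = depth V \<Lambda> ` B;
          m = Min (profit_rate V s ` D)
      in \<Lambda> (Min {d \<in> D. profit_rate V s d = m}))"

text \<open>The policy state consists of the stack, the buffer content and the number of misses so far.\<close>

fun lpr_step :: "nat \<Rightarrow> (nat \<Rightarrow> real) \<Rightarrow> nat \<Rightarrow> (nat \<Rightarrow> 'a) \<times> 'a set \<times> nat \<Rightarrow> 'a
                   \<Rightarrow> (nat \<Rightarrow> 'a) \<times> 'a set \<times> nat" where
  "lpr_step V s C (\<Lambda>, B, m) x =
     (let \<Lambda>' = lru_access V \<Lambda> x in
      if x \<in> B then (\<Lambda>', B, m)
      else if card B < C then (\<Lambda>', insert x B, m + 1)
      else (\<Lambda>', insert x (B - {lpr_victim V s \<Lambda>' B}), m + 1))"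

definition lpr_misses :: "nat \<Rightarrow> (nat \<Rightarrow> real) \<Rightarrow> nat \<Rightarrow> (nat \<Rightarrow> 'a) \<Rightarrow> 'a list \<Rightarrow> nat" where
  "lpr_misses V s C \<Lambda>\<^sub>0 xs = snd (snd (foldl (lpr_step V s C) (\<Lambda>\<^sub>0, {}, 0) xs))"


section \<open>Model of computation\<close>

text \<open>
  A random access machine with structured control. It has two kinds of cells: machine words, which
  hold natural numbers, and real cells. Memory is organised in named arrays, of which a program uses
  finitely many; a scalar variable is cell 0 of its array. There is unit-cost arithmetic and
  comparison on words and on reals, but the only numerical constants are natural numbers and there
  is no operation from reals to words (such as rounding) other than branching on a comparison.
  Subtraction of words is truncated at 0, and division by 0 yields 0 (for words and for reals).
\<close>

type_synonym vname = string

datatype wop = WAdd | WSub | WMul | WDiv | WMod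

datatype wexp =
    Num nat
  | Load vname wexp
  | WOp wop wexp wexp

datatype rop = RAdd | RSub | RMul | RDiv

datatype rexp =
    RLoad vname wexp
  | OfWord wexp
  | ROp rop rexp rexp

datatype bexp =
    WLess wexp wexp
  | RLess rexp rexp
  | BNot bexp
  | BAnd bexp bexp

datatype com =
    Skip
  | Store vname wexp wexp
  | RStore vname wexp rexp
  | Seq com com
  | Cond bexp com com
  | While bexp com

record mem =
  words :: "vname \<Rightarrow> nat \<Rightarrow> nat"
  reals :: "vname \<Rightarrow> nat \<Rightarrow> real"

fun wop_val :: "wop \<Rightarrow> nat \<Rightarrow> nat \<Rightarrow> nat" where
  "wop_val WAdd m n = m + n"
| "wop_val WSub m n = m - n"
| "wop_val WMul m n = m * n"
| "wop_val WDiv m n = m div n"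
| "wop_val WMod m n = m mod n"

fun rop_val :: "rop \<Rightarrow> real \<Rightarrow> real \<Rightarrow> real" where
  "rop_val RAdd x y = x + y"
| "rop_val RSub x y = x - y"
| "rop_val RMul x y = x * y"
| "rop_val RDiv x y = x / y"

fun wval :: "wexp \<Rightarrow> mem \<Rightarrow> nat" where
  "wval (Num n) \<sigma> = n"
| "wval (Load a e) \<sigma> = words \<sigma> a (wval e \<sigma>)"
| "wval (WOp f e1 e2) \<sigma> = wop_val f (wval e1 \<sigma>) (wval e2 \<sigma>)"

fun rval :: "rexp \<Rightarrow> mem \<Rightarrow> real" where
  "rval (RLoad a e) \<sigma> = reals \<sigma> a (wval e \<sigma>)"
| "rval (OfWord e) \<sigma> = real (wval e \<sigma>)"
| "rval (ROp f r1 r2) \<sigma> = rop_val f (rval r1 \<sigma>) (rval r2 \<sigma>)"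

fun bval :: "bexp \<Rightarrow> mem \<Rightarrow> bool" where
  "bval (WLess e1 e2) \<sigma> \<longleftrightarrow> wval e1 \<sigma> < wval e2 \<sigma>"
| "bval (RLess r1 r2) \<sigma> \<longleftrightarrow> rval r1 \<sigma> < rval r2 \<sigma>"
| "bval (BNot b) \<sigma> \<longleftrightarrow> \<not> bval b \<sigma>"
| "bval (BAnd b1 b2) \<sigma> \<longleftrightarrow> bval b1 \<sigma> \<and> bval b2 \<sigma>"

text \<open>
  Words are bounded: \<open>wfits W\<close>, \<open>rfits W\<close> and \<open>bfits W\<close> say that no word arising in the evaluation of
  an expression (addresses included) exceeds \<open>W\<close>.
\<close>

fun wfits :: "nat \<Rightarrow> wexp \<Rightarrow> mem \<Rightarrow> bool" where
  "wfits W (Num n) \<sigma> \<longleftrightarrow> n \<le> W"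
| "wfits W (Load a e) \<sigma> \<longleftrightarrow> wfits W e \<sigma> \<and> wval (Load a e) \<sigma> \<le> W"
| "wfits W (WOp f e1 e2) \<sigma> \<longleftrightarrow> wfits W e1 \<sigma> \<and> wfits W e2 \<sigma> \<and> wval (WOp f e1 e2) \<sigma> \<le> W"

fun rfits :: "nat \<Rightarrow> rexp \<Rightarrow> mem \<Rightarrow> bool" where
  "rfits W (RLoad a e) \<sigma> \<longleftrightarrow> wfits W e \<sigma>"
| "rfits W (OfWord e) \<sigma> \<longleftrightarrow> wfits W e \<sigma>"
| "rfits W (ROp f r1 r2) \<sigma> \<longleftrightarrow> rfits W r1 \<sigma> \<and> rfits W r2 \<sigma>"

fun bfits :: "nat \<Rightarrow> bexp \<Rightarrow> mem \<Rightarrow> bool" where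
  "bfits W (WLess e1 e2) \<sigma> \<longleftrightarrow> wfits W e1 \<sigma> \<and> wfits W e2 \<sigma>"
| "bfits W (RLess r1 r2) \<sigma> \<longleftrightarrow> rfits W r1 \<sigma> \<and> rfits W r2 \<sigma>"
| "bfits W (BNot b) \<sigma> \<longleftrightarrow> bfits W b \<sigma>"
| "bfits W (BAnd b1 b2) \<sigma> \<longleftrightarrow> bfits W b1 \<sigma> \<and> bfits W b2 \<sigma>"

fun wcost :: "wexp \<Rightarrow> nat" where
  "wcost (Num n) = 1"
| "wcost (Load a e) = 1 + wcost e"
| "wcost (WOp f e1 e2) = 1 + wcost e1 + wcost e2"

fun rcost :: "rexp \<Rightarrow> nat" where
  "rcost (RLoad a e) = 1 + wcost e"
| "rcost (OfWord e) = 1 + wcost e"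
| "rcost (ROp f r1 r2) = 1 + rcost r1 + rcost r2"

fun bcost :: "bexp \<Rightarrow> nat" where
  "bcost (WLess e1 e2) = 1 + wcost e1 + wcost e2"
| "bcost (RLess r1 r2) = 1 + rcost r1 + rcost r2"
| "bcost (BNot b) = 1 + bcost b"
| "bcost (BAnd b1 b2) = 1 + bcost b1 + bcost b2"

text \<open>
  \<open>exec W p \<sigma> t \<sigma>'\<close>: with words bounded by \<open>W\<close>, program \<open>p\<close> started in \<open>\<sigma>\<close> terminates in \<open>\<sigma>'\<close> after
  time \<open>t\<close>. A computation exceeding the word bound is stuck.
\<close>

inductive exec :: "nat \<Rightarrow> com \<Rightarrow> mem \<Rightarrow> nat \<Rightarrow> mem \<Rightarrow> bool" for W where
  Skip: "exec W Skip \<sigma> 1 \<sigma>"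
| Store: "\<lbrakk>wfits W i \<sigma>; wfits W e \<sigma>\<rbrakk> \<Longrightarrow>
    exec W (Store a i e) \<sigma> (1 + wcost i + wcost e)
      (\<sigma>\<lparr>words := (words \<sigma>)(a := (words \<sigma> a)(wval i \<sigma> := wval e \<sigma>))\<rparr>)"
| RStore: "\<lbrakk>wfits W i \<sigma>; rfits W r \<sigma>\<rbrakk> \<Longrightarrow>
    exec W (RStore a i r) \<sigma> (1 + wcost i + rcost r)
      (\<sigma>\<lparr>reals := (reals \<sigma>)(a := (reals \<sigma> a)(wval i \<sigma> := rval r \<sigma>))\<rparr>)"
| Seq: "\<lbrakk>exec W p1 \<sigma> t1 \<sigma>'; exec W p2 \<sigma>' t2 \<sigma>''\<rbrakk> \<Longrightarrow>
    exec W (Seq p1 p2) \<sigma> (t1 + t2) \<sigma>''"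
| CondTrue: "\<lbrakk>bfits W b \<sigma>; bval b \<sigma>; exec W p1 \<sigma> t \<sigma>'\<rbrakk> \<Longrightarrow>
    exec W (Cond b p1 p2) \<sigma> (1 + bcost b + t) \<sigma>'"
| CondFalse: "\<lbrakk>bfits W b \<sigma>; \<not> bval b \<sigma>; exec W p2 \<sigma> t \<sigma>'\<rbrakk> \<Longrightarrow>
    exec W (Cond b p1 p2) \<sigma> (1 + bcost b + t) \<sigma>'"
| WhileFalse: "\<lbrakk>bfits W b \<sigma>; \<not> bval b \<sigma>\<rbrakk> \<Longrightarrow>
    exec W (While b p) \<sigma> (1 + bcost b) \<sigma>"
| WhileTrue: "\<lbrakk>bfits W b \<sigma>; bval b \<sigma>; exec W p \<sigma> t1 \<sigma>'; exec W (While b p) \<sigma>' t2 \<sigma>''\<rbrakk> \<Longrightarrow>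
    exec W (While b p) \<sigma> (1 + bcost b + t1 + t2) \<sigma>''"

text \<open>The semantics is deterministic, so existence of an execution is a statement about the execution.\<close>

lemma exec_deterministic:
  "exec W p \<sigma> t \<sigma>1 \<Longrightarrow> exec W p \<sigma> u \<sigma>2 \<Longrightarrow> u = t \<and> \<sigma>2 = \<sigma>1"
proof (induction arbitrary: u \<sigma>2 rule: exec.induct)
  case (WhileTrue b \<sigma> p t1 \<sigma>' t2 \<sigma>'')
  from WhileTrue.prems WhileTrue.hyps WhileTrue.IH show ?case
    by (cases rule: exec.cases) blast+
qed (erule exec.cases; blast)+

text \<open>Cells that hold no input are initially 0.\<close>

definition input_mem :: "nat \<Rightarrow> (nat \<Rightarrow> real) \<Rightarrow> (nat \<Rightarrow> nat) \<Rightarrow> nat list \<Rightarrow> mem" where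
  "input_mem V s \<Lambda>\<^sub>0 xs =
     \<lparr>words = (\<lambda>a i. 0)
        (''V'' := (\<lambda>i. 0)(0 := V),
         ''N'' := (\<lambda>i. 0)(0 := length xs),
         ''stack'' := (\<lambda>i. if i \<in> {1..V} then \<Lambda>\<^sub>0 i else 0),
         ''trace'' := (\<lambda>i. if i \<in> {1..length xs} then xs ! (i - 1) else 0)),
      reals = (\<lambda>a i. 0)
        (''s'' := (\<lambda>i. if i \<in> {1..V} then s i else 0))\<rparr>"

end

theory Submission imports Defs "HOL-Library.Log_Nat" begin

text \<open>The maximum defining \<open>\<xi>\<close> is governed by the partition of \<open>{2..V}\<close> into blocks whose means of
  \<open>s\<close> strictly decrease and in which no prefix has a mean above that of the block (pool adjacent violators):
  \<open>\<xi>\<close> is at least the mean of the block, with equality at its start. Together with the block \<open>{1}\<close> these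
  are the \<^emph>\<open>segments\<close>. The buffers of all capacities are nested, so each of the \<open>m\<close> items accessed so far has
  a slot, the least capacity at which it is buffered. Since the victim of a miss is always the first item of
  a segment, the slots change in a simple way: on an access at depth \<open>d\<close> the slots held in each segment
  before depth \<open>d\<close> rotate by one place, and so does the part down to \<open>d\<close> of the segment that contains \<open>d\<close>. The
  access is a hit exactly for the capacities from the old slot on, so the histogram of these
  slots yields all miss counts at the end.

  The rotations of entire segments are carried out lazily. They are recovered from the number of
  accesses that went beyond the segment, counted in a binary tree, so that one access only moves one slot
  to the front of one segment, kept as an AVL tree. The depth of an item is its rank in an AVL tree of time
  stamps. Tree nodes are never modified after their creation.\<close>

section \<open>Weakest preconditions with time bounds\<close>

text \<open>Origin of the rotations: let \<open>(K, L]\<close> be the segment of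
  \<open>C + 1\<close>. A full buffer of capacity C holds the items of all ranks up to K, some in
  \<open>(K, L]\<close> and none beyond. A miss pushes the item of rank K to the first, cheapest
  rank of the segment; it is evicted unless a buffered item of rank L is pushed to
  \<open>L + 1\<close>, where the rate is smaller still. For all C together: an item that enters a
  segment takes over the slot of the item that leaves it, or of the accessed item.

  An access may touch V segments, so carrying out every rotation would cost too much; this forces
  the lazy form. The factor is log V and not log N because every AVL tree has at most
  \<open>V + 1\<close> elements and the counting tree is indexed by ranks, not by time. An item not
  accessed yet is treated as if it had rank \<open>m + 1\<close>, so the order of such items never
  matters.

  As nodes are never overwritten, a tree once built stays valid, which replaces arguments about
  separation; the price is O(N log V) addresses, covered by the polynomial word bound. The time
  constants are generous roundings.\<close>

definition bounded_mem :: "nat \<Rightarrow> mem \<Rightarrow> bool" where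
  "bounded_mem W \<sigma> \<longleftrightarrow> (\<forall>a i. words \<sigma> a i \<le> W)"

text \<open>In a bounded memory every loaded word is small, and differences, quotients and
  remainders do not exceed their left operand. Only constants, sums and products leave an
  obligation, which keeps verification conditions short.\<close>

fun wsafe :: "nat \<Rightarrow> wexp \<Rightarrow> mem \<Rightarrow> bool" where
  "wsafe W (Num n) \<sigma> \<longleftrightarrow> n \<le> W"
| "wsafe W (Load a e) \<sigma> \<longleftrightarrow> wsafe W e \<sigma>"
| "wsafe W (WOp f e1 e2) \<sigma> \<longleftrightarrow> wsafe W e1 \<sigma> \<and> wsafe W e2 \<sigma> \<and>
     (f = WAdd \<or> f = WMul \<longrightarrow> wop_val f (wval e1 \<sigma>) (wval e2 \<sigma>) \<le> W)"

fun rsafe :: "nat \<Rightarrow> rexp \<Rightarrow> mem \<Rightarrow> bool" where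
  "rsafe W (RLoad a e) \<sigma> \<longleftrightarrow> wsafe W e \<sigma>"
| "rsafe W (OfWord e) \<sigma> \<longleftrightarrow> wsafe W e \<sigma>"
| "rsafe W (ROp f r1 r2) \<sigma> \<longleftrightarrow> rsafe W r1 \<sigma> \<and> rsafe W r2 \<sigma>"

fun bsafe :: "nat \<Rightarrow> bexp \<Rightarrow> mem \<Rightarrow> bool" where
  "bsafe W (WLess e1 e2) \<sigma> \<longleftrightarrow> wsafe W e1 \<sigma> \<and> wsafe W e2 \<sigma>"
| "bsafe W (RLess r1 r2) \<sigma> \<longleftrightarrow> rsafe W r1 \<sigma> \<and> rsafe W r2 \<sigma>"
| "bsafe W (BNot b) \<sigma> \<longleftrightarrow> bsafe W b \<sigma>"
| "bsafe W (BAnd b1 b2) \<sigma> \<longleftrightarrow> bsafe W b1 \<sigma> \<and> bsafe W b2 \<sigma>"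

lemma wsafe_wfits:
  assumes "bounded_mem W \<sigma>"
  shows "wsafe W e \<sigma> \<Longrightarrow> wfits W e \<sigma> \<and> wval e \<sigma> \<le> W"
proof (induction e)
  case (WOp f e1 e2)
  then show ?case
    by (cases f) (auto intro: order.trans[OF diff_le_self] order.trans[OF div_le_dividend]
        order.trans[OF mod_less_eq_dividend])
qed (use assms in \<open>auto simp: bounded_mem_def\<close>)

lemma rsafe_rfits: "bounded_mem W \<sigma> \<Longrightarrow> rsafe W r \<sigma> \<Longrightarrow> rfits W r \<sigma>"
  by (induction r) (auto simp: wsafe_wfits)

lemma bsafe_bfits: "bounded_mem W \<sigma> \<Longrightarrow> bsafe W b \<sigma> \<Longrightarrow> bfits W b \<sigma>"
  by (induction b) (auto simp: wsafe_wfits rsafe_rfits)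

definition upd :: "vname \<Rightarrow> nat \<Rightarrow> nat \<Rightarrow> mem \<Rightarrow> mem" where
  "upd a i v \<sigma> = \<sigma>\<lparr>words := (words \<sigma>)(a := (words \<sigma> a)(i := v))\<rparr>"

definition rupd :: "vname \<Rightarrow> nat \<Rightarrow> real \<Rightarrow> mem \<Rightarrow> mem" where
  "rupd a i v \<sigma> = \<sigma>\<lparr>reals := (reals \<sigma>)(a := (reals \<sigma> a)(i := v))\<rparr>"

lemma words_upd_fun [simp]:
  "words (upd a i v \<sigma>) b = (if b = a then (words \<sigma> a)(i := v) else words \<sigma> b)"
  by (simp add: upd_def)

lemma reals_upd [simp]: "reals (upd a i v \<sigma>) = reals \<sigma>"
  by (simp add: upd_def)

lemma words_rupd [simp]: "words (rupd a i v \<sigma>) = words \<sigma>"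
  by (simp add: rupd_def)

lemma reals_rupd [simp]:
  "reals (rupd a i v \<sigma>) b = (if b = a then (reals \<sigma> a)(i := v) else reals \<sigma> b)"
  by (simp add: rupd_def)

definition terminates :: "nat \<Rightarrow> com \<Rightarrow> mem \<Rightarrow> (nat \<Rightarrow> mem \<Rightarrow> bool) \<Rightarrow> bool" where
  "terminates W p \<sigma> Q \<longleftrightarrow>
     (bounded_mem W \<sigma> \<longrightarrow> (\<exists>t \<sigma>'. exec W p \<sigma> t \<sigma>' \<and> bounded_mem W \<sigma>' \<and> Q t \<sigma>'))"

text \<open>The elapsed time is an argument of the postcondition, so a time bound is simply part of
  Q. Boundedness of the memory is hidden in \<open>terminates\<close> as hypothesis and as
  conclusion and never has to appear in an invariant. A loop has no precondition by structural
  recursion, hence the semantic clause.\<close>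

primrec wp :: "nat \<Rightarrow> com \<Rightarrow> mem \<Rightarrow> (nat \<Rightarrow> mem \<Rightarrow> bool) \<Rightarrow> bool" where
  "wp W Skip \<sigma> Q \<longleftrightarrow> Q 1 \<sigma>"
| "wp W (Store a i e) \<sigma> Q \<longleftrightarrow> wsafe W i \<sigma> \<and> wsafe W e \<sigma> \<and>
     Q (1 + wcost i + wcost e) (upd a (wval i \<sigma>) (wval e \<sigma>) \<sigma>)"
| "wp W (RStore a i r) \<sigma> Q \<longleftrightarrow> wsafe W i \<sigma> \<and> rsafe W r \<sigma> \<and>
     Q (1 + wcost i + rcost r) (rupd a (wval i \<sigma>) (rval r \<sigma>) \<sigma>)"
| "wp W (Seq p q) \<sigma> Q \<longleftrightarrow> wp W p \<sigma> (\<lambda>t \<sigma>'. wp W q \<sigma>' (\<lambda>u. Q (t + u)))"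
| "wp W (Cond b p q) \<sigma> Q \<longleftrightarrow> bsafe W b \<sigma> \<and>
     (if bval b \<sigma> then wp W p \<sigma> (\<lambda>t. Q (1 + bcost b + t)) else wp W q \<sigma> (\<lambda>t. Q (1 + bcost b + t)))"
| "wp W (While b p) \<sigma> Q \<longleftrightarrow> terminates W (While b p) \<sigma> Q"

lemma terminates_mono:
  "terminates W p \<sigma> Q \<Longrightarrow> (\<And>t \<sigma>'. Q t \<sigma>' \<Longrightarrow> R t \<sigma>') \<Longrightarrow> terminates W p \<sigma> R"
  unfolding terminates_def by blast

lemma wp_mono: "wp W p \<sigma> Q \<Longrightarrow> (\<And>t \<sigma>'. Q t \<sigma>' \<Longrightarrow> R t \<sigma>') \<Longrightarrow> wp W p \<sigma> R"
proof (induction p arbitrary: \<sigma> Q R)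
  case (Seq p q)
  from Seq.prems(1) have "wp W p \<sigma> (\<lambda>t \<sigma>'. wp W q \<sigma>' (\<lambda>u. Q (t + u)))" by simp
  then have "wp W p \<sigma> (\<lambda>t \<sigma>'. wp W q \<sigma>' (\<lambda>u. R (t + u)))"
    by (rule Seq.IH(1)) (erule Seq.IH(2), rule Seq.prems(2))
  then show ?case by simp
next
  case (Cond b p q)
  show ?case
  proof (cases "bval b \<sigma>")
    case True
    with Cond.prems(1) have "wp W p \<sigma> (\<lambda>t. Q (1 + bcost b + t))" by simp
    then have "wp W p \<sigma> (\<lambda>t. R (1 + bcost b + t))"
      by (rule Cond.IH(1)) (rule Cond.prems(2))
    with True Cond.prems(1) show ?thesis by simp
  next
    case False
    with Cond.prems(1) have "wp W q \<sigma> (\<lambda>t. Q (1 + bcost b + t))" by simp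
    then have "wp W q \<sigma> (\<lambda>t. R (1 + bcost b + t))"
      by (rule Cond.IH(2)) (rule Cond.prems(2))
    with False Cond.prems(1) show ?thesis by simp
  qed
qed (auto intro: terminates_mono)

lemma wp_terminates: "wp W p \<sigma> Q \<Longrightarrow> terminates W p \<sigma> Q"
proof (induction p arbitrary: \<sigma> Q)
  case Skip
  then show ?case unfolding terminates_def wp.simps using exec.Skip by blast
next
  case (Store a i e)
  show ?case unfolding terminates_def
  proof
    assume b: "bounded_mem W \<sigma>"
    with Store have f: "wfits W i \<sigma>" "wfits W e \<sigma>" "wval e \<sigma> \<le> W" by (auto dest: wsafe_wfits)
    then have "bounded_mem W (upd a (wval i \<sigma>) (wval e \<sigma>) \<sigma>)"
      using b by (auto simp: bounded_mem_def)
    moreover from Store have "Q (1 + wcost i + wcost e) (upd a (wval i \<sigma>) (wval e \<sigma>) \<sigma>)" by simp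
    ultimately
    show "\<exists>t \<sigma>'. exec W (Store a i e) \<sigma> t \<sigma>' \<and> bounded_mem W \<sigma>' \<and> Q t \<sigma>'"
      using exec.Store[OF f(1,2), of a, folded upd_def] by blast
  qed
next
  case (RStore a i r)
  show ?case unfolding terminates_def
  proof
    assume b: "bounded_mem W \<sigma>"
    with RStore have f: "wfits W i \<sigma>" "rfits W r \<sigma>" by (auto dest: wsafe_wfits rsafe_rfits)
    have "bounded_mem W (rupd a (wval i \<sigma>) (rval r \<sigma>) \<sigma>)"
      using b by (auto simp: bounded_mem_def)
    moreover from RStore have "Q (1 + wcost i + rcost r) (rupd a (wval i \<sigma>) (rval r \<sigma>) \<sigma>)" by simp
    ultimately
    show "\<exists>t \<sigma>'. exec W (RStore a i r) \<sigma> t \<sigma>' \<and> bounded_mem W \<sigma>' \<and> Q t \<sigma>'"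
      using exec.RStore[OF f, of a, folded rupd_def] by blast
  qed
next
  case (Seq p q)
  have "terminates W p \<sigma> (\<lambda>t \<sigma>'. wp W q \<sigma>' (\<lambda>u. Q (t + u)))"
    using Seq.prems by (intro Seq.IH(1)) simp
  then show ?case
    using Seq.IH(2) unfolding terminates_def by (meson exec.Seq)
next
  case (Cond b p q)
  show ?case
  proof (cases "bval b \<sigma>")
    case True
    with Cond.prems have "terminates W p \<sigma> (\<lambda>t. Q (1 + bcost b + t))"
      by (intro Cond.IH(1)) simp
    moreover from Cond.prems have "bsafe W b \<sigma>" by simp
    ultimately show ?thesis
      using True exec.CondTrue unfolding terminates_def by (meson bsafe_bfits)
  next
    case False
    with Cond.prems have "terminates W q \<sigma> (\<lambda>t. Q (1 + bcost b + t))"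
      by (intro Cond.IH(2)) simp
    moreover from Cond.prems have "bsafe W b \<sigma>" by simp
    ultimately show ?thesis
      using False exec.CondFalse unfolding terminates_def by (meson bsafe_bfits)
  qed
qed simp

text \<open>At most \<open>\<mu> \<sigma>\<close> rounds are made, each paying for the test and at
  most c for the body; the last summand pays for the failing test. The bound c has to be uniform
  over all rounds.\<close>

lemma wp_while:
  assumes "I \<sigma>"
    and safe: "\<And>\<sigma>. I \<sigma> \<Longrightarrow> bsafe W b \<sigma>"
    and body: "\<And>\<sigma>. I \<sigma> \<Longrightarrow> bval b \<sigma> \<Longrightarrow> wp W p \<sigma> (\<lambda>t \<sigma>'. t \<le> c \<and> I \<sigma>' \<and> \<mu> \<sigma>' < (\<mu> \<sigma> :: nat))"
  shows "wp W (While b p) \<sigma> (\<lambda>t \<sigma>'. t \<le> (1 + bcost b + c) * \<mu> \<sigma> + (1 + bcost b) \<and> I \<sigma>' \<and> \<not> bval b \<sigma>')"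
  using assms(1)
proof (induction "\<mu> \<sigma>" arbitrary: \<sigma> rule: less_induct)
  case less
  show ?case unfolding wp.simps terminates_def
  proof
    assume bd: "bounded_mem W \<sigma>"
    then have fits: "bfits W b \<sigma>" using safe[OF less.prems] by (rule bsafe_bfits)
    show "\<exists>t \<sigma>'. exec W (While b p) \<sigma> t \<sigma>' \<and> bounded_mem W \<sigma>' \<and>
        t \<le> (1 + bcost b + c) * \<mu> \<sigma> + (1 + bcost b) \<and> I \<sigma>' \<and> \<not> bval b \<sigma>'"
    proof (cases "bval b \<sigma>")
      case False
      have "1 + bcost b \<le> (1 + bcost b + c) * \<mu> \<sigma> + (1 + bcost b)" by simp
      then show ?thesis using bd less.prems exec.WhileFalse[OF fits False] False by blast
    next
      case True
      obtain t1 \<sigma>1 where 1: "exec W p \<sigma> t1 \<sigma>1" "bounded_mem W \<sigma>1" "t1 \<le> c" "I \<sigma>1" "\<mu> \<sigma>1 < \<mu> \<sigma>"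
        using wp_terminates[OF body[OF less.prems True]] bd unfolding terminates_def by blast
      obtain t2 \<sigma>2 where 2: "exec W (While b p) \<sigma>1 t2 \<sigma>2" "bounded_mem W \<sigma>2"
          "t2 \<le> (1 + bcost b + c) * \<mu> \<sigma>1 + (1 + bcost b)" "I \<sigma>2" "\<not> bval b \<sigma>2"
        using less.hyps[OF 1(5,4)] 1(2) unfolding wp.simps terminates_def by blast
      have "(1 + bcost b + c) * Suc (\<mu> \<sigma>1) \<le> (1 + bcost b + c) * \<mu> \<sigma>"
        using 1(5) by (intro mult_le_mono2) simp
      then have "1 + bcost b + t1 + t2 \<le> (1 + bcost b + c) * \<mu> \<sigma> + (1 + bcost b)"
        using 1(3) 2(3) by simp
      then show ?thesis using exec.WhileTrue[OF fits True 1(1) 2(1)] 2 by blast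
    qed
  qed
qed

lemma wp_while_post:
  assumes "I \<sigma>" and "\<And>\<sigma>. I \<sigma> \<Longrightarrow> bsafe W b \<sigma>"
    and "\<And>\<sigma>. I \<sigma> \<Longrightarrow> bval b \<sigma> \<Longrightarrow> wp W p \<sigma> (\<lambda>t \<sigma>'. t \<le> c \<and> I \<sigma>' \<and> \<mu> \<sigma>' < (\<mu> \<sigma> :: nat))"
    and "\<And>t \<sigma>'. t \<le> (1 + bcost b + c) * \<mu> \<sigma> + (1 + bcost b) \<Longrightarrow> I \<sigma>' \<Longrightarrow> \<not> bval b \<sigma>' \<Longrightarrow> Q t \<sigma>'"
  shows "wp W (While b p) \<sigma> Q"
proof (rule wp_mono[OF wp_while[of I \<sigma> W b p c \<mu>]])
  show "\<And>\<sigma>. I \<sigma> \<Longrightarrow> bval b \<sigma> \<Longrightarrow> wp W p \<sigma> (\<lambda>t \<sigma>'. t \<le> c \<and> I \<sigma>' \<and> \<mu> \<sigma>' < \<mu> \<sigma>)"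
    by (rule assms(3))
qed (use assms in blast)+

abbreviation Var :: "vname \<Rightarrow> wexp" where "Var a \<equiv> Load a (Num 0)"
abbreviation Set :: "vname \<Rightarrow> wexp \<Rightarrow> com" where "Set a e \<equiv> Store a (Num 0) e"
abbreviation val :: "mem \<Rightarrow> vname \<Rightarrow> nat" where "val \<sigma> a \<equiv> words \<sigma> a 0"
abbreviation Plus :: "wexp \<Rightarrow> wexp \<Rightarrow> wexp" where "Plus \<equiv> WOp WAdd"
abbreviation Minus :: "wexp \<Rightarrow> wexp \<Rightarrow> wexp" where "Minus \<equiv> WOp WSub"

fun Block :: "com list \<Rightarrow> com" where
  "Block [] = Skip"
| "Block [p] = p"
| "Block (p # q # ps) = Seq p (Block (q # ps))"

text \<open>Real cells are not covered: only the computation of the blocks writes to them, and it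
  states separately that the input array survives.\<close>

definition frame :: "vname set \<Rightarrow> mem \<Rightarrow> mem \<Rightarrow> bool" where
  "frame S \<sigma> \<sigma>' \<longleftrightarrow> (\<forall>a. a \<notin> S \<longrightarrow> words \<sigma>' a = words \<sigma> a)"

lemma frame_refl [simp]: "frame S \<sigma> \<sigma>"
  by (simp add: frame_def)

lemma frame_trans: "frame S \<sigma> \<sigma>' \<Longrightarrow> frame T \<sigma>' \<sigma>'' \<Longrightarrow> S \<subseteq> R \<Longrightarrow> T \<subseteq> R \<Longrightarrow> frame R \<sigma> \<sigma>''"
  unfolding frame_def by (metis subsetD)

lemma frame_words: "frame S \<sigma> \<sigma>' \<Longrightarrow> a \<notin> S \<Longrightarrow> words \<sigma>' a = words \<sigma> a"
  by (simp add: frame_def)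

lemma frame_upd [simp]: "a \<in> S \<Longrightarrow> frame S \<sigma> (upd a i v \<sigma>') \<longleftrightarrow> frame S \<sigma> \<sigma>'"
  by (auto simp: frame_def)

section \<open>AVL trees\<close>

text \<open>Elements sit in the leaves only, so an edit replaces a leaf by a node with two leaves,
  or a node by one of its children, and never has to relocate an element of an inner node. The empty
  sequence has no tree.\<close>

datatype tree = Lf nat | Nd tree tree

fun elems :: "tree \<Rightarrow> nat list" where
  "elems (Lf v) = [v]"
| "elems (Nd l r) = elems l @ elems r"

fun hgt :: "tree \<Rightarrow> nat" where
  "hgt (Lf v) = 0"
| "hgt (Nd l r) = Suc (max (hgt l) (hgt r))"

fun avl :: "tree \<Rightarrow> bool" where
  "avl (Lf v) \<longleftrightarrow> True"
| "avl (Nd l r) \<longleftrightarrow> avl l \<and> avl r \<and> hgt l \<le> Suc (hgt r) \<and> hgt r \<le> Suc (hgt l)"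

abbreviation siz :: "tree \<Rightarrow> nat" where "siz T \<equiv> length (elems T)"

text \<open>The single and double rotations of AVL trees. Where the shape needed for a rotation is
  missing, the value defaults to \<open>Nd l r\<close>, so that \<open>elems_bal\<close> holds
  without hypotheses.\<close>

definition bal :: "tree \<Rightarrow> tree \<Rightarrow> tree" where
  "bal l r =
     (if Suc (hgt r) < hgt l then
        case l of Lf _ \<Rightarrow> Nd l r
        | Nd u w \<Rightarrow> if hgt u < hgt w
            then (case w of Lf _ \<Rightarrow> Nd l r | Nd x y \<Rightarrow> Nd (Nd u x) (Nd y r))
            else Nd u (Nd w r)
      else if Suc (hgt l) < hgt r then
        case r of Lf _ \<Rightarrow> Nd l r
        | Nd w u \<Rightarrow> if hgt u < hgt w
            then (case w of Lf _ \<Rightarrow> Nd l r | Nd x y \<Rightarrow> Nd (Nd l x) (Nd y u))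
            else Nd (Nd l w) u
      else Nd l r)"

lemma elems_bal [simp]: "elems (bal l r) = elems l @ elems r"
  by (auto simp: bal_def split: tree.splits)

lemma elems_nonempty [simp]: "elems T \<noteq> []"
  by (induction T) auto

lemma siz_pos [simp]: "0 < siz T"
  by simp

lemma hgt_less_siz: "hgt T < siz T"
proof (induction T)
  case (Nd l r)
  have "0 < siz l" "0 < siz r" by simp_all
  with Nd show ?case unfolding hgt.simps elems.simps length_append by linarith
qed simp

text \<open>The exact height in the already balanced case is essential for
  \<open>avl_rebuild\<close>: the two general inequalities alone would allow the height to drop by
  two when a child has become lower by one.\<close>

lemma avl_bal:
  assumes "avl l" "avl r" "hgt l \<le> hgt r + 2" "hgt r \<le> hgt l + 2"
  shows "avl (bal l r) \<and> hgt (bal l r) \<le> Suc (max (hgt l) (hgt r)) \<and> max (hgt l) (hgt r) \<le> hgt (bal l r) \<and>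
    (hgt l \<le> Suc (hgt r) \<longrightarrow> hgt r \<le> Suc (hgt l) \<longrightarrow> hgt (bal l r) = Suc (max (hgt l) (hgt r)))"
proof -
  consider (left) "hgt l = Suc (Suc (hgt r))" | (right) "hgt r = Suc (Suc (hgt l))"
    | (mid) "hgt l \<le> Suc (hgt r)" "hgt r \<le> Suc (hgt l)"
    using assms(3,4) by linarith
  then show ?thesis
  proof cases
    case left
    then obtain u w where l: "l = Nd u w" by (cases l) auto
    show ?thesis
    proof (cases "hgt u < hgt w")
      case True
      then obtain x y where w: "w = Nd x y" by (cases w) auto
      have "hgt u = hgt r" "max (hgt x) (hgt y) = hgt r"
        using left True assms(1) by (auto simp: l w)
      then show ?thesis using left True assms(1,2) by (auto simp: bal_def l w)
    next
      case False
      have "hgt u = Suc (hgt r)" "hgt w = hgt r \<or> hgt w = Suc (hgt r)"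
        using left False assms(1) by (auto simp: l)
      then show ?thesis using left False assms(1,2) by (auto simp: bal_def l)
    qed
  next
    case right
    then obtain w u where r: "r = Nd w u" by (cases r) auto
    show ?thesis
    proof (cases "hgt u < hgt w")
      case True
      then obtain x y where w: "w = Nd x y" by (cases w) auto
      have "hgt u = hgt l" "max (hgt x) (hgt y) = hgt l"
        using right True assms(2) by (auto simp: r w)
      then show ?thesis using right True assms(1,2) by (auto simp: bal_def r w)
    next
      case False
      have "hgt u = Suc (hgt l)" "hgt w = hgt l \<or> hgt w = Suc (hgt l)"
        using right False assms(2) by (auto simp: r)
      then show ?thesis using right False assms(1,2) by (auto simp: bal_def r)
    qed
  next
    case mid
    then show ?thesis using assms(1,2) by (auto simp: bal_def)
  qed
qed

text \<open>The Fibonacci growth of AVL trees exceeds the growth rate sqrt 2, and squaring keeps the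
  statement within the naturals. If h is the smaller height of the two subtrees, the tree has height
  at most \<open>h + 2\<close>, while both squared sizes, and hence the product of the sizes, are at
  least \<open>2 ^ h\<close>, so that the square of their sum is at least
  \<open>4 * 2 ^ h\<close>.\<close>

lemma avl_size: "avl T \<Longrightarrow> 2 ^ hgt T \<le> (siz T)\<^sup>2"
proof (induction T)
  case (Nd l r)
  define a b where "a = siz l" and "b = siz r"
  obtain h where h: "hgt l \<ge> h" "hgt r \<ge> h" "hgt (Nd l r) \<le> h + 2"
      "hgt (Nd l r) = h + 2 \<longrightarrow> hgt l \<ge> Suc h \<or> hgt r \<ge> Suc h"
    using Nd.prems by (intro that[of "min (hgt l) (hgt r)"]) auto
  have IH: "2 ^ hgt l \<le> a\<^sup>2" "2 ^ hgt r \<le> b\<^sup>2" using Nd by (auto simp: a_def b_def)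
  have ge: "2 ^ h \<le> a\<^sup>2" "2 ^ h \<le> b\<^sup>2"
    using IH h(1,2) by (meson order.trans power_increasing one_le_numeral)+
  \<comment> \<open>The smaller of the two squares is at most the product.\<close>
  have ab: "2 ^ h \<le> a * b"
  proof (cases "a \<le> b")
    case True
    then have "a\<^sup>2 \<le> a * b" by (simp add: power2_eq_square)
    with ge show ?thesis by linarith
  next
    case False
    then have "b\<^sup>2 \<le> a * b" by (simp add: power2_eq_square)
    with ge show ?thesis by linarith
  qed
  have sq: "(a + b)\<^sup>2 = a\<^sup>2 + b\<^sup>2 + 2 * (a * b)" by (simp add: power2_eq_square algebra_simps)
  have four: "4 * 2 ^ h \<le> (a + b)\<^sup>2" using ge ab unfolding sq by linarith
  have "2 ^ hgt (Nd l r) \<le> (2 :: nat) ^ (h + 2)" using h(3) by (intro power_increasing) auto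
  also have "\<dots> = 4 * 2 ^ h" by simp
  finally show ?case using four by (simp add: a_def b_def)
qed simp

text \<open>A context of a subtree is a list of siblings, from the root down, where the flag tells whether
  the subtree lies to the left of the sibling.\<close>

definition plug :: "(bool \<times> tree) list \<Rightarrow> tree \<Rightarrow> tree" where
  "plug = foldr (\<lambda>(left, s) t. if left then Nd t s else Nd s t)"

definition rebuild :: "(bool \<times> tree) list \<Rightarrow> tree \<Rightarrow> tree" where
  "rebuild = foldr (\<lambda>(left, s) t. if left then bal t s else bal s t)"

definition elems_before :: "(bool \<times> tree) list \<Rightarrow> nat list" where
  "elems_before fs = concat (map (\<lambda>(left, s). if left then [] else elems s) fs)"

definition elems_after :: "(bool \<times> tree) list \<Rightarrow> nat list" where
  "elems_after fs = concat (rev (map (\<lambda>(left, s). if left then elems s else []) fs))"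

lemma elems_plug: "elems (plug fs t) = elems_before fs @ elems t @ elems_after fs"
  by (induction fs) (auto simp: plug_def elems_before_def elems_after_def)

lemma elems_rebuild: "elems (rebuild fs t) = elems_before fs @ elems t @ elems_after fs"
  by (induction fs) (auto simp: rebuild_def elems_before_def elems_after_def)

lemma hgt_plug: "length fs + hgt t \<le> hgt (plug fs t)"
  by (induction fs) (auto simp: plug_def)

text \<open>A change of height by at most one is handed on from each level to the next, since a
  child that changed by one differs from its sibling by at most two. One \<open>bal\<close> per
  level therefore repairs insertions and deletions alike.\<close>

lemma avl_rebuild:
  assumes "avl (plug fs t)" "avl t'" "hgt t' \<le> Suc (hgt t)" "hgt t \<le> Suc (hgt t')"
  shows "avl (rebuild fs t') \<and> hgt (rebuild fs t') \<le> Suc (hgt (plug fs t)) \<and>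
    hgt (plug fs t) \<le> Suc (hgt (rebuild fs t'))"
  using assms(1)
proof (induction fs)
  case Nil
  then show ?case using assms by (simp add: plug_def rebuild_def)
next
  case (Cons f fs)
  obtain left s where f: "f = (left, s)" by (cases f)
  define p q where "p = plug fs t" and "q = rebuild fs t'"
  have IH: "avl q" "hgt q \<le> Suc (hgt p)" "hgt p \<le> Suc (hgt q)"
    using Cons by (auto simp: p_def q_def f plug_def split: if_splits)
  show ?case
  proof (cases left)
    case True
    with Cons.prems have "avl p" "avl s" "hgt p \<le> Suc (hgt s)" "hgt s \<le> Suc (hgt p)"
      by (auto simp: p_def f plug_def)
    moreover have "plug (f # fs) t = Nd p s" "rebuild (f # fs) t' = bal q s"
      using True by (auto simp: f plug_def rebuild_def p_def q_def)
    ultimately show ?thesis using IH avl_bal[of q s] by auto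
  next
    case False
    with Cons.prems have "avl p" "avl s" "hgt p \<le> Suc (hgt s)" "hgt s \<le> Suc (hgt p)"
      by (auto simp: p_def f plug_def)
    moreover have "plug (f # fs) t = Nd s p" "rebuild (f # fs) t' = bal s q"
      using False by (auto simp: f plug_def rebuild_def p_def q_def)
    ultimately show ?thesis using IH avl_bal[of s q] by auto
  qed
qed

section \<open>AVL trees in memory\<close>

definition node_arrays :: "vname set" where
  "node_arrays = {''lf'', ''rt'', ''ht'', ''sz'', ''ky''}"

text \<open>Address 0 is never a node, so a root 0 can mean that there is no tree. Children have
  smaller addresses than their parent; hence a tree whose root lies below \<open>nx\<close> lies
  there entirely. The key of an inner node is its last element, which is the least one when the
  elements decrease.\<close>

fun rep :: "mem \<Rightarrow> nat \<Rightarrow> tree \<Rightarrow> bool" where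
  "rep \<sigma> v (Lf u) \<longleftrightarrow> 0 < v \<and> words \<sigma> ''ht'' v = 0 \<and> words \<sigma> ''sz'' v = 1 \<and> words \<sigma> ''ky'' v = u"
| "rep \<sigma> v (Nd l r) \<longleftrightarrow> 0 < v \<and> words \<sigma> ''ht'' v = hgt (Nd l r) \<and> words \<sigma> ''sz'' v = siz (Nd l r) \<and>
     words \<sigma> ''ky'' v = last (elems r) \<and> words \<sigma> ''lf'' v < v \<and> words \<sigma> ''rt'' v < v \<and>
     rep \<sigma> (words \<sigma> ''lf'' v) l \<and> rep \<sigma> (words \<sigma> ''rt'' v) r"

definition tree_at :: "mem \<Rightarrow> nat \<Rightarrow> tree \<Rightarrow> bool" where
  "tree_at \<sigma> v T \<longleftrightarrow> v < val \<sigma> ''nx'' \<and> rep \<sigma> v T"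

text \<open>Allocation only writes at addresses from \<open>nx\<close> on. This one relation
  preserves all existing trees at once (\<open>tree_at_extends\<close>), even if they share
  nodes.\<close>

definition extends :: "mem \<Rightarrow> mem \<Rightarrow> bool" where
  "extends \<sigma> \<sigma>' \<longleftrightarrow> val \<sigma> ''nx'' \<le> val \<sigma>' ''nx'' \<and>
     (\<forall>a\<in>node_arrays. \<forall>i<val \<sigma> ''nx''. words \<sigma>' a i = words \<sigma> a i)"

lemma extends_refl [simp]: "extends \<sigma> \<sigma>"
  by (simp add: extends_def)

lemma extends_trans: "extends \<sigma> \<sigma>' \<Longrightarrow> extends \<sigma>' \<sigma>'' \<Longrightarrow> extends \<sigma> \<sigma>''"
  unfolding extends_def by (force intro: order.trans)

lemma frame_extends: "frame S \<sigma> \<sigma>' \<Longrightarrow> S \<inter> insert ''nx'' node_arrays = {} \<Longrightarrow> extends \<sigma> \<sigma>'"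
  by (auto simp: extends_def frame_def disjoint_iff)

lemma extends_cong:
  assumes "\<And>a. a \<in> insert ''nx'' node_arrays \<Longrightarrow> words \<sigma>' a = words \<sigma>'' a"
  shows "extends \<sigma> \<sigma>' \<longleftrightarrow> extends \<sigma> \<sigma>''"
  unfolding extends_def using assms by (metis insertCI)

lemma extends_upd [simp]:
  assumes "a \<notin> insert ''nx'' node_arrays"
  shows "extends \<sigma> (upd a i v \<sigma>') \<longleftrightarrow> extends \<sigma> \<sigma>'"
proof (rule extends_cong)
  fix b assume "b \<in> insert ''nx'' node_arrays"
  with assms have "b \<noteq> a" by blast
  then show "words (upd a i v \<sigma>') b = words \<sigma>' b" by simp
qed

lemma extends_upd_node [simp]:
  assumes "a \<in> node_arrays" "val \<sigma> ''nx'' \<le> i"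
  shows "extends \<sigma> (upd a i v \<sigma>') \<longleftrightarrow> extends \<sigma> \<sigma>'"
proof -
  have "words (upd a i v \<sigma>') b j = words \<sigma>' b j" if "j < val \<sigma> ''nx''" for b j
    using that assms(2) by simp
  moreover have "a \<noteq> ''nx''" using assms(1) by (auto simp: node_arrays_def)
  ultimately show ?thesis unfolding extends_def by simp
qed

lemma extends_upd_nx [simp]:
  assumes "val \<sigma> ''nx'' \<le> v" "val \<sigma> ''nx'' \<le> val \<sigma>' ''nx''"
  shows "extends \<sigma> (upd ''nx'' 0 v \<sigma>') \<longleftrightarrow> extends \<sigma> \<sigma>'"
proof -
  have "b \<noteq> ''nx''" if "b \<in> node_arrays" for b
    using that by (auto simp: node_arrays_def)
  then show ?thesis unfolding extends_def using assms by simp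
qed

lemma rep_cong:
  "rep \<sigma> v T \<Longrightarrow> v < n \<Longrightarrow> (\<And>a i. a \<in> node_arrays \<Longrightarrow> i < n \<Longrightarrow> words \<sigma>' a i = words \<sigma> a i) \<Longrightarrow> rep \<sigma>' v T"
proof (induction T arbitrary: v)
  case (Lf u)
  then show ?case by (simp add: node_arrays_def)
next
  case (Nd l r)
  then have eq: "words \<sigma>' a v = words \<sigma> a v" if "a \<in> node_arrays" for a using that by blast
  have "words \<sigma> ''lf'' v < n" "words \<sigma> ''rt'' v < n" using Nd.prems by auto
  with Nd.IH Nd.prems have "rep \<sigma>' (words \<sigma> ''lf'' v) l" "rep \<sigma>' (words \<sigma> ''rt'' v) r" by auto
  with Nd.prems(1) show ?case by (simp add: eq node_arrays_def)
qed

lemma tree_at_extends: "extends \<sigma> \<sigma>' \<Longrightarrow> tree_at \<sigma> v T \<Longrightarrow> tree_at \<sigma>' v T"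
  unfolding extends_def tree_at_def using rep_cong[of \<sigma> v T "val \<sigma> ''nx''" \<sigma>'] by auto

lemma tree_at_upd [simp]:
  assumes "a \<notin> insert ''nx'' node_arrays"
  shows "tree_at (upd a i u \<sigma>) v T \<longleftrightarrow> tree_at \<sigma> v T"
proof -
  have "b \<noteq> a" if "b \<in> insert ''nx'' node_arrays" for b using that assms by blast
  then have "extends \<sigma> (upd a i u \<sigma>)" "extends (upd a i u \<sigma>) \<sigma>"
    unfolding extends_def by simp_all
  then show ?thesis using tree_at_extends by blast
qed

lemma tree_at_root:
  assumes "tree_at \<sigma> v T"
  shows "words \<sigma> ''ht'' v = hgt T" "words \<sigma> ''sz'' v = siz T" "words \<sigma> ''ky'' v = last (elems T)" "0 < v"
    "v < val \<sigma> ''nx''"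
  using assms unfolding tree_at_def by (cases T; simp)+

lemma tree_at_Nd:
  assumes "tree_at \<sigma> v (Nd l r)"
  shows "tree_at \<sigma> (words \<sigma> ''lf'' v) l" "tree_at \<sigma> (words \<sigma> ''rt'' v) r"
  using assms unfolding tree_at_def by auto

lemma node_arrays_iff [simp]:
  "a \<in> node_arrays \<longleftrightarrow> a = ''lf'' \<or> a = ''rt'' \<or> a = ''ht'' \<or> a = ''sz'' \<or> a = ''ky''"
  by (simp add: node_arrays_def)

definition mk_node :: "vname \<Rightarrow> vname \<Rightarrow> vname \<Rightarrow> com" where
  "mk_node a b c = Block
     [Store ''lf'' (Var ''nx'') (Var a),
      Store ''rt'' (Var ''nx'') (Var b),
      Cond (WLess (Load ''ht'' (Var a)) (Load ''ht'' (Var b)))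
        (Store ''ht'' (Var ''nx'') (Plus (Load ''ht'' (Var b)) (Num 1)))
        (Store ''ht'' (Var ''nx'') (Plus (Load ''ht'' (Var a)) (Num 1))),
      Store ''sz'' (Var ''nx'') (Plus (Load ''sz'' (Var a)) (Load ''sz'' (Var b))),
      Store ''ky'' (Var ''nx'') (Load ''ky'' (Var b)),
      Set c (Var ''nx''),
      Set ''nx'' (Plus (Var ''nx'') (Num 1))]"

lemma wp_mk_node:
  assumes A: "tree_at \<sigma> (val \<sigma> a) A" and B: "tree_at \<sigma> (val \<sigma> b) B"
    and names: "a \<notin> insert ''nx'' node_arrays" "b \<notin> insert ''nx'' node_arrays" "c \<notin> insert ''nx'' node_arrays"
    and fits: "siz A + siz B \<le> W" "val \<sigma> ''nx'' < W"
    and Q: "\<And>t \<sigma>'. t \<le> 60 \<Longrightarrow> tree_at \<sigma>' (val \<sigma>' c) (Nd A B) \<Longrightarrow> val \<sigma>' ''nx'' = Suc (val \<sigma> ''nx'') \<Longrightarrow>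
       extends \<sigma> \<sigma>' \<Longrightarrow> frame (insert c (insert ''nx'' node_arrays)) \<sigma> \<sigma>' \<Longrightarrow> Q t \<sigma>'"
  shows "wp W (mk_node a b c) \<sigma> Q"
proof -
  have sym: "d \<noteq> c" if "d \<in> insert ''nx'' node_arrays" for d using that names(3) by blast
  define n where "n = val \<sigma> ''nx''"
  have lt: "val \<sigma> a < n" "val \<sigma> b < n" "0 < n"
    using tree_at_root[OF A] tree_at_root[OF B] by (simp_all add: n_def)
  have h: "hgt A < W" "hgt B < W" "1 \<le> W" "Suc n \<le> W"
    using hgt_less_siz[of A] hgt_less_siz[of B] fits unfolding n_def by linarith+
  have tr: "tree_at \<sigma>' v (Nd A B)"
    if "extends \<sigma> \<sigma>'" "val \<sigma>' ''nx'' = Suc n" "v = n" "words \<sigma>' ''lf'' n = val \<sigma> a" "words \<sigma>' ''rt'' n = val \<sigma> b"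
      "words \<sigma>' ''ht'' n = Suc (max (hgt A) (hgt B))" "words \<sigma>' ''sz'' n = siz A + siz B"
      "words \<sigma>' ''ky'' n = last (elems B)" for \<sigma>' v
    using tree_at_extends[OF that(1) A] tree_at_extends[OF that(1) B] that(2-) lt by (simp add: tree_at_def)
  have "wp W (mk_node a b c) \<sigma> (\<lambda>t \<sigma>'. t \<le> 60 \<and> tree_at \<sigma>' (val \<sigma>' c) (Nd A B) \<and>
      val \<sigma>' ''nx'' = Suc (val \<sigma> ''nx'') \<and> extends \<sigma> \<sigma>' \<and> frame (insert c (insert ''nx'' node_arrays)) \<sigma> \<sigma>')"
    using names sym lt h fits
    by (simp add: mk_node_def tree_at_root[OF A] tree_at_root[OF B] n_def[symmetric] tr max_def)
  then show ?thesis by (rule wp_mono) (use Q in blast)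
qed

definition mk_leaf :: "vname \<Rightarrow> vname \<Rightarrow> com" where
  "mk_leaf a c = Block
     [Store ''ht'' (Var ''nx'') (Num 0),
      Store ''sz'' (Var ''nx'') (Num 1),
      Store ''ky'' (Var ''nx'') (Var a),
      Set c (Var ''nx''),
      Set ''nx'' (Plus (Var ''nx'') (Num 1))]"

lemma wp_mk_leaf:
  assumes names: "a \<notin> insert ''nx'' node_arrays" "c \<notin> insert ''nx'' node_arrays"
    and fits: "0 < val \<sigma> ''nx''" "val \<sigma> ''nx'' < W"
    and Q: "\<And>t \<sigma>'. t \<le> 30 \<Longrightarrow> tree_at \<sigma>' (val \<sigma>' c) (Lf (val \<sigma> a)) \<Longrightarrow> val \<sigma>' ''nx'' = Suc (val \<sigma> ''nx'') \<Longrightarrow>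
       extends \<sigma> \<sigma>' \<Longrightarrow> frame (insert c (insert ''nx'' node_arrays)) \<sigma> \<sigma>' \<Longrightarrow> Q t \<sigma>'"
  shows "wp W (mk_leaf a c) \<sigma> Q"
proof -
  have sym: "b \<noteq> c" if "b \<in> insert ''nx'' node_arrays" for b using that names(2) by blast
  have "wp W (mk_leaf a c) \<sigma> (\<lambda>t \<sigma>'. t \<le> 30 \<and> tree_at \<sigma>' (val \<sigma>' c) (Lf (val \<sigma> a)) \<and>
      val \<sigma>' ''nx'' = Suc (val \<sigma> ''nx'') \<and> extends \<sigma> \<sigma>' \<and> frame (insert c (insert ''nx'' node_arrays)) \<sigma> \<sigma>')"
    using names sym fits by (simp add: mk_leaf_def tree_at_def)
  then show ?thesis by (rule wp_mono) (use Q in blast)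
qed

definition balance :: com where
  "balance =
     Cond (WLess (Plus (Load ''ht'' (Var ''b'')) (Num 1)) (Load ''ht'' (Var ''a'')))
       (Block [Set ''u'' (Load ''lf'' (Var ''a'')), Set ''w'' (Load ''rt'' (Var ''a'')),
         Cond (WLess (Load ''ht'' (Var ''u'')) (Load ''ht'' (Var ''w'')))
           (Block [Set ''x'' (Load ''lf'' (Var ''w'')), Set ''y'' (Load ''rt'' (Var ''w'')),
             mk_node ''u'' ''x'' ''p'', mk_node ''y'' ''b'' ''q'', mk_node ''p'' ''q'' ''cur''])
           (Block [mk_node ''w'' ''b'' ''q'', mk_node ''u'' ''q'' ''cur''])])
     (Cond (WLess (Plus (Load ''ht'' (Var ''a'')) (Num 1)) (Load ''ht'' (Var ''b'')))
       (Block [Set ''w'' (Load ''lf'' (Var ''b'')), Set ''u'' (Load ''rt'' (Var ''b'')),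
         Cond (WLess (Load ''ht'' (Var ''u'')) (Load ''ht'' (Var ''w'')))
           (Block [Set ''x'' (Load ''lf'' (Var ''w'')), Set ''y'' (Load ''rt'' (Var ''w'')),
             mk_node ''a'' ''x'' ''p'', mk_node ''y'' ''u'' ''q'', mk_node ''p'' ''q'' ''cur''])
           (Block [mk_node ''a'' ''w'' ''p'', mk_node ''p'' ''u'' ''cur''])])
     (mk_node ''a'' ''b'' ''cur''))"

definition balance_vars :: "vname set" where
  "balance_vars = {''cur'', ''u'', ''w'', ''x'', ''y'', ''p'', ''q'', ''nx''} \<union> node_arrays"

lemma frame_mono: "frame S \<sigma> \<sigma>' \<Longrightarrow> S \<subseteq> R \<Longrightarrow> frame R \<sigma> \<sigma>'"
  by (auto simp: frame_def)

text \<open>State in the midst of a rebalancing that began in \<open>\<rho>\<close>: k nodes have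
  been allocated, and m records which variables hold which trees. It lets several calls of
  \<open>mk_node\<close> be chained without restating what each one preserves.\<close>

definition building :: "mem \<Rightarrow> nat \<Rightarrow> mem \<Rightarrow> (vname \<Rightarrow> tree option) \<Rightarrow> bool" where
  "building \<rho> k \<sigma> m \<longleftrightarrow> extends \<rho> \<sigma> \<and> val \<sigma> ''nx'' = val \<rho> ''nx'' + k \<and> frame balance_vars \<rho> \<sigma> \<and>
     (\<forall>a T. m a = Some T \<longrightarrow> tree_at \<sigma> (val \<sigma> a) T \<and> a \<notin> insert ''nx'' node_arrays)"

lemma building_tree: "building \<rho> k \<sigma> m \<Longrightarrow> m a = Some T \<Longrightarrow> tree_at \<sigma> (val \<sigma> a) T"
  by (auto simp: building_def)

lemma building_upd:
  assumes "building \<rho> k \<sigma> m" "tree_at \<sigma> v T" "c \<in> balance_vars - insert ''nx'' node_arrays"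
  shows "building \<rho> k (upd c 0 v \<sigma>) (m(c \<mapsto> T))"
proof -
  have "c \<noteq> ''nx''" "c \<notin> insert ''nx'' node_arrays" "c \<in> balance_vars" using assms(3) by auto
  then show ?thesis using assms(1,2) unfolding building_def by (simp del: node_arrays_iff)
qed

lemma wp_building:
  assumes b: "building \<rho> k \<sigma> m" and m: "m a = Some A" "m b = Some B"
    and c: "c \<in> balance_vars - insert ''nx'' node_arrays"
    and fits: "siz A + siz B \<le> W" "val \<rho> ''nx'' + k < W"
    and Q: "\<And>t \<sigma>'. t \<le> 60 \<Longrightarrow> building \<rho> (Suc k) \<sigma>' (m(c \<mapsto> Nd A B)) \<Longrightarrow> Q t \<sigma>'"
  shows "wp W (mk_node a b c) \<sigma> Q"
proof (rule wp_mk_node[OF building_tree[OF b m(1)] building_tree[OF b m(2)]], goal_cases)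
  case (6 t \<sigma>')
  have "tree_at \<sigma>' (val \<sigma>' d) T" if "m d = Some T" "d \<noteq> c" for d T
  proof -
    have "d \<notin> insert ''nx'' node_arrays" "tree_at \<sigma> (val \<sigma> d) T"
      using b that by (auto simp: building_def)
    then show ?thesis using tree_at_extends[OF 6(4)] frame_words[OF 6(5), of d] that by simp
  qed
  moreover have "extends \<rho> \<sigma>'" using b 6(4) extends_trans by (auto simp: building_def)
  moreover have "frame balance_vars \<rho> \<sigma>'"
  proof -
    have "insert c (insert ''nx'' node_arrays) \<subseteq> balance_vars" using c by (auto simp: balance_vars_def)
    then show ?thesis using frame_trans[OF _ 6(5) order_refl] b unfolding building_def by blast
  qed
  ultimately have "building \<rho> (Suc k) \<sigma>' (m(c \<mapsto> Nd A B))"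
    using 6(2,3) b c unfolding building_def by (simp del: node_arrays_iff)
  then show ?case using Q 6(1) by blast
qed (use b m c fits in \<open>simp_all add: building_def del: node_arrays_iff\<close>)

lemma wp_balance:
  assumes A: "tree_at \<sigma> (val \<sigma> ''a'') A" and B: "tree_at \<sigma> (val \<sigma> ''b'') B"
    and fits: "siz A + siz B \<le> W" "val \<sigma> ''nx'' + 3 \<le> W"
    and Q: "\<And>t \<sigma>'. t \<le> 300 \<Longrightarrow> tree_at \<sigma>' (val \<sigma>' ''cur'') (bal A B) \<Longrightarrow> val \<sigma>' ''nx'' \<le> val \<sigma> ''nx'' + 3 \<Longrightarrow>
       extends \<sigma> \<sigma>' \<Longrightarrow> frame balance_vars \<sigma> \<sigma>' \<Longrightarrow> Q t \<sigma>'"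
  shows "wp W balance \<sigma> Q"
proof -
  have start: "building \<sigma> 0 \<sigma> [''a'' \<mapsto> A, ''b'' \<mapsto> B]"
    using A B by (simp add: building_def)
  have fin: "Q t \<sigma>'" if "t \<le> 300" "building \<sigma> k \<sigma>' m" "m ''cur'' = Some (bal A B)" "k \<le> 3" for t \<sigma>' k m
    using that by (intro Q) (auto simp: building_def)
  have h: "hgt A < W" "hgt B < W" "siz A \<le> W" "siz B \<le> W"
    using hgt_less_siz[of A] hgt_less_siz[of B] fits by linarith+
  have vars: "{''cur'', ''p'', ''q''} \<subseteq> balance_vars - insert ''nx'' node_arrays"
    "{''u'', ''w'', ''x'', ''y''} \<subseteq> balance_vars"
    by (simp_all add: balance_vars_def)
  have nx: "val \<sigma> ''nx'' + 0 < W" "val \<sigma> ''nx'' + Suc 0 < W" "val \<sigma> ''nx'' + Suc (Suc 0) < W"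
    using fits(2) by simp_all
  note roots = tree_at_root[OF A] tree_at_root[OF B]
  consider (left) "Suc (hgt B) < hgt A" | (right) "\<not> Suc (hgt B) < hgt A" "Suc (hgt A) < hgt B"
    | (mid) "\<not> Suc (hgt B) < hgt A" "\<not> Suc (hgt A) < hgt B" by blast
  then show ?thesis
  proof cases
    case left
    then obtain u w where l: "A = Nd u w" by (cases A) auto
    note tu = tree_at_Nd(1)[OF A[unfolded l]] and tw = tree_at_Nd(2)[OF A[unfolded l]]
    show ?thesis
    proof (cases "hgt u < hgt w")
      case True
      then obtain x y where w: "w = Nd x y" by (cases w) auto
      note tx = tree_at_Nd(1)[OF tw[unfolded w]] and ty = tree_at_Nd(2)[OF tw[unfolded w]]
      have sz: "siz u + siz x \<le> W" "siz y + siz B \<le> W" "siz (Nd u x) + siz (Nd y B) \<le> W"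
        using fits(1) by (simp_all add: l w)
      show ?thesis using left True h fits(2)
        apply (simp add: balance_def roots tree_at_root[OF tu] tree_at_root[OF tw])
        apply (rule wp_building[where m = "[''u'' \<mapsto> u, ''x'' \<mapsto> x, ''y'' \<mapsto> y, ''b'' \<mapsto> B]" and k = 0 and \<rho> = \<sigma>, OF _ _ _ _ sz(1) nx(1)])
        using B tu tw tx ty vars
           apply (simp_all add: building_def l w)[4]
        apply (erule wp_building[OF _ _ _ _ sz(2) nx(2)])
        using vars apply simp_all[3]
        apply (erule wp_building[OF _ _ _ _ sz(3) nx(3)])
        using vars apply simp_all[3]
        apply (erule fin[rotated])
        apply (simp_all add: bal_def l w)
        done
    next
      case False
      have sz: "siz w + siz B \<le> W" "siz u + siz (Nd w B) \<le> W"
        using fits(1) by (simp_all add: l)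
      show ?thesis using left False h fits(2)
        apply (simp add: balance_def roots tree_at_root[OF tu] tree_at_root[OF tw])
        apply (rule wp_building[where m = "[''u'' \<mapsto> u, ''w'' \<mapsto> w, ''b'' \<mapsto> B]" and k = 0 and \<rho> = \<sigma>, OF _ _ _ _ sz(1) nx(1)])
        using B tu tw vars
           apply (simp_all add: building_def l)[4]
        apply (erule wp_building[OF _ _ _ _ sz(2) nx(2)])
        using vars apply simp_all[3]
        apply (erule fin[rotated])
        apply (simp_all add: bal_def l)
        done
    qed
  next
    case right
    then obtain u w where r: "B = Nd w u" by (cases B) auto
    note tu = tree_at_Nd(2)[OF B[unfolded r]] and tw = tree_at_Nd(1)[OF B[unfolded r]]
    show ?thesis
    proof (cases "hgt u < hgt w")
      case True
      then obtain x y where w: "w = Nd x y" by (cases w) auto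
      note tx = tree_at_Nd(1)[OF tw[unfolded w]] and ty = tree_at_Nd(2)[OF tw[unfolded w]]
      have sz: "siz A + siz x \<le> W" "siz y + siz u \<le> W" "siz (Nd A x) + siz (Nd y u) \<le> W"
        using fits(1) by (simp_all add: r w)
      show ?thesis using right True h fits(2)
        apply (simp add: balance_def roots tree_at_root[OF tu] tree_at_root[OF tw])
        apply (rule wp_building[where m = "[''u'' \<mapsto> u, ''x'' \<mapsto> x, ''y'' \<mapsto> y, ''a'' \<mapsto> A]" and k = 0 and \<rho> = \<sigma>, OF _ _ _ _ sz(1) nx(1)])
        using A tu tw tx ty vars
           apply (simp_all add: building_def r w)[4]
        apply (erule wp_building[OF _ _ _ _ sz(2) nx(2)])
        using vars apply simp_all[3]
        apply (erule wp_building[OF _ _ _ _ sz(3) nx(3)])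
        using vars apply simp_all[3]
        apply (erule fin[rotated])
        apply (simp_all add: bal_def r w)
        done
    next
      case False
      have sz: "siz A + siz w \<le> W" "siz (Nd A w) + siz u \<le> W"
        using fits(1) by (simp_all add: r)
      show ?thesis using right False h fits(2)
        apply (simp add: balance_def roots tree_at_root[OF tu] tree_at_root[OF tw])
        apply (rule wp_building[where m = "[''u'' \<mapsto> u, ''w'' \<mapsto> w, ''a'' \<mapsto> A]" and k = 0 and \<rho> = \<sigma>, OF _ _ _ _ sz(1) nx(1)])
        using A tu tw vars
           apply (simp_all add: building_def r)[4]
        apply (erule wp_building[OF _ _ _ _ sz(2) nx(2)])
        using vars apply simp_all[3]
        apply (erule fin[rotated])
        apply (simp_all add: bal_def r)
        done
    qed
  next
    case mid
    then show ?thesis using h fits(2)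
      apply (simp add: balance_def roots)
      apply (rule wp_building[OF start _ _ _ fits(1) nx(1)])
      using vars apply simp_all[3]
      apply (erule fin[rotated])
      apply (simp_all add: bal_def)
      done
  qed
qed

section \<open>Insertion and deletion by position\<close>

definition ascend :: com where
  "ascend = While (WLess (Num 0) (Var ''sp''))
     (Block [Set ''sp'' (Minus (Var ''sp'') (Num 1)),
       Cond (WLess (Num 0) (Load ''sd'' (Var ''sp'')))
         (Block [Set ''a'' (Load ''sn'' (Var ''sp'')), Set ''b'' (Var ''cur'')])
         (Block [Set ''a'' (Var ''cur''), Set ''b'' (Load ''sn'' (Var ''sp''))]),
       balance])"

definition stack_at :: "mem \<Rightarrow> (bool \<times> tree) list \<Rightarrow> bool" where
  "stack_at \<sigma> fs \<longleftrightarrow> (\<forall>i<length fs. tree_at \<sigma> (words \<sigma> ''sn'' i) (snd (fs ! i)) \<and>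
     (words \<sigma> ''sd'' i = 0 \<longleftrightarrow> fst (fs ! i)))"

definition ascend_vars :: "vname set" where
  "ascend_vars = {''sp'', ''a'', ''b''} \<union> balance_vars"

lemma rebuild_snoc: "rebuild (fs @ [(left, s)]) t = rebuild fs (if left then bal t s else bal s t)"
  by (simp add: rebuild_def)

lemma plug_snoc: "plug (fs @ [(left, s)]) t = plug fs (if left then Nd t s else Nd s t)"
  by (simp add: plug_def)

text \<open>The context lies on the stack from the root down and is consumed from its end.
  Invariant: rebuilding the remaining prefix around the current tree yields the final result. The
  factor 3 is the number of nodes made by a double rotation.\<close>

lemma wp_ascend:
  assumes st: "stack_at \<sigma> fs" "val \<sigma> ''sp'' = length fs" and T: "tree_at \<sigma> (val \<sigma> ''cur'') T"
    and fits: "siz (plug fs T) \<le> W" "val \<sigma> ''nx'' + 3 * length fs \<le> W"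
    and Q: "\<And>t \<sigma>'. t \<le> 400 * length fs + 10 \<Longrightarrow> tree_at \<sigma>' (val \<sigma>' ''cur'') (rebuild fs T) \<Longrightarrow>
       val \<sigma>' ''nx'' \<le> val \<sigma> ''nx'' + 3 * length fs \<Longrightarrow>
       extends \<sigma> \<sigma>' \<Longrightarrow> frame ascend_vars \<sigma> \<sigma>' \<Longrightarrow> Q t \<sigma>'"
  shows "wp W ascend \<sigma> Q"
proof -
  define I where "I \<tau> \<longleftrightarrow> val \<tau> ''sp'' \<le> length fs \<and>
    (\<exists>t. tree_at \<tau> (val \<tau> ''cur'') t \<and> rebuild fs T = rebuild (take (val \<tau> ''sp'') fs) t \<and>
       siz (plug (take (val \<tau> ''sp'') fs) t) \<le> W) \<and>
    val \<tau> ''nx'' + 3 * val \<tau> ''sp'' \<le> val \<sigma> ''nx'' + 3 * length fs \<and> extends \<sigma> \<tau> \<and> frame ascend_vars \<sigma> \<tau>" for \<tau>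
  have W: "1 \<le> W" using fits(1) siz_pos[of "plug fs T"] by linarith
  show ?thesis unfolding ascend_def
  proof (rule wp_while_post[where I = I and \<mu> = "\<lambda>\<tau>. val \<tau> ''sp''" and c = 350])
    show "I \<sigma>" using st T fits by (auto simp: I_def)
  next
    fix \<tau> assume "I \<tau>"
    then show "bsafe W (WLess (Num 0) (Var ''sp'')) \<tau>" using W by simp
  next
    fix \<tau> assume I: "I \<tau>" and "bval (WLess (Num 0) (Var ''sp'')) \<tau>"
    then obtain k where k: "val \<tau> ''sp'' = Suc k" by (cases "val \<tau> ''sp''") auto
    obtain t where t: "tree_at \<tau> (val \<tau> ''cur'') t" "rebuild fs T = rebuild (take (Suc k) fs) t"
        "siz (plug (take (Suc k) fs) t) \<le> W" and len: "k < length fs"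
      and nx: "val \<tau> ''nx'' + 3 * Suc k \<le> val \<sigma> ''nx'' + 3 * length fs"
      and ext: "extends \<sigma> \<tau>" and fr: "frame ascend_vars \<sigma> \<tau>"
      using I k unfolding I_def by auto
    obtain left s where f: "fs ! k = (left, s)" by (cases "fs ! k")
    have take: "take (Suc k) fs = take k fs @ [(left, s)]" using len f by (simp add: take_Suc_conv_app_nth)
    have sn: "words \<tau> ''sn'' = words \<sigma> ''sn''" "words \<tau> ''sd'' = words \<sigma> ''sd''"
      using fr by (simp_all add: frame_def ascend_vars_def balance_vars_def)
    have s: "tree_at \<tau> (words \<tau> ''sn'' k) s" "words \<tau> ''sd'' k = 0 \<longleftrightarrow> left"
      using st(1) len f tree_at_extends[OF ext] unfolding stack_at_def sn by auto
    have sizes: "siz s + siz t \<le> W" "siz t + siz s \<le> W" using t(3) by (simp_all add: take plug_snoc elems_plug split: if_splits)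
    have goal: "I \<upsilon> \<and> val \<upsilon> ''sp'' < val \<tau> ''sp''"
      if "tree_at \<upsilon> (val \<upsilon> ''cur'') (if left then bal t s else bal s t)" "val \<upsilon> ''nx'' \<le> val \<tau> ''nx'' + 3"
        "extends \<rho> \<upsilon>" "extends \<tau> \<rho>" "frame balance_vars \<rho> \<upsilon>" "frame {''sp'', ''a'', ''b''} \<tau> \<rho>" "val \<rho> ''sp'' = k"
      for \<rho> \<upsilon>
    proof -
      have "val \<upsilon> ''sp'' = k" using that(5,7) by (simp add: frame_def balance_vars_def)
      moreover have "extends \<sigma> \<upsilon>" using ext that(3,4) extends_trans by blast
      moreover have "frame ascend_vars \<sigma> \<upsilon>"
        using frame_trans[OF fr frame_trans[OF that(6,5)], of ascend_vars ascend_vars]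
        by (auto simp: ascend_vars_def)
      moreover have "siz (plug (take k fs) (if left then bal t s else bal s t)) \<le> W"
        using t(3) by (simp add: take plug_snoc elems_plug split: if_splits)
      ultimately show ?thesis using that(1,2) nx len k t(2) unfolding I_def
        by (auto simp: take rebuild_snoc)
    qed
    show "wp W (Block [Set ''sp'' (Minus (Var ''sp'') (Num 1)),
       Cond (WLess (Num 0) (Load ''sd'' (Var ''sp'')))
         (Block [Set ''a'' (Load ''sn'' (Var ''sp'')), Set ''b'' (Var ''cur'')])
         (Block [Set ''a'' (Var ''cur''), Set ''b'' (Load ''sn'' (Var ''sp''))]),
       balance]) \<tau> (\<lambda>t \<sigma>'. t \<le> 350 \<and> I \<sigma>' \<and> val \<sigma>' ''sp'' < val \<tau> ''sp'')"
    proof (cases left)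
      case True
      show ?thesis using W s True
        apply (simp add: k)
        apply (rule wp_balance[of _ t s])
        using t(1) s sizes fits(2) nx k apply (simp_all)[4]
        apply (intro conjI, simp)
         apply (erule goal[THEN conjunct1, rotated 2]; simp)
        apply (drule goal[THEN conjunct2, rotated 2]; simp add: k)
        done
    next
      case False
      show ?thesis using W s False
        apply (simp add: k)
        apply (rule wp_balance[of _ s t])
        using t(1) s sizes fits(2) nx k apply (simp_all)[4]
        apply (intro conjI, simp)
         apply (erule goal[THEN conjunct1, rotated 2]; simp)
        apply (drule goal[THEN conjunct2, rotated 2]; simp add: k)
        done
    qed
  next
    fix t \<sigma>'
    assume "t \<le> (1 + bcost (WLess (Num 0) (Var ''sp'')) + 350) * val \<sigma> ''sp'' + (1 + bcost (WLess (Num 0) (Var ''sp'')))"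
      "I \<sigma>'" "\<not> bval (WLess (Num 0) (Var ''sp'')) \<sigma>'"
    then show "Q t \<sigma>'" using st(2) by (intro Q) (auto simp: I_def rebuild_def)
  qed
qed

text \<open>One search serves both edits: with \<open>e = 0\<close> the index names one of n
  elements, with \<open>e = 1\<close> one of the \<open>n + 1\<close> gaps between them. A gap at
  the border of two subtrees is assigned to the left one, and at the leaf the remaining index 0 or 1
  tells on which side of it the gap lies.\<close>

definition descend :: com where
  "descend = While (WLess (Num 0) (Load ''ht'' (Var ''cur'')))
     (Block [
       Cond (WLess (Var ''idx'') (Plus (Load ''sz'' (Load ''lf'' (Var ''cur''))) (Var ''e'')))
         (Block [Store ''sn'' (Var ''sp'') (Load ''rt'' (Var ''cur'')),
           Store ''sd'' (Var ''sp'') (Num 0),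
           Set ''cur'' (Load ''lf'' (Var ''cur''))])
         (Block [Set ''idx'' (Minus (Var ''idx'') (Load ''sz'' (Load ''lf'' (Var ''cur'')))),
           Store ''sn'' (Var ''sp'') (Load ''lf'' (Var ''cur'')),
           Store ''sd'' (Var ''sp'') (Num 1),
           Set ''cur'' (Load ''rt'' (Var ''cur''))]),
       Set ''sp'' (Plus (Var ''sp'') (Num 1))])"

definition descend_vars :: "vname set" where
  "descend_vars = {''sn'', ''sd'', ''sp'', ''cur'', ''idx''}"

lemma stack_at_push:
  assumes "stack_at \<sigma> fs" "tree_at \<sigma> v s" "d = 0 \<longleftrightarrow> left" "k = length fs"
  shows "stack_at (upd ''sd'' k d (upd ''sn'' k v \<sigma>)) (fs @ [(left, s)])"
  using assms unfolding stack_at_def by (auto simp: nth_append less_Suc_eq)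

lemma stack_at_upd [simp]:
  "a \<notin> insert ''nx'' node_arrays \<Longrightarrow> a \<noteq> ''sn'' \<Longrightarrow> a \<noteq> ''sd'' \<Longrightarrow> stack_at (upd a i v \<sigma>) fs \<longleftrightarrow> stack_at \<sigma> fs"
  unfolding stack_at_def using tree_at_upd[of a] by (simp del: node_arrays_iff)

lemma wp_descend:
  assumes T: "tree_at \<sigma> (val \<sigma> ''cur'') T" and e: "val \<sigma> ''e'' \<le> 1" and idx: "val \<sigma> ''idx'' < siz T + val \<sigma> ''e''"
    and sp: "val \<sigma> ''sp'' = 0" and fits: "siz T < W"
    and Q: "\<And>t \<sigma>' fs u. t \<le> 60 * hgt T + 10 \<Longrightarrow> stack_at \<sigma>' fs \<Longrightarrow> val \<sigma>' ''sp'' = length fs \<Longrightarrow>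
       tree_at \<sigma>' (val \<sigma>' ''cur'') (Lf u) \<Longrightarrow> plug fs (Lf u) = T \<Longrightarrow>
       length (elems_before fs) + val \<sigma>' ''idx'' = val \<sigma> ''idx'' \<Longrightarrow> val \<sigma>' ''idx'' < Suc (val \<sigma> ''e'') \<Longrightarrow>
       frame descend_vars \<sigma> \<sigma>' \<Longrightarrow> Q t \<sigma>'"
  shows "wp W descend \<sigma> Q"
proof -
  define P where "P \<tau> fs t \<longleftrightarrow> stack_at \<tau> fs \<and> val \<tau> ''sp'' = length fs \<and> tree_at \<tau> (val \<tau> ''cur'') t \<and> plug fs t = T \<and>
    length (elems_before fs) + val \<tau> ''idx'' = val \<sigma> ''idx'' \<and> val \<tau> ''idx'' < siz t + val \<sigma> ''e'' \<and>
    frame descend_vars \<sigma> \<tau>" for \<tau> fs t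
  let ?b = "WLess (Num 0) (Load ''ht'' (Var ''cur''))"
  show ?thesis unfolding descend_def
  proof (rule wp_while_post[where I = "\<lambda>\<tau>. \<exists>fs t. P \<tau> fs t" and \<mu> = "\<lambda>\<tau>. words \<tau> ''ht'' (val \<tau> ''cur'')" and c = 45])
    have "P \<sigma> [] T" using T idx sp by (simp add: P_def stack_at_def plug_def elems_before_def)
    then show "\<exists>fs t. P \<sigma> fs t" by blast
  next
    fix \<tau> show "bsafe W ?b \<tau>" using fits by simp
  next
    fix \<tau> assume "\<exists>fs t. P \<tau> fs t" "bval ?b \<tau>"
    then obtain fs t where Pt: "P \<tau> fs t" and pos: "0 < words \<tau> ''ht'' (val \<tau> ''cur'')" by auto
    have t: "tree_at \<tau> (val \<tau> ''cur'') t" using Pt by (simp add: P_def)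
    obtain l r where lr: "t = Nd l r" using pos tree_at_root(1)[OF t] by (cases t) auto
    note l = tree_at_Nd(1)[OF t[unfolded lr]] and r = tree_at_Nd(2)[OF t[unfolded lr]]
    have e_eq: "val \<tau> ''e'' = val \<sigma> ''e''" using Pt by (simp add: P_def frame_def descend_vars_def)
    have len: "length fs + hgt t \<le> hgt T" using hgt_plug[of fs t] Pt by (simp add: P_def)
    then have sp1: "Suc (length fs) \<le> W" using hgt_less_siz[of T] fits by linarith
    have "siz t \<le> siz T" using Pt elems_plug[of fs t] by (auto simp: P_def)
    then have szl: "siz l + val \<sigma> ''e'' \<le> W" using fits e by (simp add: lr)
    note facts = Pt[unfolded P_def] lr
    have left: "P (upd ''sp'' 0 (Suc (length fs)) (upd ''cur'' 0 (words \<tau> ''lf'' (val \<tau> ''cur''))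
        (upd ''sd'' (length fs) 0 (upd ''sn'' (length fs) (words \<tau> ''rt'' (val \<tau> ''cur'')) \<tau>)))) (fs @ [(True, r)]) l"
      if "val \<tau> ''idx'' < siz l + val \<sigma> ''e''"
      using facts l stack_at_push[of \<tau> fs _ r 0 True "length fs", OF _ r] that unfolding P_def
      by (simp add: plug_snoc elems_before_def descend_vars_def)
    have idx: "val \<tau> ''idx'' - siz l < siz r + val \<sigma> ''e''" "siz l \<le> val \<tau> ''idx''"
      if "\<not> val \<tau> ''idx'' < siz l + val \<sigma> ''e''"
    proof -
      have "val \<tau> ''idx'' < siz l + siz r + val \<sigma> ''e''" using Pt by (simp add: P_def lr)
      then show "val \<tau> ''idx'' - siz l < siz r + val \<sigma> ''e''" "siz l \<le> val \<tau> ''idx''" using that by linarith+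
    qed
    have right: "P (upd ''sp'' 0 (Suc (length fs)) (upd ''cur'' 0 (words \<tau> ''rt'' (val \<tau> ''cur''))
        (upd ''sd'' (length fs) (Suc 0) (upd ''sn'' (length fs) (words \<tau> ''lf'' (val \<tau> ''cur''))
         (upd ''idx'' 0 (val \<tau> ''idx'' - siz l) \<tau>))))) (fs @ [(False, l)]) r"
      if "\<not> val \<tau> ''idx'' < siz l + val \<sigma> ''e''"
      using facts l r stack_at_push[of "upd ''idx'' 0 (val \<tau> ''idx'' - siz l) \<tau>" fs _ l 1 False "length fs"] idx[OF that] unfolding P_def
      by (simp add: plug_snoc elems_before_def descend_vars_def)
    have spl: "val \<tau> ''sp'' = length fs" using facts by simp
    have ht: "hgt l < hgt t" "hgt r < hgt t" by (simp_all add: lr)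
    show "wp W (Block [
       Cond (WLess (Var ''idx'') (Plus (Load ''sz'' (Load ''lf'' (Var ''cur''))) (Var ''e'')))
         (Block [Store ''sn'' (Var ''sp'') (Load ''rt'' (Var ''cur'')),
           Store ''sd'' (Var ''sp'') (Num 0),
           Set ''cur'' (Load ''lf'' (Var ''cur''))])
         (Block [Set ''idx'' (Minus (Var ''idx'') (Load ''sz'' (Load ''lf'' (Var ''cur'')))),
           Store ''sn'' (Var ''sp'') (Load ''lf'' (Var ''cur'')),
           Store ''sd'' (Var ''sp'') (Num 1),
           Set ''cur'' (Load ''rt'' (Var ''cur''))]),
       Set ''sp'' (Plus (Var ''sp'') (Num 1))]) \<tau>
      (\<lambda>t \<sigma>'. t \<le> 45 \<and> (\<exists>fs t. P \<sigma>' fs t) \<and>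
        words \<sigma>' ''ht'' (val \<sigma>' ''cur'') < words \<tau> ''ht'' (val \<tau> ''cur''))"
    proof (cases "val \<tau> ''idx'' < siz l + val \<sigma> ''e''")
      case True
      show ?thesis using szl sp1 ht left[OF True] True
        by (simp add: e_eq spl tree_at_root[OF l] tree_at_root[OF r] tree_at_root[OF t]) blast
    next
      case False
      show ?thesis using szl sp1 ht right[OF False] False
        by (simp add: e_eq spl tree_at_root[OF l] tree_at_root[OF r] tree_at_root[OF t]) blast
    qed
  next
    fix t \<sigma>' assume "t \<le> (1 + bcost ?b + 45) * words \<sigma> ''ht'' (val \<sigma> ''cur'') + (1 + bcost ?b)"
      "\<exists>fs t. P \<sigma>' fs t" "\<not> bval ?b \<sigma>'"
    then obtain fs s where s: "P \<sigma>' fs s" "words \<sigma>' ''ht'' (val \<sigma>' ''cur'') = 0" "t \<le> 60 * hgt T + 10"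
      using tree_at_root[OF T] by auto
    then have "hgt s = 0" using tree_at_root(1)[of \<sigma>' "val \<sigma>' ''cur''" s] by (simp add: P_def)
    then obtain u where "s = Lf u" by (cases s) auto
    then show "Q t \<sigma>'" using s unfolding P_def by (intro Q) auto
  qed
qed

definition delete_at :: com where
  "delete_at = Block
     [Set ''e'' (Num 0), Set ''sp'' (Num 0), descend,
      Set ''out'' (Load ''ky'' (Var ''cur'')),
      Set ''sp'' (Minus (Var ''sp'') (Num 1)),
      Set ''cur'' (Load ''sn'' (Var ''sp'')),
      ascend]"

definition insert_at :: com where
  "insert_at = Block
     [Set ''e'' (Num 1), Set ''sp'' (Num 0), descend,
      mk_leaf ''val'' ''q'',
      Cond (WLess (Num 0) (Var ''idx''))
        (Block [Set ''a'' (Var ''cur''), Set ''b'' (Var ''q'')])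
        (Block [Set ''a'' (Var ''q''), Set ''b'' (Var ''cur'')]),
      mk_node ''a'' ''b'' ''cur'',
      ascend]"

definition edit_vars :: "vname set" where
  "edit_vars = {''e'', ''out''} \<union> descend_vars \<union> ascend_vars"

lemma vars_disjoint: "descend_vars \<inter> insert ''nx'' node_arrays = {}"
  by (simp add: descend_vars_def)

lemma stack_at_extends:
  assumes "extends \<sigma> \<sigma>'" "words \<sigma>' ''sn'' = words \<sigma> ''sn''" "words \<sigma>' ''sd'' = words \<sigma> ''sd''" "stack_at \<sigma> fs"
  shows "stack_at \<sigma>' fs"
  using assms tree_at_extends unfolding stack_at_def by simp

text \<open>The parent of the leaf is replaced by the sibling of the leaf. Since a leaf has height
  0, the sibling is lower than the parent by exactly one, a change that \<open>avl_rebuild\<close>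
  admits.\<close>

lemma wp_delete_at:
  assumes T: "tree_at \<sigma> (val \<sigma> ''cur'') T" "avl T" and idx: "val \<sigma> ''idx'' < siz T" and two: "2 \<le> siz T"
    and fits: "siz T < W" "val \<sigma> ''nx'' + 3 * hgt T \<le> W"
    and Q: "\<And>t \<sigma>' T'. t \<le> 500 * hgt T + 100 \<Longrightarrow> tree_at \<sigma>' (val \<sigma>' ''cur'') T' \<Longrightarrow> avl T' \<Longrightarrow>
       elems T' = take (val \<sigma> ''idx'') (elems T) @ drop (Suc (val \<sigma> ''idx'')) (elems T) \<Longrightarrow>
       val \<sigma>' ''out'' = elems T ! val \<sigma> ''idx'' \<Longrightarrow> hgt T' \<le> Suc (hgt T) \<Longrightarrow>
       val \<sigma>' ''nx'' \<le> val \<sigma> ''nx'' + 3 * hgt T \<Longrightarrow> extends \<sigma> \<sigma>' \<Longrightarrow> frame edit_vars \<sigma> \<sigma>' \<Longrightarrow> Q t \<sigma>'"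
  shows "wp W delete_at \<sigma> Q"
proof -
  define \<rho> where "\<rho> = upd ''sp'' 0 0 (upd ''e'' 0 0 \<sigma>)"
  have r: "val \<rho> ''cur'' = val \<sigma> ''cur''" "val \<rho> ''idx'' = val \<sigma> ''idx''" "val \<rho> ''nx'' = val \<sigma> ''nx''"
      "val \<rho> ''sp'' = 0" "val \<rho> ''e'' = 0" "tree_at \<rho> (val \<rho> ''cur'') T" "extends \<sigma> \<rho>" "frame {''sp'', ''e''} \<sigma> \<rho>"
    using T by (simp_all add: \<rho>_def)
  have desc: "wp W descend \<rho> (\<lambda>t \<sigma>'. \<exists>fs u. t \<le> 60 * hgt T + 10 \<and> stack_at \<sigma>' fs \<and> val \<sigma>' ''sp'' = length fs \<and>
       tree_at \<sigma>' (val \<sigma>' ''cur'') (Lf u) \<and> plug fs (Lf u) = T \<and>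
       length (elems_before fs) = val \<sigma> ''idx'' \<and> frame descend_vars \<rho> \<sigma>')"
    by (rule wp_descend[OF r(6)]) (use r idx fits in \<open>simp_all, blast\<close>)
  show ?thesis unfolding delete_at_def Block.simps wp.simps(2,4) wsafe.simps wval.simps \<rho>_def[symmetric]
  proof (intro conjI, goal_cases)
    case 5
    show ?case
    proof (rule wp_mono[OF desc], goal_cases)
      case (1 t \<tau>)
      then obtain fs u where d: "t \<le> 60 * hgt T + 10" "stack_at \<tau> fs" "val \<tau> ''sp'' = length fs"
        "tree_at \<tau> (val \<tau> ''cur'') (Lf u)" "plug fs (Lf u) = T" "length (elems_before fs) = val \<sigma> ''idx''" "frame descend_vars \<rho> \<tau>"
        by blast
      \<comment> \<open>With two elements the leaf is not the root, so it has a parent and a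
        sibling.\<close>
      have "fs \<noteq> []" using d(5) two by (auto simp: plug_def)
      then obtain gs left s where fs: "fs = gs @ [(left, s)]" by (metis rev_exhaust surj_pair)
      define \<upsilon> where "\<upsilon> = upd ''cur'' 0 (words \<tau> ''sn'' (length gs)) (upd ''sp'' 0 (length gs) (upd ''out'' 0 u \<tau>))"
      have el: "elems T = elems_before fs @ u # elems_after fs" using d(5) elems_plug[of fs "Lf u"] by simp
      have pl: "plug gs (if left then Nd (Lf u) s else Nd s (Lf u)) = T" using d(5) by (simp add: fs plug_snoc)
      then have siz_s: "siz (plug gs s) \<le> siz T" by (auto simp: elems_plug)
      have reb: "elems (rebuild gs s) = elems_before fs @ elems_after fs"
        by (cases left) (simp_all add: elems_rebuild fs elems_before_def elems_after_def)
      have "hgt (if left then Nd (Lf u) s else Nd s (Lf u)) = Suc (hgt s)" by simp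
      moreover have "avl (plug gs (if left then Nd (Lf u) s else Nd s (Lf u)))" using pl T(2) by simp
      moreover have "avl s" using calculation(2) by (induction gs) (auto simp: plug_def split: if_splits)
      ultimately have av: "avl (rebuild gs s) \<and> hgt (rebuild gs s) \<le> Suc (hgt T)"
        using avl_rebuild[of gs "if left then Nd (Lf u) s else Nd s (Lf u)" s] pl by simp
      have len: "length gs \<le> hgt T" using hgt_plug[of fs "Lf u"] d(5) by (simp add: fs)
      have s: "tree_at \<tau> (words \<tau> ''sn'' (length gs)) s" using d(2) unfolding stack_at_def fs by force
      have st: "stack_at \<tau> gs" unfolding stack_at_def
      proof (intro allI impI)
        fix i assume "i < length gs"
        then show "tree_at \<tau> (words \<tau> ''sn'' i) (snd (gs ! i)) \<and> (words \<tau> ''sd'' i = 0) = fst (gs ! i)"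
          using d(2)[unfolded stack_at_def, rule_format, of i] by (simp add: fs nth_append)
      qed
      have ext: "extends \<sigma> \<upsilon>" using extends_trans[OF r(7) frame_extends[OF d(7) vars_disjoint]] by (simp add: \<upsilon>_def)
      have fr: "frame edit_vars \<sigma> \<tau>"
        by (rule frame_trans[OF r(8) d(7)]) (simp_all add: edit_vars_def descend_vars_def)
      then have fr': "frame edit_vars \<sigma> \<upsilon>" by (simp add: \<upsilon>_def edit_vars_def descend_vars_def)
      have nx: "val \<upsilon> ''nx'' = val \<sigma> ''nx''"
        using d(7) r(3) by (simp add: \<upsilon>_def frame_def descend_vars_def)
      have "wp W ascend \<upsilon> (\<lambda>t' \<sigma>'. t' \<le> 400 * hgt T + 10 \<and> tree_at \<sigma>' (val \<sigma>' ''cur'') (rebuild gs s) \<and>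
          val \<sigma>' ''nx'' \<le> val \<sigma> ''nx'' + 3 * hgt T \<and> extends \<sigma> \<sigma>' \<and> frame edit_vars \<sigma> \<sigma>' \<and> val \<sigma>' ''out'' = u)"
      proof (rule wp_ascend[of _ gs s], goal_cases)
        case (6 t' \<sigma>')
        have "val \<sigma>' ''out'' = u" using 6(5)
          by (simp add: frame_def \<upsilon>_def ascend_vars_def balance_vars_def)
        moreover have "frame edit_vars \<sigma> \<sigma>'"
          by (rule frame_trans[OF fr' 6(5)]) (auto simp: edit_vars_def)
        ultimately show ?case using 6 extends_trans[OF ext 6(4)] len nx by simp
      qed (use st s fits siz_s len nx in \<open>simp_all add: \<upsilon>_def\<close>)
      note asc = this
      show ?case using fits(1)
        apply (simp add: d(3) fs tree_at_root(3)[OF d(4)])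
        apply (fold \<upsilon>_def)
        apply (rule wp_mono[OF asc])
        apply (elim conjE)
        apply (erule Q[rotated])
        using d(1,6) av reb el apply (simp_all add: nth_append)
        done
    qed
  qed (use fits in simp_all)
qed

text \<open>The leaf that was reached is replaced by a node of two leaves, so the height at this
  place grows from 0 to 1, and \<open>avl_rebuild\<close> applies again. The new leaf and its parent
  account for the two nodes beyond those of the rebalancing.\<close>

lemma wp_insert_at:
  assumes T: "tree_at \<sigma> (val \<sigma> ''cur'') T" "avl T" and idx: "val \<sigma> ''idx'' \<le> siz T"
    and fits: "siz T < W" "val \<sigma> ''nx'' + 3 * hgt T + 2 \<le> W"
    and Q: "\<And>t \<sigma>' T'. t \<le> 500 * hgt T + 200 \<Longrightarrow> tree_at \<sigma>' (val \<sigma>' ''cur'') T' \<Longrightarrow> avl T' \<Longrightarrow>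
       elems T' = take (val \<sigma> ''idx'') (elems T) @ val \<sigma> ''val'' # drop (val \<sigma> ''idx'') (elems T) \<Longrightarrow>
       val \<sigma>' ''nx'' \<le> val \<sigma> ''nx'' + 3 * hgt T + 2 \<Longrightarrow> extends \<sigma> \<sigma>' \<Longrightarrow> frame edit_vars \<sigma> \<sigma>' \<Longrightarrow> Q t \<sigma>'"
  shows "wp W insert_at \<sigma> Q"
proof -
  define v where "v = val \<sigma> ''val''"
  define \<rho> where "\<rho> = upd ''sp'' 0 0 (upd ''e'' 0 1 \<sigma>)"
  have r: "val \<rho> ''cur'' = val \<sigma> ''cur''" "val \<rho> ''idx'' = val \<sigma> ''idx''" "val \<rho> ''nx'' = val \<sigma> ''nx''"
      "val \<rho> ''sp'' = 0" "val \<rho> ''e'' = 1" "tree_at \<rho> (val \<rho> ''cur'') T" "extends \<sigma> \<rho>" "frame {''sp'', ''e''} \<sigma> \<rho>"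
      "val \<rho> ''val'' = v"
    using T by (simp_all add: \<rho>_def v_def)
  have desc: "wp W descend \<rho> (\<lambda>t \<sigma>'. \<exists>fs u. t \<le> 60 * hgt T + 10 \<and> stack_at \<sigma>' fs \<and> val \<sigma>' ''sp'' = length fs \<and>
       tree_at \<sigma>' (val \<sigma>' ''cur'') (Lf u) \<and> plug fs (Lf u) = T \<and>
       length (elems_before fs) + val \<sigma>' ''idx'' = val \<sigma> ''idx'' \<and> val \<sigma>' ''idx'' \<le> 1 \<and> frame descend_vars \<rho> \<sigma>')"
  proof (rule wp_descend[OF r(6)], goal_cases)
    case (5 t \<sigma>' fs u)
    then show ?case using r(2,5) by (intro exI[of _ fs] exI[of _ u]) simp
  qed (use r idx fits in simp_all)
  show ?thesis unfolding insert_at_def Block.simps wp.simps(2,4) wsafe.simps wval.simps \<rho>_def[symmetric]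
  proof (intro conjI, goal_cases)
    case 5
    show ?case
    proof (rule wp_mono[OF desc], goal_cases)
      case (1 t \<tau>)
      then obtain fs u where d: "t \<le> 60 * hgt T + 10" "stack_at \<tau> fs" "val \<tau> ''sp'' = length fs"
        "tree_at \<tau> (val \<tau> ''cur'') (Lf u)" "plug fs (Lf u) = T" "length (elems_before fs) + val \<tau> ''idx'' = val \<sigma> ''idx''"
        "val \<tau> ''idx'' \<le> 1" "frame descend_vars \<rho> \<tau>"
        by blast
      define N where "N = (if 0 < val \<tau> ''idx'' then Nd (Lf u) (Lf v) else Nd (Lf v) (Lf u))"
      have nx: "val \<tau> ''nx'' = val \<sigma> ''nx''" "val \<tau> ''val'' = v"
        using d(8) r(3,9) by (simp_all add: frame_def descend_vars_def)
      have nx0: "0 < val \<tau> ''nx''" using tree_at_root(4,5)[OF d(4)] by linarith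
      have el: "elems T = elems_before fs @ u # elems_after fs" using d(5) elems_plug[of fs "Lf u"] by simp
      have siz_N: "siz (plug fs N) \<le> W" using fits(1) el by (simp add: elems_plug N_def)
      have av: "avl (rebuild fs N)"
        using avl_rebuild[of fs "Lf u" N] d(5) T(2) by (simp add: N_def)
      have reb: "elems (rebuild fs N) = take (val \<sigma> ''idx'') (elems T) @ v # drop (val \<sigma> ''idx'') (elems T)"
        using d(6,7) by (auto simp: elems_rebuild N_def el le_Suc_eq simp flip: d(6))
      have len: "length fs \<le> hgt T" using hgt_plug[of fs "Lf u"] d(5) by simp
      have ext: "extends \<sigma> \<tau>" using extends_trans[OF r(7) frame_extends[OF d(8) vars_disjoint]] .
      have fr: "frame edit_vars \<sigma> \<tau>"
        by (rule frame_trans[OF r(8) d(8)]) (simp_all add: edit_vars_def descend_vars_def)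
      show ?case unfolding wp.simps(4)
      proof (rule wp_mk_leaf[of "''val''" "''q''"], goal_cases)
        case (5 t1 \<tau>1)
        define \<upsilon> where "\<upsilon> = (if 0 < val \<tau> ''idx'' then upd ''b'' 0 (val \<tau>1 ''q'') (upd ''a'' 0 (val \<tau>1 ''cur'') \<tau>1)
            else upd ''b'' 0 (val \<tau>1 ''cur'') (upd ''a'' 0 (val \<tau>1 ''q'') \<tau>1))"
        define X Y where "X = (if 0 < val \<tau> ''idx'' then Lf u else Lf v)" and "Y = (if 0 < val \<tau> ''idx'' then Lf v else Lf u)"
        have eqs: "val \<tau>1 ''cur'' = val \<tau> ''cur''" "val \<tau>1 ''idx'' = val \<tau> ''idx''" "words \<tau>1 ''sn'' = words \<tau> ''sn''"
            "words \<tau>1 ''sd'' = words \<tau> ''sd''" "words \<tau>1 ''sp'' = words \<tau> ''sp''"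
          using 5(5) by (simp_all add: frame_def)
        have cur: "tree_at \<tau>1 (val \<tau>1 ''cur'') (Lf u)" using tree_at_extends[OF 5(4) d(4)] eqs by simp
        have XY: "tree_at \<upsilon> (val \<upsilon> ''a'') X" "tree_at \<upsilon> (val \<upsilon> ''b'') Y"
          using cur 5(2) nx by (simp_all add: \<upsilon>_def X_def Y_def)
        have ext1: "extends \<sigma> \<upsilon>" using extends_trans[OF ext 5(4)] by (simp add: \<upsilon>_def)
        have "frame edit_vars \<sigma> \<tau>1"
          by (rule frame_trans[OF fr 5(5)]) (auto simp: edit_vars_def ascend_vars_def balance_vars_def simp del: node_arrays_iff)
        then have fr1: "frame edit_vars \<sigma> \<upsilon>" by (simp add: \<upsilon>_def edit_vars_def ascend_vars_def)
        have eqs': "val \<upsilon> ''nx'' = Suc (val \<sigma> ''nx'')" "words \<upsilon> ''sn'' = words \<tau> ''sn''" "words \<upsilon> ''sd'' = words \<tau> ''sd''"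
            "val \<upsilon> ''sp'' = length fs" "extends \<tau> \<upsilon>"
          using eqs d(3) 5(3,4) nx by (simp_all add: \<upsilon>_def)
        have main: "wp W (Seq (mk_node ''a'' ''b'' ''cur'') ascend) \<upsilon> (\<lambda>t' \<sigma>'. t' \<le> 400 * hgt T + 80 \<and>
            tree_at \<sigma>' (val \<sigma>' ''cur'') (rebuild fs N) \<and> val \<sigma>' ''nx'' \<le> val \<sigma> ''nx'' + 3 * hgt T + 2 \<and>
            extends \<sigma> \<sigma>' \<and> frame edit_vars \<sigma> \<sigma>')"
          unfolding wp.simps(4)
        proof (rule wp_mk_node[OF XY], goal_cases)
          case 4
          have "siz X + siz Y = 2" by (simp add: X_def Y_def)
          then show ?case using siz_N by (simp add: N_def elems_plug split: if_splits)
        next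
          case (6 t2 \<tau>2)
          have eqs2: "words \<tau>2 ''sn'' = words \<tau> ''sn''" "words \<tau>2 ''sd'' = words \<tau> ''sd''" "val \<tau>2 ''sp'' = length fs"
            using 6(5) eqs' by (simp_all add: frame_def)
          have N: "Nd X Y = N" by (simp add: N_def X_def Y_def)
          have fr2: "frame edit_vars \<sigma> \<tau>2"
            by (rule frame_trans[OF fr1 6(5)]) (auto simp: edit_vars_def ascend_vars_def balance_vars_def simp del: node_arrays_iff)
          show ?case
          proof (rule wp_ascend[of _ fs N], goal_cases)
            case 1
            show ?case using stack_at_extends[OF extends_trans[OF eqs'(5) 6(4)] eqs2(1,2) d(2)] .
          next
            case (6 t3 \<tau>3)
            have "frame edit_vars \<sigma> \<tau>3"
              by (rule frame_trans[OF fr2 6(5)]) (auto simp: edit_vars_def)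
            then show ?case
              using 6 \<open>t2 \<le> 60\<close> extends_trans[OF ext1 extends_trans[OF \<open>extends \<upsilon> \<tau>2\<close> 6(4)]] len
                \<open>val \<tau>2 ''nx'' = _\<close> eqs'(1) by simp
          qed (use eqs2 6 N siz_N fits len eqs' in simp_all)
        qed (use fits eqs' in simp_all)
        have fin: "Q t' \<sigma>'" if "t' \<le> 500 * hgt T + 200" "tree_at \<sigma>' (val \<sigma>' ''cur'') (rebuild fs N)"
            "val \<sigma>' ''nx'' \<le> val \<sigma> ''nx'' + 3 * hgt T + 2" "extends \<sigma> \<sigma>'" "frame edit_vars \<sigma> \<sigma>'" for t' \<sigma>'
          using Q[OF that(1,2) av _ that(3-5)] reb by (simp add: v_def)
        have main': "wp W (mk_node ''a'' ''b'' ''cur'') \<upsilon> (\<lambda>t \<sigma>'. wp W ascend \<sigma>' (\<lambda>u \<sigma>'. t + u \<le> 400 * hgt T + 80 \<and>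
            tree_at \<sigma>' (val \<sigma>' ''cur'') (rebuild fs N) \<and> val \<sigma>' ''nx'' \<le> val \<sigma> ''nx'' + 3 * hgt T + 2 \<and>
            extends \<sigma> \<sigma>' \<and> frame edit_vars \<sigma> \<sigma>'))" using main by simp
        show ?case
        proof (cases "0 < val \<tau> ''idx''")
          case True
          have \<upsilon>: "\<upsilon> = upd ''b'' 0 (val \<tau>1 ''q'') (upd ''a'' 0 (val \<tau> ''cur'') \<tau>1)" using True eqs(1) by (simp add: \<upsilon>_def)
          show ?thesis using fits(1) True eqs
            apply (simp flip: \<upsilon>)
            apply (rule wp_mono[OF main'])
            apply (erule wp_mono)
            apply (elim conjE)
            apply (rule fin)
            using d(1) 5(1) apply simp_all
            done
        next
          case False
          have \<upsilon>: "\<upsilon> = upd ''b'' 0 (val \<tau> ''cur'') (upd ''a'' 0 (val \<tau>1 ''q'') \<tau>1)" using False eqs(1) by (simp add: \<upsilon>_def)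
          show ?thesis using fits(1) False eqs
            apply (simp flip: \<upsilon>)
            apply (rule wp_mono[OF main'])
            apply (erule wp_mono)
            apply (elim conjE)
            apply (rule fin)
            using d(1) 5(1) apply simp_all
            done
        qed
      qed (use fits nx nx0 in simp_all)
    qed
  qed (use fits in simp_all)
qed

section \<open>Search for a time stamp\<close>

definition find_rank :: com where
  "find_rank = Block
     [Set ''acc'' (Num 0),
      While (WLess (Num 0) (Load ''ht'' (Var ''cur'')))
        (Cond (WLess (Var ''key'') (Load ''ky'' (Load ''lf'' (Var ''cur''))))
          (Block [Set ''acc'' (Plus (Var ''acc'') (Load ''sz'' (Load ''lf'' (Var ''cur'')))),
            Set ''cur'' (Load ''rt'' (Var ''cur''))])
          (Set ''cur'' (Load ''lf'' (Var ''cur''))))]"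

text \<open>As the elements decrease strictly, the key stored in the left child is the least one
  there: a present key lies to the right exactly if it is smaller. The accumulator counts the
  elements passed on the left.\<close>

lemma wp_find_rank:
  assumes T: "tree_at \<sigma> (val \<sigma> ''cur'') T" and sorted: "sorted_wrt (>) (elems T)"
    and k: "k < siz T" "val \<sigma> ''key'' = elems T ! k" and fits: "siz T \<le> W"
    and Q: "\<And>t \<sigma>'. t \<le> 60 * hgt T + 20 \<Longrightarrow> val \<sigma>' ''acc'' = k \<Longrightarrow> frame {''acc'', ''cur''} \<sigma> \<sigma>' \<Longrightarrow> Q t \<sigma>'"
  shows "wp W find_rank \<sigma> Q"
proof -
  let ?b = "WLess (Num 0) (Load ''ht'' (Var ''cur''))"
  define P where "P \<tau> t pre \<longleftrightarrow> tree_at \<tau> (val \<tau> ''cur'') t \<and> (\<exists>post. elems T = pre @ elems t @ post) \<and>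
    val \<tau> ''acc'' = length pre \<and> elems T ! k \<in> set (elems t) \<and> frame {''acc'', ''cur''} \<sigma> \<tau>" for \<tau> t pre
  have W: "0 < W" using fits siz_pos[of T] by linarith
  show ?thesis unfolding find_rank_def Block.simps wp.simps(2,4) wsafe.simps wval.simps
  proof (intro conjI, simp, simp, rule wp_while_post[where I = "\<lambda>\<tau>. \<exists>t pre. P \<tau> t pre"
        and \<mu> = "\<lambda>\<tau>. words \<tau> ''ht'' (val \<tau> ''cur'')" and c = 40], goal_cases)
    case 1
    have "P (upd ''acc'' 0 0 \<sigma>) T []" using T k by (simp add: P_def)
    then show ?case by blast
  next
    case (2 \<tau>)
    then show ?case using W by simp
  next
    case (3 \<tau>)
    then obtain t pre where Pt: "P \<tau> t pre" and pos: "0 < words \<tau> ''ht'' (val \<tau> ''cur'')" by auto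
    have t: "tree_at \<tau> (val \<tau> ''cur'') t" using Pt by (simp add: P_def)
    obtain l r where lr: "t = Nd l r" using pos tree_at_root(1)[OF t] by (cases t) auto
    note l = tree_at_Nd(1)[OF t[unfolded lr]] and r = tree_at_Nd(2)[OF t[unfolded lr]]
    have key: "val \<tau> ''key'' = elems T ! k" using Pt k by (simp add: P_def frame_def)
    obtain post where el: "elems T = pre @ elems l @ elems r @ post" using Pt by (auto simp: P_def lr)
    have len: "length pre + siz l \<le> W" using fits el by simp
    have acc: "val \<tau> ''acc'' = length pre" using Pt by (simp add: P_def)
    have in_t: "elems T ! k \<in> set (elems l) \<union> set (elems r)" using Pt by (simp add: P_def lr)
    have gt: "x > y" if "x \<in> set (elems l)" "y \<in> set (elems r)" for x y
      using sorted that by (auto simp: el sorted_wrt_append)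
    have ge: "last (elems l) \<le> x" if x: "x \<in> set (elems l)" for x
    proof -
      have s: "sorted_wrt (>) (butlast (elems l) @ [last (elems l)])"
        using sorted by (simp add: el sorted_wrt_append)
      have "x \<in> set (butlast (elems l)) \<or> x = last (elems l)"
        using x append_butlast_last_id[OF elems_nonempty[of l]] by (metis Un_iff empty_iff empty_set set_ConsD set_append)
      moreover have "\<forall>x\<in>set (butlast (elems l)). \<forall>y\<in>set [last (elems l)]. y < x"
        using iffD1[OF sorted_wrt_append s] by blast
      ultimately show ?thesis by force
    qed
    have left: "P (upd ''cur'' 0 (words \<tau> ''lf'' (val \<tau> ''cur'')) \<tau>) l pre" if "\<not> elems T ! k < last (elems l)"
    proof -
      have "elems T ! k \<notin> set (elems r)" using that gt[of "last (elems l)" "elems T ! k"] by auto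
      with in_t show ?thesis using Pt l el by (auto simp: P_def)
    qed
    have right: "P (upd ''cur'' 0 (words \<tau> ''rt'' (val \<tau> ''cur'')) (upd ''acc'' 0 (length pre + siz l) \<tau>)) r (pre @ elems l)"
      if "elems T ! k < last (elems l)"
    proof -
      have "elems T ! k \<notin> set (elems l)" using that ge leD by blast
      with in_t show ?thesis using Pt r el by (auto simp: P_def)
    qed
    have ht: "hgt l < hgt t" "hgt r < hgt t" by (simp_all add: lr)
    show ?case
    proof (cases "elems T ! k < last (elems l)")
      case True
      show ?thesis using len ht right[OF True] True
        by (simp add: key acc tree_at_root[OF l] tree_at_root[OF r] tree_at_root[OF t]) blast
    next
      case False
      show ?thesis using len ht left[OF False] False
        by (simp add: key acc tree_at_root[OF l] tree_at_root[OF r] tree_at_root[OF t]) blast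
    qed
  next
    case (4 t \<sigma>')
    then obtain s pre where s: "P \<sigma>' s pre" "words \<sigma>' ''ht'' (val \<sigma>' ''cur'') = 0" by auto
    then have "hgt s = 0" using tree_at_root(1)[of \<sigma>' "val \<sigma>' ''cur''" s] by (simp add: P_def)
    then obtain u where u: "s = Lf u" by (cases s) auto
    have dist: "distinct (elems T)" using sorted by (auto simp: sorted_wrt_iff_nth_less distinct_conv_nth) (metis less_irrefl linorder_neqE_nat)
    obtain post where "elems T = pre @ (elems T ! k) # post" using s(1) by (auto simp: P_def u)
    then have "elems T ! length pre = elems T ! k" "length pre < siz T"
      by (metis nth_append_length, metis length_append length_Cons less_add_Suc1 add_Suc_right)
    then have "length pre = k" using dist k(1) nth_eq_iff_index_eq by metis
    moreover have "words (upd ''acc'' 0 0 \<sigma>) ''ht'' (val (upd ''acc'' 0 0 \<sigma>) ''cur'') = hgt T" using tree_at_root[OF T] by simp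
    ultimately show ?case using s 4(1) by (intro Q) (auto simp: P_def)
  qed
qed

section \<open>Counting accesses beyond a segment\<close>

definition suffix_loop :: com where
  "suffix_loop = While (WLess (Num 1) (Var ''v''))
     (Block [Cond (WLess (Num 0) (WOp WMod (Var ''v'') (Num 2))) Skip
         (Set ''q'' (Plus (Var ''q'') (Load ''cnt'' (Plus (Var ''v'') (Num 1))))),
       Set ''v'' (WOp WDiv (Var ''v'') (Num 2))])"

definition suffix_count :: com where
  "suffix_count = Block
     [Set ''v'' (Plus (Var ''P'') (Var ''K'')), Set ''q'' (Num 0), suffix_loop]"

definition add_loop :: com where
  "add_loop = While (WLess (Num 0) (Var ''v''))
     (Block [Store ''cnt'' (Var ''v'') (Plus (Load ''cnt'' (Var ''v'')) (Num 1)),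
       Set ''v'' (WOp WDiv (Var ''v'') (Num 2))])"

definition add_point :: com where
  "add_point = Block [Set ''v'' (Plus (Var ''P'') (Var ''K'')), add_loop]"

text \<open>Node \<open>u\<close> has the children \<open>2 * u\<close> and \<open>2 * u + 1\<close>, and \<open>2 ^ p + k\<close> is the leaf of \<open>k\<close>.\<close>

definition count_tree :: "nat \<Rightarrow> (nat \<Rightarrow> nat) \<Rightarrow> nat list \<Rightarrow> bool" where
  "count_tree p cnt ks \<longleftrightarrow> (\<forall>j\<le>p. \<forall>u. 2 ^ (p - j) \<le> u \<and> u < 2 * 2 ^ (p - j) \<longrightarrow>
     cnt u = length (filter (\<lambda>k. (2 ^ p + k) div 2 ^ j = u) ks))"

lemma div_power_Suc: "u div 2 ^ Suc j = u div 2 ^ j div (2 :: nat)"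
  by (metis div_mult2_eq power_Suc2)

lemma level_bounds:
  fixes k :: nat
  assumes "k < 2 ^ p" "j \<le> p"
  shows "2 ^ (p - j) \<le> (2 ^ p + k) div 2 ^ j" "(2 ^ p + k) div 2 ^ j < 2 * 2 ^ (p - j)"
proof -
  have *: "(2 :: nat) ^ p = 2 ^ (p - j) * 2 ^ j" using assms(2) by (simp flip: power_add)
  show "2 ^ (p - j) \<le> (2 ^ p + k) div 2 ^ j" unfolding * by simp
  have "2 ^ p + k < 2 * (2 ^ (p - j) * 2 ^ j)" using assms(1) * by linarith
  then have "2 ^ p + k < 2 * 2 ^ (p - j) * 2 ^ j" by (simp only: mult.assoc)
  then show "(2 ^ p + k) div 2 ^ j < 2 * 2 ^ (p - j)" by (simp add: less_mult_imp_div_less)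
qed

lemma level_zero: "k < 2 ^ p \<Longrightarrow> p < j \<Longrightarrow> (2 ^ p + k) div 2 ^ j = (0 :: nat)"
proof -
  assume "k < 2 ^ p" "p < j"
  then have "2 ^ p + k < 2 ^ Suc p" "(2 :: nat) ^ Suc p \<le> 2 ^ j" by (simp, intro power_increasing) auto
  then show ?thesis by (intro div_less) linarith
qed

text \<open>The levels of the tree occupy disjoint intervals of node numbers, so the path from a
  leaf to the root visits every node at most once. Hence \<open>add_point\<close> increments no
  counter twice.\<close>

lemma level_unique:
  assumes "k < 2 ^ p" "l < 2 ^ p" "i \<le> p" "(2 ^ p + k) div 2 ^ j = (2 ^ p + l :: nat) div 2 ^ i"
  shows "j = i"
proof (rule ccontr)
  assume "j \<noteq> i"
  have b: "2 ^ (p - i) \<le> (2 ^ p + l) div 2 ^ i" "(2 ^ p + l) div 2 ^ i < 2 * 2 ^ (p - i)"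
    using level_bounds[OF assms(2,3)] by auto
  have "j \<le> p" using level_zero[OF assms(1), of j] b(1) assms(4) by (cases "j \<le> p") auto
  then have c: "2 ^ (p - j) \<le> (2 ^ p + l) div 2 ^ i" "(2 ^ p + l) div 2 ^ i < 2 * 2 ^ (p - j)"
    using level_bounds[OF assms(1) \<open>j \<le> p\<close>] assms(4) by auto
  consider "j < i" | "i < j" using \<open>j \<noteq> i\<close> by linarith
  then show False
  proof cases
    case 1
    then have "(2 :: nat) ^ Suc (p - i) \<le> 2 ^ (p - j)" using assms(3) by (intro power_increasing) auto
    then show ?thesis using b(2) c(1) by simp
  next
    case 2
    then have "(2 :: nat) ^ Suc (p - j) \<le> 2 ^ (p - i)" using \<open>j \<le> p\<close> by (intro power_increasing) auto
    then show ?thesis using b(1) c(2) by simp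
  qed
qed

text \<open>The number of binary digits is the measure of both loops along a path; it is
  \<open>p + 1\<close> at a leaf.\<close>

lemma floorlog_half: "0 < v \<Longrightarrow> floorlog 2 v = Suc (floorlog 2 (v div 2))"
  by (subst compute_floorlog) simp

lemma floorlog_level: "k < 2 ^ p \<Longrightarrow> floorlog 2 (2 ^ p + k) = Suc p"
proof (induction p arbitrary: k)
  case (Suc p)
  have "(2 ^ Suc p + k) div 2 = 2 ^ p + k div 2" by simp
  moreover have "k div 2 < 2 ^ p" using Suc.prems by (simp add: less_mult_imp_div_less mult.commute)
  ultimately show ?case using Suc.IH[of "k div 2"] floorlog_half[of "2 ^ Suc p + k"] by simp
qed (simp add: compute_floorlog)

text \<open>Invariant: q plus the number of keys whose ancestor on the level of v lies to the right
  of v is the final answer. At the leaves this is the specification, and at the root nothing lies to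
  the right. On the way to the parent, only the keys below the right sibling \<open>v + 1\<close>
  are lost, and only if v is a left child; these are added to q.\<close>

lemma wp_suffix_count:
  assumes cnt: "count_tree p (words \<sigma> ''cnt'') ks" and ks: "\<And>k. k \<in> set ks \<Longrightarrow> k < 2 ^ p"
    and P: "val \<sigma> ''P'' = 2 ^ p" and K: "val \<sigma> ''K'' < 2 ^ p"
    and fits: "length ks \<le> W" "2 * 2 ^ p < W"
    and Q: "\<And>t \<sigma>'. t \<le> 40 * p + 100 \<Longrightarrow> val \<sigma>' ''q'' = length (filter (\<lambda>k. val \<sigma> ''K'' < k) ks) \<Longrightarrow>
      frame {''v'', ''q''} \<sigma> \<sigma>' \<Longrightarrow> Q t \<sigma>'"
  shows "wp W suffix_count \<sigma> Q"
proof -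
  define K where "K = val \<sigma> ''K''"
  have KP: "K < 2 ^ p" using K by (simp add: K_def)
  define I where "I \<tau> \<longleftrightarrow> (\<exists>j\<le>p. val \<tau> ''v'' = (2 ^ p + K) div 2 ^ j \<and>
      val \<tau> ''q'' + length (filter (\<lambda>k. val \<tau> ''v'' < (2 ^ p + k) div 2 ^ j) ks) = length (filter (\<lambda>k. K < k) ks)) \<and>
      frame {''v'', ''q''} \<sigma> \<tau>" for \<tau>
  have two: "2 \<le> W" "2 ^ p + K \<le> W" using fits K KP one_le_power[of "2 :: nat" p] by linarith+
  define \<upsilon> where "\<upsilon> = upd ''q'' 0 0 (upd ''v'' 0 (2 ^ p + K) \<sigma>)"
  have loop: "wp W suffix_loop \<upsilon>
    (\<lambda>t \<sigma>'. t \<le> 40 * p + 70 \<and> val \<sigma>' ''q'' = length (filter (\<lambda>k. K < k) ks) \<and> frame {''v'', ''q''} \<sigma> \<sigma>')"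
    unfolding suffix_loop_def
  proof (rule wp_while_post[where I = I and \<mu> = "\<lambda>\<tau>. floorlog 2 (val \<tau> ''v'')" and c = 30], goal_cases)
      case 1
      show ?case by (auto simp: I_def \<upsilon>_def intro!: exI[of _ 0])
    next
      case (2 \<tau>)
      then show ?case using two by simp
    next
      case (3 \<tau>)
      then obtain j where j: "j \<le> p" "val \<tau> ''v'' = (2 ^ p + K) div 2 ^ j"
          "val \<tau> ''q'' + length (filter (\<lambda>k. val \<tau> ''v'' < (2 ^ p + k) div 2 ^ j) ks) = length (filter (\<lambda>k. K < k) ks)"
        and fr: "frame {''v'', ''q''} \<sigma> \<tau>" and v1: "1 < val \<tau> ''v''"
        by (auto simp: I_def)
      define v where "v = val \<tau> ''v''"
      have jp: "j < p"
      proof (rule ccontr)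
        assume "\<not> j < p"
        then have "j = p" using j(1) by simp
        then show False using v1 j(2) level_bounds(2)[OF KP, of p] by simp
      qed
      have v_half: "v div 2 = (2 ^ p + K) div 2 ^ Suc j"
        using j(2) by (simp only: v_def div_power_Suc)
      have b: "2 ^ (p - j) \<le> v" "v < 2 * 2 ^ (p - j)" using level_bounds[OF KP j(1)] j(2) by (auto simp: v_def)
      have cnt_eq: "words \<tau> ''cnt'' (Suc v) = length (filter (\<lambda>k. (2 ^ p + k) div 2 ^ j = Suc v) ks)" if "even v"
      proof -
        have "Suc v \<noteq> 2 * 2 ^ (p - j)" using that by (metis dvd_triv_left even_Suc)
        then have "Suc v < 2 * 2 ^ (p - j)" using b(2) by linarith
        then show ?thesis using cnt j(1) b(1) fr unfolding count_tree_def by (simp add: frame_def)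
      qed
      have count_split: "length (filter (\<lambda>k. v < (2 ^ p + k) div 2 ^ j) ks) =
          (if even v then length (filter (\<lambda>k. (2 ^ p + k) div 2 ^ j = Suc v) ks) else 0) +
          length (filter (\<lambda>k. v div 2 < (2 ^ p + k) div 2 ^ Suc j) ks)"
      proof -
        \<comment> \<open>A node u lies to the right of v if it is the right sibling of v, or if its
          parent lies to the right of the parent of v; the two cases exclude each other.\<close>
        have "v < u \<longleftrightarrow> (even v \<and> u = Suc v) \<or> v div 2 < u div 2" for u :: nat
          by presburger
        moreover have "\<not> (u = Suc v \<and> v div 2 < u div 2)" if "even v" for u using that by auto
        moreover have "u div 2 ^ Suc j = u div 2 ^ j div 2" for u :: nat by (rule div_power_Suc)
        ultimately show ?thesis by (induction ks) (auto simp del: power_Suc)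
      qed
      have small: "Suc v \<le> W"
      proof -
        have "v \<le> 2 ^ p + K" using j(2) by (simp add: v_def)
        then show ?thesis using fits(2) KP by linarith
      qed
      have sum: "val \<tau> ''q'' + length (filter (\<lambda>k. v < (2 ^ p + k) div 2 ^ j) ks) \<le> W"
      proof -
        have "length (filter (\<lambda>k. K < k) ks) \<le> W" using order.trans[OF length_filter_le fits(1)] .
        then show ?thesis using j(3) unfolding v_def by linarith
      qed
      have dec: "floorlog 2 (v div 2) < floorlog 2 v" using floorlog_half[of v] v1 by (simp add: v_def)
      have step: "I \<upsilon>" if "val \<upsilon> ''v'' = v div 2" "frame {''v'', ''q''} \<sigma> \<upsilon>"
          "val \<upsilon> ''q'' = val \<tau> ''q'' + (if even v then length (filter (\<lambda>k. (2 ^ p + k) div 2 ^ j = Suc v) ks) else 0)" for \<upsilon>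
        using that j(3) jp unfolding I_def
        by (intro conjI exI[of _ "Suc j"]) (simp_all add: v_half[symmetric] count_split del: power_Suc flip: v_def)
      show ?case
      proof (cases "even v")
        case True
        then have "val \<tau> ''q'' + words \<tau> ''cnt'' (Suc v) \<le> W" using sum count_split cnt_eq by simp
        then show ?thesis using True two small dec fr cnt_eq
          by (simp add: v_def[symmetric] even_iff_mod_2_eq_zero step)
      next
        case False
        then show ?thesis using two small dec fr
          by (simp add: v_def[symmetric] even_iff_mod_2_eq_zero odd_iff_mod_2_eq_one step)
      qed
    next
      case (4 t \<sigma>')
      then obtain j where j: "j \<le> p" "val \<sigma>' ''v'' = (2 ^ p + K) div 2 ^ j" "val \<sigma>' ''v'' \<le> 1"
          "val \<sigma>' ''q'' + length (filter (\<lambda>k. val \<sigma>' ''v'' < (2 ^ p + k) div 2 ^ j) ks) = length (filter (\<lambda>k. K < k) ks)"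
          "frame {''v'', ''q''} \<sigma> \<sigma>'" by (auto simp: I_def)
      have "j = p"
      proof (rule ccontr)
        assume "j \<noteq> p"
        then have "(2 :: nat) ^ 1 \<le> 2 ^ (p - j)" using j(1) by (intro power_increasing) auto
        then show False using level_bounds(1)[OF KP j(1)] j(2,3) by simp
      qed
      have "filter (\<lambda>k. val \<sigma>' ''v'' < (2 ^ p + k) div 2 ^ j) ks = []"
        using ks level_bounds[OF _ j(1)] level_bounds(1)[OF KP j(1)] j(2,3) \<open>j = p\<close>
        by (force simp: filter_empty_conv)
      moreover have "floorlog 2 (2 ^ p + K) = Suc p" using floorlog_level[OF KP] .
      ultimately show ?case using j 4(1) by (simp add: \<upsilon>_def)
  qed
  show ?thesis using P two
    apply (simp add: suffix_count_def flip: K_def)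
    apply (fold \<upsilon>_def)
    apply (rule wp_mono[OF loop])
    apply (rule Q)
    apply (auto simp: K_def)
    done
qed

text \<open>Invariant: the counters strictly below v on the path have been incremented. The counter
  at v is thus still the old one, at most the length of \<open>ks\<close>, and its successor fits
  into a word. The loop runs past the root until v is 0.\<close>

lemma wp_add_point:
  assumes cnt: "count_tree p (words \<sigma> ''cnt'') ks"
    and P: "val \<sigma> ''P'' = 2 ^ p" and K: "val \<sigma> ''K'' < 2 ^ p"
    and fits: "length ks < W" "2 * 2 ^ p < W"
    and Q: "\<And>t \<sigma>'. t \<le> 40 * p + 100 \<Longrightarrow> count_tree p (words \<sigma>' ''cnt'') (val \<sigma> ''K'' # ks) \<Longrightarrow>
      frame {''v'', ''cnt''} \<sigma> \<sigma>' \<Longrightarrow> Q t \<sigma>'"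
  shows "wp W add_point \<sigma> Q"
proof -
  define K where "K = val \<sigma> ''K''"
  have KP: "K < 2 ^ p" using K by (simp add: K_def)
  define I where "I \<tau> \<longleftrightarrow> (\<exists>j. val \<tau> ''v'' = (2 ^ p + K) div 2 ^ j \<and>
      (\<forall>u. words \<tau> ''cnt'' u = words \<sigma> ''cnt'' u + (if \<exists>i<j. u = (2 ^ p + K) div 2 ^ i then 1 else 0))) \<and>
      frame {''v'', ''cnt''} \<sigma> \<tau>" for \<tau>
  have two: "2 \<le> W" "2 ^ p + K \<le> W" using fits K KP one_le_power[of "2 :: nat" p] by linarith+
  define \<upsilon> where "\<upsilon> = upd ''v'' 0 (2 ^ p + K) \<sigma>"
  have loop: "wp W add_loop \<upsilon> (\<lambda>t \<sigma>'. t \<le> 40 * p + 70 \<and> count_tree p (words \<sigma>' ''cnt'') (K # ks) \<and>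
      frame {''v'', ''cnt''} \<sigma> \<sigma>')"
    unfolding add_loop_def
  proof (rule wp_while_post[where I = I and \<mu> = "\<lambda>\<tau>. floorlog 2 (val \<tau> ''v'')" and c = 30], goal_cases)
    case 1
    show ?case by (auto simp: I_def \<upsilon>_def intro!: exI[of _ 0])
  next
    case (2 \<tau>)
    then show ?case by simp
  next
    case (3 \<tau>)
    then obtain j where j: "val \<tau> ''v'' = (2 ^ p + K) div 2 ^ j"
        "\<And>u. words \<tau> ''cnt'' u = words \<sigma> ''cnt'' u + (if \<exists>i<j. u = (2 ^ p + K) div 2 ^ i then 1 else 0)"
      and fr: "frame {''v'', ''cnt''} \<sigma> \<tau>" and v0: "0 < val \<tau> ''v''"
      by (auto simp: I_def)
    define v where "v = val \<tau> ''v''"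
    have jp: "j \<le> p" using level_zero[OF KP, of j] v0 j(1) by (cases "j \<le> p") auto
    have no: "v \<noteq> (2 ^ p + K) div 2 ^ i" if "i < j" for i
      using level_unique[OF KP KP jp, of i] that j(1) by (auto simp: v_def)
    have v_half: "v div 2 = (2 ^ p + K) div 2 ^ Suc j"
      using j(1) by (simp only: v_def div_power_Suc)
    have cnt_v: "words \<tau> ''cnt'' v = words \<sigma> ''cnt'' v"
      unfolding j(2) using no by auto
    have "words \<sigma> ''cnt'' v = length (filter (\<lambda>k. (2 ^ p + k) div 2 ^ j = v) ks)"
      using cnt jp level_bounds[OF KP jp] j(1) unfolding count_tree_def v_def by simp
    then have small: "Suc (words \<sigma> ''cnt'' v) \<le> W"
      using fits(1) length_filter_le[of "\<lambda>k. (2 ^ p + k) div 2 ^ j = v" ks] by linarith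
    have dec: "floorlog 2 (v div 2) < floorlog 2 v" using floorlog_half[of v] v0 by (simp add: v_def)
    have cnt': "((words \<tau> ''cnt'')(v := Suc (words \<sigma> ''cnt'' v))) u =
        words \<sigma> ''cnt'' u + (if \<exists>i<Suc j. u = (2 ^ p + K) div 2 ^ i then 1 else 0)" for u
      using no j(1) by (auto simp: j(2) less_Suc_eq v_def[symmetric])
    have step: "I (upd ''v'' 0 (v div 2) (upd ''cnt'' v (Suc (words \<sigma> ''cnt'' v)) \<tau>))"
      unfolding I_def
    proof (intro conjI exI[of _ "Suc j"] allI)
      show "val (upd ''v'' 0 (v div 2) (upd ''cnt'' v (Suc (words \<sigma> ''cnt'' v)) \<tau>)) ''v'' = (2 ^ p + K) div 2 ^ Suc j"
        using v_half by simp
      fix u show "words (upd ''v'' 0 (v div 2) (upd ''cnt'' v (Suc (words \<sigma> ''cnt'' v)) \<tau>)) ''cnt'' u =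
          words \<sigma> ''cnt'' u + (if \<exists>i<Suc j. u = (2 ^ p + K) div 2 ^ i then 1 else 0)"
        using cnt'[of u] by simp
    qed (use fr in simp)
    show ?case using small two dec step by (simp add: v_def[symmetric] cnt_v)
  next
    case (4 t \<sigma>')
    then obtain j where j: "(2 ^ p + K) div 2 ^ j = 0"
        "\<And>u. words \<sigma>' ''cnt'' u = words \<sigma> ''cnt'' u + (if \<exists>i<j. u = (2 ^ p + K) div 2 ^ i then 1 else 0)"
      and fr: "frame {''v'', ''cnt''} \<sigma> \<sigma>'"
      by (auto simp: I_def)
    have pj: "p < j" using level_bounds(1)[OF KP, of j] j(1) by (cases "p < j") auto
    have "count_tree p (words \<sigma>' ''cnt'') (K # ks)" unfolding count_tree_def
    proof (intro allI impI)
      fix i u :: nat assume i: "i \<le> p" and u: "2 ^ (p - i) \<le> u \<and> u < 2 * 2 ^ (p - i)"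
      have "(\<exists>l<j. u = (2 ^ p + K) div 2 ^ l) \<longleftrightarrow> (2 ^ p + K) div 2 ^ i = u"
      proof
        assume "\<exists>l<j. u = (2 ^ p + K) div 2 ^ l"
        then obtain l where l: "u = (2 ^ p + K) div 2 ^ l" by blast
        have lp: "l \<le> p" using level_zero[OF KP, of l] l u by (cases "l \<le> p") auto
        note b = level_bounds[OF KP lp, folded l]
        have "l = i"
        proof (rule ccontr)
          assume "l \<noteq> i"
          then consider "l < i" | "i < l" by linarith
          then show False
          proof cases
            case 1
            then have "(2 :: nat) ^ Suc (p - i) \<le> 2 ^ (p - l)" using i by (intro power_increasing) auto
            then show ?thesis using b u by simp
          next
            case 2
            then have "(2 :: nat) ^ Suc (p - l) \<le> 2 ^ (p - i)" using lp by (intro power_increasing) auto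
            then show ?thesis using b u by simp
          qed
        qed
        with l show "(2 ^ p + K) div 2 ^ i = u" by simp
      next
        assume "(2 ^ p + K) div 2 ^ i = u"
        then show "\<exists>l<j. u = (2 ^ p + K) div 2 ^ l" using i pj by (intro exI[of _ i]) auto
      qed
      moreover have "words \<sigma> ''cnt'' u = length (filter (\<lambda>k. (2 ^ p + k) div 2 ^ i = u) ks)"
        using cnt i u unfolding count_tree_def by simp
      ultimately show "words \<sigma>' ''cnt'' u = length (filter (\<lambda>k. (2 ^ p + k) div 2 ^ i = u) (K # ks))"
        by (simp add: j(2))
    qed
    moreover have "floorlog 2 (2 ^ p + K) = Suc p" using floorlog_level[OF KP] .
    ultimately show ?case using fr 4(1) by (simp add: \<upsilon>_def)
  qed
  show ?thesis using P two
    apply (simp add: add_point_def flip: K_def)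
    apply (fold \<upsilon>_def)
    apply (rule wp_mono[OF loop])
    apply (rule Q)
    apply (auto simp: K_def)
    done
qed

section \<open>Segments and slots\<close>

lemma lpr_victim_eqI:
  assumes "finite G" "v \<in> G" "\<And>e. e \<in> G \<Longrightarrow> profit_rate V s v \<le> profit_rate V s e"
    and "\<And>e. e \<in> G \<Longrightarrow> profit_rate V s e = profit_rate V s v \<Longrightarrow> v \<le> e"
    and "depth V \<Lambda> ` B = G"
  shows "lpr_victim V s \<Lambda> B = \<Lambda> v"
proof -
  have m: "Min (profit_rate V s ` G) = profit_rate V s v"
    using assms(1-3) by (intro Min_eqI) auto
  have "Min {d \<in> G. profit_rate V s d = profit_rate V s v} = v"
    using assms(1,2,4) by (intro Min_eqI) auto
  then show ?thesis by (simp add: lpr_victim_def Let_def assms(5) m)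
qed

text \<open>Rank i lies in the segment from \<open>Suc (kk i)\<close> to \<open>ll i\<close>. Of the
  profit rate, which is put for f later, the analysis uses only two facts: it is least at the first
  rank of a segment, and these least values strictly decrease from one segment to the next. Rank 1
  is a segment of its own, without a condition on f, since the accessed item cannot be a
  victim.\<close>

locale segmentation =
  fixes V :: nat and f :: "nat \<Rightarrow> real" and kk ll :: "nat \<Rightarrow> nat"
  assumes V_pos: "1 \<le> V" and kk_1: "kk 1 = 0" and ll_1: "ll 1 = 1"
    and seg: "1 \<le> i \<Longrightarrow> i \<le> V \<Longrightarrow> kk i < i \<and> i \<le> ll i \<and> ll i \<le> V"
    and seg_same: "1 \<le> i \<Longrightarrow> i \<le> V \<Longrightarrow> kk i < j \<Longrightarrow> j \<le> ll i \<Longrightarrow> kk j = kk i \<and> ll j = ll i"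
    and f_first: "2 \<le> i \<Longrightarrow> i \<le> V \<Longrightarrow> f (Suc (kk i)) \<le> f i"
    and f_dec: "2 \<le> i \<Longrightarrow> i \<le> V \<Longrightarrow> 2 \<le> j \<Longrightarrow> j \<le> V \<Longrightarrow> kk i < kk j \<Longrightarrow> f (Suc (kk j)) < f (Suc (kk i))"
begin

lemma kk_ge: "1 \<le> i \<Longrightarrow> i \<le> V \<Longrightarrow> ll i < j \<Longrightarrow> j \<le> V \<Longrightarrow> ll i \<le> kk j"
proof (rule ccontr)
  assume a: "1 \<le> i" "i \<le> V" "ll i < j" "j \<le> V" "\<not> ll i \<le> kk j"
  then have "kk (ll i) = kk j \<and> ll (ll i) = ll j" using seg[of j] by (intro seg_same) auto
  moreover have "ll (ll i) = ll i" using a seg[of i] seg_same[of i "ll i"] by auto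
  ultimately show False using a seg[of j] by auto
qed

lemma same_iff:
  assumes "1 \<le> i" "i \<le> V" "1 \<le> j" "j \<le> V"
  shows "kk i = kk j \<longleftrightarrow> kk i < j \<and> j \<le> ll i"
proof
  assume "kk i = kk j"
  moreover have "kk j < j" "kk i < i" "i \<le> ll i" using assms seg by auto
  moreover have "ll i < j \<Longrightarrow> ll i \<le> kk j" using assms kk_ge by blast
  ultimately show "kk i < j \<and> j \<le> ll i" by linarith
next
  assume "kk i < j \<and> j \<le> ll i"
  then have "kk j = kk i" using assms seg_same by blast
  then show "kk i = kk j" by simp
qed

lemma ll_eq: "1 \<le> i \<Longrightarrow> i \<le> V \<Longrightarrow> 1 \<le> j \<Longrightarrow> j \<le> V \<Longrightarrow> kk i = kk j \<Longrightarrow> ll i = ll j"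
  using same_iff[of i j] seg_same[of i j] by simp

lemma kk_mono:
  assumes "1 \<le> i" "i \<le> j" "j \<le> V"
  shows "kk i \<le> kk j"
proof (cases "j \<le> ll i")
  case True
  have "kk i < i" using assms seg by auto
  then have "kk j = kk i" using assms seg_same[of i j] True by linarith
  then show ?thesis by simp
next
  case False
  have "kk i < i" "i \<le> ll i" using assms seg[of i] by auto
  moreover have "ll i \<le> kk j" using False assms kk_ge[of i j] by linarith
  ultimately show ?thesis by linarith
qed

lemma ll_le_kk:
  assumes "1 \<le> i" "i \<le> kk j" "1 \<le> j" "j \<le> V"
  shows "ll i \<le> kk j"
proof (rule ccontr)
  assume *: "\<not> ll i \<le> kk j"
  have "kk j < j" using assms seg by blast
  then have iV: "i \<le> V" using assms by linarith
  have "kk i < kk j" using seg[of i] assms iV by linarith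
  then have "kk (kk j) = kk i \<and> ll (kk j) = ll i" using seg_same[of i "kk j"] * assms iV by simp
  moreover have "ll i < j" using same_iff[of i j] assms iV \<open>kk i < kk j\<close> \<open>kk j < j\<close> by linarith
  then show False using kk_ge[of i j] assms iV * by linarith
qed

lemma kk_pos: "2 \<le> i \<Longrightarrow> i \<le> V \<Longrightarrow> 1 \<le> kk i"
  using kk_ge[of 1 i] ll_1 by simp

lemma kk_Suc_ll: "1 \<le> i \<Longrightarrow> ll i < V \<Longrightarrow> i \<le> V \<Longrightarrow> kk (Suc (ll i)) = ll i"
  using kk_ge[of i "Suc (ll i)"] seg[of "Suc (ll i)"] by force

lemma kk_Suc_kk: "1 \<le> i \<Longrightarrow> i \<le> V \<Longrightarrow> kk (Suc (kk i)) = kk i \<and> ll (Suc (kk i)) = ll i"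
  using seg_same[of i "Suc (kk i)"] seg[of i] by auto

lemma ll_kk: "1 \<le> kk i \<Longrightarrow> 1 \<le> i \<Longrightarrow> i \<le> V \<Longrightarrow> ll (kk i) = kk i"
  using ll_le_kk[of "kk i" i] seg[of "kk i"] seg[of i] by force

text \<open>An access at depth \<open>d\<close> lets rank \<open>i \<le> d\<close> take over the slot of rank \<open>source d i\<close>.\<close>

definition source :: "nat \<Rightarrow> nat \<Rightarrow> nat" where
  "source d i = (if d < i then i else if i = Suc (kk i) then min d (ll i) else i - 1)"

text \<open>A permutation of \<open>{1..V}\<close> that preserves every segment and is the identity
  beyond rank m. Keeping it total lets an item accessed for the first time enter as rank
  \<open>m + 1\<close> with slot \<open>m + 1\<close>, as if it had been there before.\<close>

definition slot_map :: "nat \<Rightarrow> (nat \<Rightarrow> nat) \<Rightarrow> bool" where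
  "slot_map m \<tau> \<longleftrightarrow> (\<forall>i\<in>{1..V}. \<tau> i \<in> {1..V} \<and> kk (\<tau> i) = kk i) \<and> inj_on \<tau> {1..V} \<and>
     (\<forall>i\<in>{m<..V}. \<tau> i = i)"

lemma source_range: "1 \<le> i \<Longrightarrow> i \<le> V \<Longrightarrow> source d i \<in> {1..V} \<and> kk (source d i) = kk i"
  using seg[of i] seg_same[of i "i - 1"] seg_same[of i "min d (ll i)"] by (auto simp: source_def)

lemma source_inj: "inj_on (source d) {1..V}"
proof (rule inj_onI)
  fix i j assume ij: "i \<in> {1..V}" "j \<in> {1..V}" "source d i = source d j"
  then have "kk i = kk j" using source_range[of i d] source_range[of j d] by auto
  moreover from this have "ll i = ll j" using ij ll_eq by auto
  ultimately show "i = j" using ij seg[of i] seg[of j]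
    by (auto simp: source_def min_def split: if_splits)
qed

lemma slot_map_source:
  assumes "slot_map m \<tau>"
  shows "slot_map (max m d) (\<tau> \<circ> source d)"
  unfolding slot_map_def
proof (intro conjI ballI)
  fix i assume i: "i \<in> {1..V}"
  then show "(\<tau> \<circ> source d) i \<in> {1..V}" "kk ((\<tau> \<circ> source d) i) = kk i"
    using assms source_range[of i d] unfolding slot_map_def by auto
next
  have "source d ` {1..V} \<subseteq> {1..V}" using source_range by auto
  then show "inj_on (\<tau> \<circ> source d) {1..V}"
    using assms source_inj[of d] unfolding slot_map_def by (auto intro: comp_inj_on inj_on_subset)
next
  fix i assume "i \<in> {max m d<..V}"
  then show "(\<tau> \<circ> source d) i = i" using assms by (auto simp: slot_map_def source_def)
qed

lemma slot_bounds:
  assumes "slot_map m \<tau>" "1 \<le> i" "i \<le> V"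
  shows "kk i < \<tau> i" "\<tau> i \<le> ll i" "1 \<le> \<tau> i" "\<tau> i \<le> V" "kk (\<tau> i) = kk i"
proof -
  have t: "\<tau> i \<in> {1..V}" "kk (\<tau> i) = kk i" using assms unfolding slot_map_def by auto
  then have r: "1 \<le> \<tau> i" "\<tau> i \<le> V" by simp_all
  have "ll (\<tau> i) = ll i" using ll_eq[OF r assms(2,3) t(2)] .
  then show "kk i < \<tau> i" "\<tau> i \<le> ll i" "1 \<le> \<tau> i" "\<tau> i \<le> V" "kk (\<tau> i) = kk i"
    using seg[OF r] r t(2) by simp_all
qed

text \<open>A slot beyond m would be a fixed point of \<open>\<tau>\<close>, so by injectivity no
  rank up to m can hold it.\<close>

lemma slot_le: "slot_map m \<tau> \<Longrightarrow> 1 \<le> i \<Longrightarrow> i \<le> m \<Longrightarrow> m \<le> V \<Longrightarrow> \<tau> i \<le> m"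
proof (rule ccontr)
  assume a: "slot_map m \<tau>" "1 \<le> i" "i \<le> m" "m \<le> V" "\<not> \<tau> i \<le> m"
  then have "\<tau> (\<tau> i) = \<tau> i" "\<tau> i \<in> {1..V}" using slot_bounds[of m \<tau> i] by (auto simp: slot_map_def)
  then show False using a unfolding slot_map_def by (auto dest: inj_onD[of \<tau> _ "\<tau> i" i])
qed

lemma slot_inj: "slot_map m \<tau> \<Longrightarrow> A \<subseteq> {1..V} \<Longrightarrow> inj_on \<tau> A"
  unfolding slot_map_def using inj_on_subset by blast

lemma slot_image: "slot_map m \<tau> \<Longrightarrow> m \<le> V \<Longrightarrow> \<tau> ` {1..m} = {1..m}"
proof -
  assume a: "slot_map m \<tau>" "m \<le> V"
  have "\<tau> ` {1..m} \<subseteq> {1..m}" using a slot_le slot_bounds by fastforce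
  moreover have "inj_on \<tau> {1..m}" using a(2) slot_inj[OF a(1)] by simp
  ultimately show ?thesis by (simp add: endo_inj_surj)
qed

section \<open>Buffers described by slots\<close>

definition buffer :: "(nat \<Rightarrow> 'a) \<Rightarrow> nat \<Rightarrow> (nat \<Rightarrow> nat) \<Rightarrow> nat \<Rightarrow> 'a set" where
  "buffer \<Lambda> m \<tau> C = \<Lambda> ` {i \<in> {1..m}. \<tau> i \<le> C}"

lemma card_buffer:
  assumes "slot_map m \<tau>" "m \<le> V" "inj_on \<Lambda> {1..V}"
  shows "card (buffer \<Lambda> m \<tau> C) = min m C"
proof -
  define S where "S = {i \<in> {1..m}. \<tau> i \<le> C}"
  have S: "S \<subseteq> {1..V}" using assms(2) by (auto simp: S_def)
  have "\<tau> ` S = \<tau> ` {1..m} \<inter> {..C}" by (auto simp: S_def)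
  also have "\<dots> = {1..min m C}" unfolding slot_image[OF assms(1,2)] by auto
  finally have "card S = min m C" using card_image[OF slot_inj[OF assms(1) S]] by simp
  moreover have "inj_on \<Lambda> S" using assms(3) S inj_on_subset by blast
  ultimately show ?thesis unfolding buffer_def S_def[symmetric] by (simp add: card_image)
qed

text \<open>Meant for the items other than the accessed one, which moves to rank 1 instead; for
  \<open>j = d\<close> the value has no meaning.\<close>

definition new_rank :: "nat \<Rightarrow> nat \<Rightarrow> nat" where
  "new_rank d j = (if j < d then Suc j else j)"

text \<open>The condition \<open>kk (Suc j) = j\<close> says that j is the last rank of its segment.
  An item keeps its slot unless it is pushed across such a border; then it takes the slot of the
  last item of the segment it enters, or of the accessed item if that one lies in this
  segment.\<close>

lemma source_new_rank:
  assumes \<tau>: "slot_map m \<tau>" and m: "m \<le> V" and d: "1 \<le> d" "d \<le> V"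
    and j: "1 \<le> j" "j \<le> m" "j \<noteq> d"
  shows "kk (Suc j) = j \<Longrightarrow> j < d \<Longrightarrow> (\<tau> \<circ> source d) (new_rank d j) = \<tau> (min d (ll (Suc j)))"
    "kk (Suc j) \<noteq> j \<or> d < j \<Longrightarrow> (\<tau> \<circ> source d) (new_rank d j) = \<tau> j"
  using j by (auto simp: source_def new_rank_def)

text \<open>If the slot of d is at most C, all segments before that of d have their slots below C.
  An item that crosses a border then exchanges one slot below C for another one, or takes the slot
  of d itself, so no membership changes.\<close>

lemma hit_slots:
  assumes \<tau>: "slot_map m \<tau>" and m: "m \<le> V" and d: "1 \<le> d" "d \<le> m" "\<tau> d \<le> C"
    and j: "1 \<le> j" "j \<le> m" "j \<noteq> d"
  shows "(\<tau> \<circ> source d) (new_rank d j) \<le> C \<longleftrightarrow> \<tau> j \<le> C"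
proof (cases "kk (Suc j) = j \<and> j < d")
  case True
  have dV: "d \<le> V" using m d by simp
  have jd: "Suc j \<le> d" "Suc j \<le> V" using True dV by auto
  have eq: "(\<tau> \<circ> source d) (new_rank d j) = \<tau> (min d (ll (Suc j)))"
    using source_new_rank(1)[OF \<tau> m d(1) dV j] True by simp
  have kkd: "j \<le> kk d" using kk_mono[OF _ jd(1) dV] True by simp
  have "ll j = j" using ll_kk[of "Suc j"] True j jd by simp
  then have "\<tau> j \<le> j" using slot_bounds(2)[OF \<tau>, of j] j jd by simp
  moreover have kd: "kk d < \<tau> d" using slot_bounds(1)[OF \<tau> d(1) dV] .
  ultimately have "\<tau> j \<le> C" using kkd d(3) by linarith
  moreover have "\<tau> (min d (ll (Suc j))) \<le> C"
  proof (cases "d \<le> ll (Suc j)")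
    case True
    then show ?thesis using d(3) by (simp add: min_def)
  next
    case False
    then have "ll (Suc j) \<le> kk d" using kk_ge[of "Suc j" d] jd dV by simp
    moreover have "ll (ll (Suc j)) = ll (Suc j)" "1 \<le> ll (Suc j)"
      using seg[of "Suc j"] seg_same[of "Suc j" "ll (Suc j)"] jd by auto
    then have "\<tau> (ll (Suc j)) \<le> ll (Suc j)" using slot_bounds(2)[OF \<tau>, of "ll (Suc j)"] False dV by simp
    ultimately show ?thesis using False kd d(3) by (simp add: min_def)
  qed
  ultimately show ?thesis using eq by simp
next
  case False
  then have "(\<tau> \<circ> source d) (new_rank d j) = \<tau> j"
    using source_new_rank(2)[OF \<tau> m d(1) _ j] m d j(3) by fastforce
  then show ?thesis by simp
qed

text \<open>The rank after the access. Only two items compete: the one pushed from K to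
  \<open>K + 1\<close> and, if it is buffered, the one pushed from L to \<open>L + 1\<close>, where
  \<open>(K, L]\<close> is the segment of \<open>C + 1\<close>. The second one wins whenever it
  exists, as its segment has the smaller rate.\<close>

definition victim_rank :: "(nat \<Rightarrow> nat) \<Rightarrow> nat \<Rightarrow> nat \<Rightarrow> nat" where
  "victim_rank \<tau> d C =
     (let L = ll (Suc C) in if L < d \<and> \<tau> L \<le> C then Suc L else Suc (kk (Suc C)))"

context
  fixes m \<tau> d C
  assumes \<tau>: "slot_map m \<tau>" and m: "m \<le> V" and d: "1 \<le> d" "d \<le> V" "d \<le> Suc m"
    and C: "1 \<le> C" "C \<le> m" and miss: "C < \<tau> d"
begin

lemma C_less: "C < V"
  using slot_bounds(4)[OF \<tau> d(1,2)] miss by linarith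

lemma seg_C: "1 \<le> kk (Suc C)" "kk (Suc C) \<le> C" "Suc C \<le> ll (Suc C)" "ll (Suc C) \<le> V"
  using seg[of "Suc C"] kk_pos[of "Suc C"] C C_less by auto

text \<open>The slot of d exceeds C, so d lies in the segment of \<open>C + 1\<close> or in a later
  one. Hence the item of rank K is indeed pushed across the border.\<close>

lemma kk_C_less: "kk (Suc C) < d"
proof -
  have "kk (Suc C) \<le> kk (\<tau> d)" using kk_mono[of "Suc C" "\<tau> d"] miss slot_bounds(4)[OF \<tau> d(1,2)] by simp
  then show ?thesis using slot_bounds(5)[OF \<tau> d(1,2)] seg[OF d(1,2)] by linarith
qed

text \<open>Only items pushed across a border j matter. If j lies before K, the old and the new slot
  are both at most C. At \<open>j = K\<close> the outcome depends on who leaves the segment of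
  \<open>C + 1\<close>. From L on, every new slot exceeds C, and only the item of rank L can have
  had a smaller one.\<close>

lemma miss_slots:
  assumes j: "1 \<le> j" "j \<le> m" "j \<noteq> d"
  shows "(\<tau> \<circ> source d) (new_rank d j) \<le> C \<longleftrightarrow> \<tau> j \<le> C \<and> new_rank d j \<noteq> victim_rank \<tau> d C"
proof -
  define K where "K = kk (Suc C)"
  define L where "L = ll (Suc C)"
  have KL: "1 \<le> K" "K \<le> C" "C < L" "L \<le> V" "K < d"
    using seg_C kk_C_less by (auto simp: K_def L_def)
  have v: "victim_rank \<tau> d C = (if L < d \<and> \<tau> L \<le> C then Suc L else Suc K)"
    by (simp add: victim_rank_def Let_def K_def L_def)
  have first_K: "kk (Suc K) = K" "ll (Suc K) = L" using kk_Suc_kk[of "Suc C"] C_less by (auto simp: K_def L_def)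
  have first_L: "kk (Suc L) = L" if "L < V" using kk_Suc_ll[of "Suc C"] that C_less by (simp add: L_def)
  have jV: "j \<le> V" using j m by simp
  consider (gt) "d < j" | (inner) "j < d" "kk (Suc j) \<noteq> j" | (edge) "j < d" "kk (Suc j) = j" using j(3) by linarith
  then show ?thesis
  proof cases
    case gt
    then have "new_rank d j = j" "victim_rank \<tau> d C \<le> d" using KL by (auto simp: new_rank_def v)
    then show ?thesis using gt source_new_rank(2)[OF \<tau> m d(1,2) j] by auto
  next
    case inner
    have "Suc j \<noteq> victim_rank \<tau> d C" using inner(2) first_K first_L d(2) by (auto simp: v split: if_splits)
    then show ?thesis using inner source_new_rank(2)[OF \<tau> m d(1,2) j] by (auto simp: new_rank_def)
  next
    case edge
    define r where "r = min d (ll (Suc j))"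
    have sj: "1 \<le> Suc j" "Suc j \<le> V" using edge d by auto
    have r: "1 \<le> r" "r \<le> V" "kk r = j" "ll r = ll (Suc j)"
      using seg[OF sj] seg_same[OF sj, of r] edge d by (auto simp: r_def)
    have eq: "(\<tau> \<circ> source d) (new_rank d j) = \<tau> r" using source_new_rank(1)[OF \<tau> m d(1,2) j edge(2,1)] by (simp add: r_def)
    have nr: "new_rank d j = Suc j" using edge by (simp add: new_rank_def)
    then have eq': "\<tau> (source d (Suc j)) = \<tau> r" using eq by simp
    have "ll j = j" using ll_kk[of "Suc j"] edge(2) j(1) sj by simp
    then have tj: "\<tau> j \<le> j" using slot_bounds(2)[OF \<tau> j(1) jV] by simp
    have tr: "j < \<tau> r" "\<tau> r \<le> ll (Suc j)" using slot_bounds(1,2)[OF \<tau> r(1,2)] r(3,4) by auto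
    consider "j < K" | "j = K" | "K < j" by linarith
    then show ?thesis
    proof cases
      case 1
      then have "ll (Suc j) \<le> K" using ll_le_kk[of "Suc j" "Suc C"] C_less by (simp add: K_def)
      then show ?thesis using 1 KL tj tr by (auto simp: eq' nr v)
    next
      case 2
      \<comment> \<open>The item of rank K inherits the slot of r. If r is d, this slot exceeds C
        and the item itself drops out, at rank \<open>K + 1\<close>. Otherwise r is L, and the item
        stays exactly if that of rank L was buffered, in which case the latter is the victim at rank
        \<open>L + 1\<close>.\<close>
      have rL: "r = min d L" using first_K 2 by (simp add: r_def)
      have "\<tau> j \<le> C" using tj 2 KL by simp
      moreover have "\<tau> r \<le> C \<longleftrightarrow> L < d \<and> \<tau> L \<le> C"
        using miss by (cases "L < d") (auto simp: rL min_def)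
      ultimately show ?thesis using 2 KL nr eq' by (auto simp: v)
    next
      case 3
      have jL: "L \<le> j"
      proof (rule ccontr)
        assume "\<not> L \<le> j"
        then have "kk (Suc j) = K" using seg_same[of "Suc C" "Suc j"] 3 C_less by (simp add: K_def L_def)
        then show False using edge 3 by simp
      qed
      then have no: "\<not> \<tau> r \<le> C" using tr KL by linarith
      \<comment> \<open>Either j is L and, if buffered, its item is the victim, or j lies in a later
        segment, whose slots all exceed C.\<close>
      have "\<not> (\<tau> j \<le> C \<and> Suc j \<noteq> victim_rank \<tau> d C)"
      proof (cases "j = L")
        case True
        then show ?thesis using edge(1) by (auto simp: v)
      next
        case False
        then have "L \<le> kk j" using kk_ge[of "Suc C" j] jL jV C_less by (simp add: L_def)
        then show ?thesis using slot_bounds(1)[OF \<tau> j(1) jV] KL by simp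
      qed
      then show ?thesis using no by (auto simp: eq' nr)
    qed
  qed
qed

text \<open>Buffered items have old ranks at most L, hence new ranks at most \<open>L + 1\<close>.
  If \<open>L + 1\<close> occurs, it begins a later segment and has the strictly least rate.
  Otherwise \<open>K + 1\<close> occurs, because the item of rank K is buffered and pushed; it
  begins the last segment concerned, so it has the least rate, and among equals it is nearest to the
  top.\<close>

lemma victim_rank_optimal:
  defines "G \<equiv> new_rank d ` {j \<in> {1..m}. \<tau> j \<le> C}"
  shows "victim_rank \<tau> d C \<in> G"
    "\<And>e. e \<in> G \<Longrightarrow> f (victim_rank \<tau> d C) \<le> f e"
    "\<And>e. e \<in> G \<Longrightarrow> f e = f (victim_rank \<tau> d C) \<Longrightarrow> victim_rank \<tau> d C \<le> e"
proof -
  define K where "K = kk (Suc C)"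
  define L where "L = ll (Suc C)"
  have KL: "1 \<le> K" "K \<le> C" "C < L" "L \<le> V" "K < d"
    using seg_C kk_C_less by (auto simp: K_def L_def)
  have v: "victim_rank \<tau> d C = (if L < d \<and> \<tau> L \<le> C then Suc L else Suc K)"
    by (simp add: victim_rank_def Let_def K_def L_def)
  have first_K: "kk (Suc K) = K" "ll (Suc K) = L" using kk_Suc_kk[of "Suc C"] C_less by (auto simp: K_def L_def)
  have first_L: "kk (Suc L) = L" if "L < V" using kk_Suc_ll[of "Suc C"] that C_less by (simp add: L_def)
  have "ll K = K" using ll_kk[of "Suc C"] KL C_less by (simp add: K_def)
  then have tK: "\<tau> K \<le> C" using slot_bounds(2)[OF \<tau>, of K] KL by simp
  show "victim_rank \<tau> d C \<in> G"
  proof (cases "L < d \<and> \<tau> L \<le> C")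
    case True
    then show ?thesis using KL d by (auto simp: v G_def new_rank_def intro!: image_eqI[of _ _ L])
  next
    case False
    then show ?thesis using KL tK C unfolding v G_def by (auto simp: new_rank_def intro!: image_eqI[of _ _ K])
  qed
  \<comment> \<open>One disjunction for both claims: the rate is strictly smaller, or it is no
    larger and the rank is no deeper, as the tie-breaking rule demands.\<close>
  have main: "f (victim_rank \<tau> d C) < f e \<or> f (victim_rank \<tau> d C) \<le> f e \<and> victim_rank \<tau> d C \<le> e" if eG: "e \<in> G" for e
  proof -
    obtain j where j0: "e = new_rank d j" "j \<in> {j \<in> {1..m}. \<tau> j \<le> C}" using eG unfolding G_def by blast
    then have j: "e = new_rank d j" "1 \<le> j" "j \<le> m" "\<tau> j \<le> C" by simp_all
    have "j \<noteq> d" using miss j(4) by auto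
    then have e2: "2 \<le> e" "e \<le> V" using j d m by (auto simp: new_rank_def)
    have jL: "j \<le> L"
    proof (rule ccontr)
      assume "\<not> j \<le> L"
      then have "L \<le> kk j" using kk_ge[of "Suc C" j] j m C_less by (simp add: L_def)
      then show False using slot_bounds(1)[OF \<tau>, of j] j m KL by simp
    qed
    have kkC: "2 \<le> Suc C" "Suc C \<le> V" using C C_less by auto
    show ?thesis
    proof (cases "L < d \<and> \<tau> L \<le> C")
      case True
      then have vL: "victim_rank \<tau> d C = Suc L" and LV: "Suc L \<le> V" using d by (auto simp: v)
      show ?thesis
      proof (cases "j = L")
        case True
        then show ?thesis using j(1) vL \<open>L < d \<and> _\<close> by (simp add: new_rank_def)
      next
        case False
        then have "e \<le> L" using j(1) jL by (simp add: new_rank_def)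
        then have "kk e < kk (Suc L)" using seg[of e] e2 first_L LV by simp
        then have "f (Suc (kk (Suc L))) < f (Suc (kk e))" using f_dec[of e "Suc L"] e2 LV KL by simp
        then show ?thesis using f_first[OF e2] first_L LV by (simp add: vL)
      qed
    next
      case False
      then have vK: "victim_rank \<tau> d C = Suc K" by (auto simp: v)
      have "e \<le> L" using j jL False by (cases "j = L") (auto simp: new_rank_def)
      show ?thesis
      proof (cases "e \<le> K")
        case True
        then have "kk e < kk (Suc C)" using seg[of e] e2 by (simp add: K_def)
        then have "f (Suc K) < f (Suc (kk e))" using f_dec[OF e2 kkC] by (simp add: K_def)
        then show ?thesis using f_first[OF e2] by (simp add: vK)
      next
        case False
        then have "kk e = K" using seg_same[of "Suc C" e] \<open>e \<le> L\<close> C_less by (simp add: K_def L_def)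
        then show ?thesis using f_first[OF e2] False by (simp add: vK)
      qed
    qed
  qed
  show "\<And>e. e \<in> G \<Longrightarrow> f (victim_rank \<tau> d C) \<le> f e" using main by force
  show "\<And>e. e \<in> G \<Longrightarrow> f e = f (victim_rank \<tau> d C) \<Longrightarrow> victim_rank \<tau> d C \<le> e" using main by force
qed

end

text \<open>The state of the simulation of all buffers at once: LRU stack, number \<open>m\<close> of distinct items
  accessed so far, slots of the ranks, and the number of hits per slot. An item accessed for the first
  time counts as having rank \<open>m + 1\<close> and slot \<open>m + 1\<close>.\<close>

definition eff_depth :: "(nat \<Rightarrow> nat) \<Rightarrow> nat \<Rightarrow> nat \<Rightarrow> nat" where
  "eff_depth \<Lambda> m x = (if depth V \<Lambda> x \<le> m then depth V \<Lambda> x else Suc m)"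

fun sim_step :: "(nat \<Rightarrow> nat) \<times> nat \<times> (nat \<Rightarrow> nat) \<times> (nat \<Rightarrow> nat) \<Rightarrow> nat
    \<Rightarrow> (nat \<Rightarrow> nat) \<times> nat \<times> (nat \<Rightarrow> nat) \<times> (nat \<Rightarrow> nat)" where
  "sim_step (\<Lambda>, m, \<tau>, h) x =
     (lru_access V \<Lambda> x, max m (eff_depth \<Lambda> m x), \<tau> \<circ> source (eff_depth \<Lambda> m x),
      if depth V \<Lambda> x \<le> m then h(\<tau> (depth V \<Lambda> x) := Suc (h (\<tau> (depth V \<Lambda> x)))) else h)"

end

section \<open>Agreement of the LPR buffers with the slots\<close>

lemma depth_stack: "bij_betw \<Lambda> {1..V} {1..V} \<Longrightarrow> i \<in> {1..V} \<Longrightarrow> depth V \<Lambda> (\<Lambda> i) = i"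
  unfolding depth_def by (auto simp: bij_betw_def)

lemma stack_depth:
  assumes "bij_betw \<Lambda> {1..V} {1..V}" "x \<in> {1..V}"
  shows "depth V \<Lambda> x \<in> {1..V}" "\<Lambda> (depth V \<Lambda> x) = x"
  using assms unfolding depth_def bij_betw_def by (metis inv_into_into, metis f_inv_into_f)

lemma bij_lru_access:
  assumes \<Lambda>: "bij_betw \<Lambda> {1..V} {1..V}" and x: "x \<in> {1..V}"
  shows "bij_betw (lru_access V \<Lambda> x) {1..V} {1..V}"
proof -
  define D where "D = depth V \<Lambda> x"
  define r where "r i = (if i = 1 then D else if i \<le> D then i - 1 else i)" for i
  have D: "D \<in> {1..V}" "\<Lambda> D = x" using stack_depth[OF assms] by (auto simp: D_def)
  have "lru_access V \<Lambda> x i = (\<Lambda> \<circ> r) i" if "i \<in> {1..V}" for i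
    using that D by (auto simp: lru_access_def r_def D_def[symmetric])
  moreover have "bij_betw r {1..V} {1..V}"
  proof -
    have "inj_on r {1..V}" using D(1) by (auto simp: inj_on_def r_def split: if_splits)
    moreover have "r ` {1..V} \<subseteq> {1..V}" using D(1) by (auto simp: r_def)
    ultimately show ?thesis by (simp add: bij_betw_def endo_inj_surj)
  qed
  ultimately show ?thesis using bij_betw_trans[of r _ _ \<Lambda>] \<Lambda> bij_betw_cong[of "{1..V}" "lru_access V \<Lambda> x" "\<Lambda> \<circ> r"] by blast
qed

locale lpr_segmentation = segmentation V "profit_rate V s" kk ll for V s kk ll
begin

text \<open>A hit leaves the buffer unchanged by \<open>hit_slots\<close>. A miss with room left can
  only be a first access, and nothing is lost. On a miss with a full buffer,
  \<open>miss_slots\<close> tells which rank drops out, and \<open>victim_rank_optimal\<close> shows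
  that LPR evicts the same one.\<close>

lemma sim_access:
  assumes \<Lambda>: "bij_betw \<Lambda> {1..V} {1..V}" and m: "m \<le> V" and \<tau>: "slot_map m \<tau>" and x: "x \<in> {1..V}"
    and C: "C \<in> {1..V}"
  defines "d \<equiv> eff_depth \<Lambda> m x"
  shows "lpr_step V s C (\<Lambda>, buffer \<Lambda> m \<tau> C, k) x =
     (lru_access V \<Lambda> x, buffer (lru_access V \<Lambda> x) (max m d) (\<tau> \<circ> source d) C,
      if depth V \<Lambda> x \<le> m \<and> \<tau> (depth V \<Lambda> x) \<le> C then k else k + 1)" (is ?step)
    and "1 \<le> d" "d \<le> V" "d \<le> Suc m"
proof -
  define D where "D = depth V \<Lambda> x"
  define \<Lambda>' where "\<Lambda>' = lru_access V \<Lambda> x"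
  have D: "1 \<le> D" "D \<le> V" "\<Lambda> D = x" using stack_depth[OF \<Lambda> x] by (auto simp: D_def)
  have d_eq: "d = (if D \<le> m then D else Suc m)" by (simp add: d_def eff_depth_def D_def)
  show d: "1 \<le> d" "d \<le> V" "d \<le> Suc m" using D by (auto simp: d_eq)
  have dD: "d \<le> D" by (auto simp: d_eq)
  have inj: "inj_on \<Lambda> {1..V}" using \<Lambda> by (simp add: bij_betw_def)
  have B: "x \<in> buffer \<Lambda> m \<tau> C \<longleftrightarrow> D \<le> m \<and> \<tau> D \<le> C"
  proof
    assume "x \<in> buffer \<Lambda> m \<tau> C"
    then obtain i where i: "1 \<le> i" "i \<le> m" "\<tau> i \<le> C" "\<Lambda> i = x" by (auto simp: buffer_def)
    then have "i = D" using inj_onD[OF inj, of i D] D m by simp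
    then show "D \<le> m \<and> \<tau> D \<le> C" using i by simp
  next
    assume "D \<le> m \<and> \<tau> D \<le> C"
    then show "x \<in> buffer \<Lambda> m \<tau> C" using D by (auto simp: buffer_def intro!: image_eqI[of _ _ D])
  qed
  have new: "\<Lambda>' (new_rank d j) = \<Lambda> j" if "1 \<le> j" "j \<le> m" "j \<noteq> D" for j
    using that dD D(1) by (auto simp: \<Lambda>'_def lru_access_def new_rank_def D_def[symmetric] d_eq)
  \<comment> \<open>Rank 1 holds x, and every other rank in use is \<open>new_rank d j\<close> for
    exactly one old rank j. This expresses the new buffer by the old ranks, as the lemmas on slots
    require.\<close>
  have buf': "buffer \<Lambda>' (max m d) (\<tau> \<circ> source d) C =
      insert x (\<Lambda> ` {j \<in> {1..m} - {D}. (\<tau> \<circ> source d) (new_rank d j) \<le> C})"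
  proof (intro equalityI subsetI)
    fix y assume "y \<in> buffer \<Lambda>' (max m d) (\<tau> \<circ> source d) C"
    then obtain i where i: "1 \<le> i" "i \<le> max m d" "(\<tau> \<circ> source d) i \<le> C" "y = \<Lambda>' i"
      by (auto simp: buffer_def)
    show "y \<in> insert x (\<Lambda> ` {j \<in> {1..m} - {D}. (\<tau> \<circ> source d) (new_rank d j) \<le> C})"
    proof (cases "i = 1")
      case True
      then show ?thesis using i by (simp add: \<Lambda>'_def lru_access_def)
    next
      case False
      define j where "j = (if i \<le> d then i - 1 else i)"
      have "1 \<le> j" "j \<le> m" "j \<noteq> D" "new_rank d j = i"
        using i False d(3) by (auto simp: j_def new_rank_def d_eq split: if_splits)
      then show ?thesis using new[of j] i(3,4) by force
    qed
  next
    fix y assume "y \<in> insert x (\<Lambda> ` {j \<in> {1..m} - {D}. (\<tau> \<circ> source d) (new_rank d j) \<le> C})"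
    then consider "y = x" | j where "1 \<le> j" "j \<le> m" "j \<noteq> D" "(\<tau> \<circ> source d) (new_rank d j) \<le> C" "y = \<Lambda> j"
      by auto
    then show "y \<in> buffer \<Lambda>' (max m d) (\<tau> \<circ> source d) C"
    proof cases
      case 1
      \<comment> \<open>Since rank 1 is a segment by itself, the accessed item always receives slot
        1 and so belongs to every buffer.\<close>
      have "\<tau> 1 \<le> 1" using slot_bounds(2)[OF \<tau>, of 1] ll_1 V_pos by simp
      then have "(\<tau> \<circ> source d) 1 \<le> C" using C d(1) kk_1 ll_1 by (simp add: source_def)
      moreover have "\<Lambda>' 1 = x" by (simp add: \<Lambda>'_def lru_access_def)
      ultimately show ?thesis using 1 d(1) unfolding buffer_def by (intro image_eqI[of _ _ 1]) auto
    next
      case 2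
      have "1 \<le> new_rank d j" "new_rank d j \<le> max m d" using 2 by (auto simp: new_rank_def)
      then show ?thesis using 2 new[of j] unfolding buffer_def by (intro image_eqI[of _ _ "new_rank d j"]) auto
    qed
  qed
  have neq_d: "j \<noteq> D \<Longrightarrow> j \<le> m \<Longrightarrow> j \<noteq> d" for j by (auto simp: d_eq)
  have card: "card (buffer \<Lambda> m \<tau> C) = min m C" using card_buffer[OF \<tau> m inj] .
  show ?step
  proof (cases "D \<le> m \<and> \<tau> D \<le> C")
    case hit: True
    then have dD': "d = D" by (simp add: d_eq)
    have "{j \<in> {1..m} - {D}. (\<tau> \<circ> source d) (new_rank d j) \<le> C} = {j \<in> {1..m} - {D}. \<tau> j \<le> C}"
      using hit_slots[OF \<tau> m d(1), of C] hit dD' by auto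
    then have "buffer \<Lambda>' (max m d) (\<tau> \<circ> source d) C = insert x (\<Lambda> ` {j \<in> {1..m} - {D}. \<tau> j \<le> C})"
      using buf' by simp
    also have "\<dots> = buffer \<Lambda> m \<tau> C" using hit D by (auto simp: buffer_def)
    finally show ?thesis using hit B by (simp add: \<Lambda>'_def D_def)
  next
    case miss: False
    then have xB: "x \<notin> buffer \<Lambda> m \<tau> C" using B by simp
    show ?thesis
    proof (cases "m < C")
      case True
      \<comment> \<open>A rank in use has a slot of at most m, which is below C here, so its item
        would be buffered.\<close>
      have "\<not> D \<le> m" using miss slot_le[OF \<tau>, of D] m D True by auto
      then have dm: "d = Suc m" by (simp add: d_eq)
      have sm: "slot_map (max m d) (\<tau> \<circ> source d)" using slot_map_source[OF \<tau>] .
      have "(\<tau> \<circ> source d) (new_rank d j) \<le> C" if "1 \<le> j" "j \<le> m" for j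
        using slot_le[OF sm, of "new_rank d j"] that dm True d(2) by (auto simp: new_rank_def)
      then have "{j \<in> {1..m} - {D}. (\<tau> \<circ> source d) (new_rank d j) \<le> C} = {1..m}"
        using \<open>\<not> D \<le> m\<close> by auto
      moreover have "buffer \<Lambda> m \<tau> C = \<Lambda> ` {1..m}"
      proof -
        have "{i \<in> {1..m}. \<tau> i \<le> C} = {1..m}" using slot_le[OF \<tau>] m True by force
        then show ?thesis by (simp add: buffer_def)
      qed
      ultimately have "buffer \<Lambda>' (max m d) (\<tau> \<circ> source d) C = insert x (buffer \<Lambda> m \<tau> C)" using buf' by simp
      moreover have "card (buffer \<Lambda> m \<tau> C) < C" using card True by simp
      ultimately show ?thesis using miss xB by (simp add: \<Lambda>'_def D_def)
    next
      case False
      then have Cm: "1 \<le> C" "C \<le> m" using C by auto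
      \<comment> \<open>A first access counts as an access at rank \<open>m + 1\<close>, whose slot
        \<open>m + 1\<close> exceeds C. Both kinds of misses thus fall under the same
        analysis.\<close>
      have td: "C < \<tau> d"
      proof (cases "D \<le> m")
        case True
        then show ?thesis using miss by (simp add: d_eq)
      next
        case False
        then have "\<tau> d = d" "d = Suc m" using \<tau> d by (auto simp: slot_map_def d_eq)
        then show ?thesis using Cm by simp
      qed
      define G where "G = new_rank d ` {j \<in> {1..m}. \<tau> j \<le> C}"
      define v where "v = victim_rank \<tau> d C"
      have nD: "j \<noteq> D" if "1 \<le> j" "j \<le> m" "\<tau> j \<le> C" for j using that miss by auto
      have bij': "bij_betw \<Lambda>' {1..V} {1..V}" using bij_lru_access[OF \<Lambda> x] by (simp add: \<Lambda>'_def)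
      have rank_V: "new_rank d j \<in> {1..V}" if "1 \<le> j" "j \<le> m" for j using that d m by (auto simp: new_rank_def)
      have dep: "depth V \<Lambda>' (\<Lambda> j) = new_rank d j" if "1 \<le> j" "j \<le> m" "\<tau> j \<le> C" for j
        using new[of j] nD[OF that] that depth_stack[OF bij' rank_V[of j]] by metis
      have depG: "depth V \<Lambda>' ` buffer \<Lambda> m \<tau> C = G"
        using dep by (force simp: buffer_def G_def image_iff)
      have vic: "lpr_victim V s \<Lambda>' (buffer \<Lambda> m \<tau> C) = \<Lambda>' v"
        by (rule lpr_victim_eqI[OF _ _ _ _ depG])
          (use victim_rank_optimal[OF \<tau> m d Cm td] in \<open>auto simp: G_def v_def\<close>)
      have slots: "(\<tau> \<circ> source d) (new_rank d j) \<le> C \<longleftrightarrow> \<tau> j \<le> C \<and> new_rank d j \<noteq> v" if "1 \<le> j" "j \<le> m" "j \<noteq> D" for j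
        using miss_slots[OF \<tau> m d Cm td that(1,2)] neq_d that by (simp add: v_def)
      have vV: "v \<in> {1..V}" using victim_rank_optimal(1)[OF \<tau> m d Cm td] rank_V by (auto simp: v_def)
      have "\<Lambda> j = \<Lambda>' v \<longleftrightarrow> new_rank d j = v" if "1 \<le> j" "j \<le> m" "j \<noteq> D" for j
        using new[OF that] rank_V[OF that(1,2)] vV bij' by (metis bij_betw_def inj_onD)
      then have "\<Lambda> ` {j \<in> {1..m} - {D}. (\<tau> \<circ> source d) (new_rank d j) \<le> C} = buffer \<Lambda> m \<tau> C - {\<Lambda>' v}"
        using slots nD unfolding buffer_def by (auto simp: image_iff)
      then have "buffer \<Lambda>' (max m d) (\<tau> \<circ> source d) C = insert x (buffer \<Lambda> m \<tau> C - {\<Lambda>' v})" using buf' by simp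
      moreover have "\<not> card (buffer \<Lambda> m \<tau> C) < C" using card False by simp
      ultimately show ?thesis using miss xB vic by (auto simp: \<Lambda>'_def D_def Let_def)
    qed
  qed
qed

definition simulate :: "(nat \<Rightarrow> nat) \<Rightarrow> nat list \<Rightarrow> (nat \<Rightarrow> nat) \<times> nat \<times> (nat \<Rightarrow> nat) \<times> (nat \<Rightarrow> nat)" where
  "simulate \<Lambda> xs = foldl sim_step (\<Lambda>, 0, id, \<lambda>_. 0) xs"

lemma simulate_snoc: "simulate \<Lambda> (xs @ [x]) = sim_step (simulate \<Lambda> xs) x"
  by (simp add: simulate_def)

text \<open>An access to an item with slot p is a hit exactly for the capacities from p on, so for
  each C the misses and the prefix sum of the histogram up to C add up to the number of
  accesses.\<close>

lemma simulate_invariant: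
  assumes \<Lambda>\<^sub>0: "bij_betw \<Lambda>\<^sub>0 {1..V} {1..V}" and xs: "set xs \<subseteq> {1..V}"
    and sim: "simulate \<Lambda>\<^sub>0 xs = (\<Lambda>, m, \<tau>, h)"
  shows "bij_betw \<Lambda> {1..V} {1..V} \<and> m \<le> V \<and> slot_map m \<tau> \<and> (\<forall>C\<in>{1..V}. \<exists>k.
    foldl (lpr_step V s C) (\<Lambda>\<^sub>0, {}, 0) xs = (\<Lambda>, buffer \<Lambda> m \<tau> C, k) \<and> k + (\<Sum>p = 1..C. h p) = length xs)"
  using xs sim
proof (induction xs arbitrary: \<Lambda> m \<tau> h rule: rev_induct)
  case Nil
  then show ?case using \<Lambda>\<^sub>0 by (auto simp: simulate_def slot_map_def buffer_def)
next
  case (snoc x xs)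
  obtain \<Lambda>1 m1 \<tau>1 h1 where s1: "simulate \<Lambda>\<^sub>0 xs = (\<Lambda>1, m1, \<tau>1, h1)" by (metis surj_pair)
  define D where "D = depth V \<Lambda>1 x"
  define d where "d = eff_depth \<Lambda>1 m1 x"
  have x: "x \<in> {1..V}" using snoc.prems(1) by simp
  have IH: "bij_betw \<Lambda>1 {1..V} {1..V}" "m1 \<le> V" "slot_map m1 \<tau>1"
    "\<And>C. C \<in> {1..V} \<Longrightarrow> \<exists>k. foldl (lpr_step V s C) (\<Lambda>\<^sub>0, {}, 0) xs = (\<Lambda>1, buffer \<Lambda>1 m1 \<tau>1 C, k) \<and>
       k + (\<Sum>p = 1..C. h1 p) = length xs"
    using snoc.IH[OF _ s1] snoc.prems(1) by auto
  have eqs: "\<Lambda> = lru_access V \<Lambda>1 x" "m = max m1 d" "\<tau> = \<tau>1 \<circ> source d"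
      "h = (if D \<le> m1 then h1(\<tau>1 D := Suc (h1 (\<tau>1 D))) else h1)"
    using snoc.prems(2) by (auto simp: simulate_snoc s1 D_def d_def)
  have D: "1 \<le> D" "D \<le> V" using stack_depth[OF IH(1) x] by (auto simp: D_def)
  have d: "d \<le> V" using sim_access(3)[OF IH(1-3) x, of 1] V_pos by (simp add: d_def)
  show ?case
  proof (intro conjI ballI)
    show "bij_betw \<Lambda> {1..V} {1..V}" using bij_lru_access[OF IH(1) x] by (simp add: eqs)
    show "m \<le> V" using IH(2) d by (simp add: eqs)
    show "slot_map m \<tau>" using slot_map_source[OF IH(3)] by (simp add: eqs)
    fix C assume C: "C \<in> {1..V}"
    obtain k where k: "foldl (lpr_step V s C) (\<Lambda>\<^sub>0, {}, 0) xs = (\<Lambda>1, buffer \<Lambda>1 m1 \<tau>1 C, k)"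
        "k + (\<Sum>p = 1..C. h1 p) = length xs"
      using IH(4)[OF C] by blast
    define k' where "k' = (if D \<le> m1 \<and> \<tau>1 D \<le> C then k else k + 1)"
    have "foldl (lpr_step V s C) (\<Lambda>\<^sub>0, {}, 0) (xs @ [x]) = (\<Lambda>, buffer \<Lambda> m \<tau> C, k')"
      using sim_access(1)[OF IH(1-3) x C, of k] by (simp add: k eqs D_def d_def k'_def)
    moreover have "k' + (\<Sum>p = 1..C. h p) = length (xs @ [x])"
    proof (cases "D \<le> m1")
      case True
      have t: "1 \<le> \<tau>1 D" using slot_bounds(3)[OF IH(3) D] .
      have "(\<Sum>p = 1..C. h p) = (\<Sum>p = 1..C. h1 p + (if p = \<tau>1 D then 1 else 0))"
        using True by (intro sum.cong) (auto simp: eqs)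
      also have "\<dots> = (\<Sum>p = 1..C. h1 p) + (if \<tau>1 D \<le> C then 1 else 0)"
        using t by (simp add: sum.distrib)
      finally show ?thesis using True k(2) by (simp add: k'_def)
    next
      case False
      then show ?thesis using k(2) by (simp add: eqs k'_def)
    qed
    ultimately show "\<exists>k. foldl (lpr_step V s C) (\<Lambda>\<^sub>0, {}, 0) (xs @ [x]) = (\<Lambda>, buffer \<Lambda> m \<tau> C, k) \<and>
      k + (\<Sum>p = 1..C. h p) = length (xs @ [x])" by blast
  qed
qed

lemma lpr_misses_simulate:
  assumes "bij_betw \<Lambda>\<^sub>0 {1..V} {1..V}" "set xs \<subseteq> {1..V}" "simulate \<Lambda>\<^sub>0 xs = (\<Lambda>, m, \<tau>, h)" "C \<in> {1..V}"
  shows "lpr_misses V s C \<Lambda>\<^sub>0 xs = length xs - (\<Sum>p = 1..C. h p)"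
  using simulate_invariant[OF assms(1-3)] assms(4) unfolding lpr_misses_def by fastforce

end

section \<open>Computing the segments\<close>

lemma mean_le_iff:
  "i \<le> j \<Longrightarrow> mean s i j \<le> c \<longleftrightarrow> (\<Sum>k=i..j. s k) \<le> c * real (j - i + 1)"
  by (simp add: mean_def divide_le_eq)

lemma sum_eq_mean: "(\<Sum>k=i..j. s k) = mean s i j * real (j - i + 1)"
  by (simp add: mean_def)

lemma sum_split: "a \<le> b \<Longrightarrow> b \<le> c \<Longrightarrow> (\<Sum>k=a..c. s k) = (\<Sum>k=a..b. s k) + (\<Sum>k=Suc b..c. (s k :: real))"
proof -
  assume "a \<le> b" "b \<le> c"
  then have "{a..c} = {a..b} \<union> {Suc b..c}" "{a..b} \<inter> {Suc b..c} = {}" by auto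
  then show ?thesis by (simp add: sum.union_disjoint)
qed

definition prefix_dominated :: "(nat \<Rightarrow> real) \<Rightarrow> nat \<Rightarrow> nat \<Rightarrow> bool" where
  "prefix_dominated s a b \<longleftrightarrow> a \<le> b \<and> (\<forall>j\<in>{a..b}. mean s a j \<le> mean s a b)"

text \<open>The merged mean M is a weighted average, so it lies between M1 and M2. A prefix that
  takes n' elements of the second block has sum at most \<open>M1 * n1 + M2 * n'\<close>. This is at
  most \<open>M * (n1 + n')\<close>: the excess \<open>(M2 - M) * n'\<close> is largest for
  \<open>n' = n2\<close>, where it equals the deficit \<open>(M - M1) * n1\<close>.\<close>

lemma prefix_dominated_merge:
  assumes 1: "prefix_dominated s a b" and 2: "prefix_dominated s (Suc b) c"
    and le: "mean s a b \<le> mean s (Suc b) c"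
  shows "prefix_dominated s a c"
  unfolding prefix_dominated_def
proof (intro conjI ballI)
  have ab: "a \<le> b" "Suc b \<le> c" using 1 2 by (auto simp: prefix_dominated_def)
  then show "a \<le> c" by simp
  define n1 n2 where "n1 = real (b - a + 1)" and "n2 = real (c - Suc b + 1)"
  define M1 M2 M where "M1 = mean s a b" and "M2 = mean s (Suc b) c" and "M = mean s a c"
  have n: "real (c - a + 1) = n1 + n2" "0 < n1" "0 < n2" using ab by (auto simp: n1_def n2_def)
  have sum: "M * (n1 + n2) = M1 * n1 + M2 * n2"
    using sum_split[of a b c s] ab sum_eq_mean[of s a c] sum_eq_mean[of s a b] sum_eq_mean[of s "Suc b" c] n
    by (simp add: M1_def M2_def M_def n1_def n2_def)
  have M: "M1 \<le> M" "M \<le> M2"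
  proof -
    have "(M - M1) * (n1 + n2) = (M2 - M1) * n2" "(M2 - M) * (n1 + n2) = (M2 - M1) * n1"
      using sum by (simp_all add: algebra_simps)
    moreover have "0 \<le> (M2 - M1) * n2" "0 \<le> (M2 - M1) * n1" using le n by (simp_all add: M1_def M2_def)
    ultimately have "0 \<le> (M - M1) * (n1 + n2)" "0 \<le> (M2 - M) * (n1 + n2)" by simp_all
    then show "M1 \<le> M" "M \<le> M2" using n(2,3) by (simp_all add: zero_le_mult_iff)
  qed
  fix j assume j: "j \<in> {a..c}"
  show "mean s a j \<le> mean s a c"
  proof (cases "j \<le> b")
    case True
    then have "mean s a j \<le> M1" using 1 j by (auto simp: prefix_dominated_def M1_def)
    then show ?thesis using M(1) by (simp add: M_def)
  next
    case False
    define n' where "n' = real (j - Suc b + 1)"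
    have n': "n' \<le> n2" "0 \<le> n'" using False j by (auto simp: n'_def n2_def)
    have "mean s (Suc b) j \<le> M2" using 2 j False by (auto simp: prefix_dominated_def M2_def)
    then have "(\<Sum>k=Suc b..j. s k) \<le> M2 * n'" using mean_le_iff[of "Suc b" j s M2] False by (simp add: n'_def)
    then have "(\<Sum>k=a..j. s k) \<le> M1 * n1 + M2 * n'"
      using sum_split[of a b j s] ab False sum_eq_mean[of s a b] by (simp add: M1_def n1_def)
    also have "\<dots> \<le> M * (n1 + n')"
    proof -
      have "(M2 - M) * n' \<le> (M2 - M) * n2" using M(2) n' by (intro mult_left_mono) auto
      then show ?thesis using sum by (simp add: algebra_simps)
    qed
    also have "n1 + n' = real (j - a + 1)" using ab False by (simp add: n1_def n'_def)
    finally show ?thesis using mean_le_iff[of a j s] j by (simp add: M_def)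
  qed
qed

text \<open>\<open>chain V e a ps\<close>: the list \<open>ps\<close> contains the starts of consecutive blocks \<open>[p, e p]\<close> covering
  \<open>[a, V]\<close>.\<close>

fun chain :: "nat \<Rightarrow> (nat \<Rightarrow> nat) \<Rightarrow> nat \<Rightarrow> nat list \<Rightarrow> bool" where
  "chain V e a [] \<longleftrightarrow> a = Suc V"
| "chain V e a (p # ps) \<longleftrightarrow> p = a \<and> a \<le> e a \<and> e a \<le> V \<and> chain V e (Suc (e a)) ps"

lemma chain_ge: "chain V e a ps \<Longrightarrow> p \<in> set ps \<Longrightarrow> a \<le> p \<and> p \<le> e p \<and> e p \<le> V"
  by (induction ps arbitrary: a) force+

lemma chain_cong: "chain V e a ps \<Longrightarrow> (\<And>p. p \<in> set ps \<Longrightarrow> e' p = e p) \<Longrightarrow> chain V e' a ps"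
  by (induction ps arbitrary: a) auto

lemma chain_disjoint: "chain V e a ps \<Longrightarrow> p \<in> set ps \<Longrightarrow> q \<in> set ps \<Longrightarrow> p < q \<Longrightarrow> e p < q"
proof (induction ps arbitrary: a)
  case (Cons r ps)
  then show ?case using chain_ge[of V e "Suc (e r)" ps] by force
qed simp

abbreviation block_mean :: "(nat \<Rightarrow> real) \<Rightarrow> (nat \<Rightarrow> nat) \<Rightarrow> nat \<Rightarrow> real" where
  "block_mean s e p \<equiv> mean s p (e p)"

lemma chain_decreasing:
  assumes "chain V e a ps" "sorted_wrt (\<lambda>p q. block_mean s e q < block_mean s e p) ps"
    "p \<in> set ps" "q \<in> set ps" "p < q"
  shows "block_mean s e q < block_mean s e p"
  using assms
proof (induction ps arbitrary: a)
  case (Cons r ps)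
  then show ?case using chain_ge[of V e "Suc (e r)" ps] by force
qed simp

text \<open>Beyond its own block, the mean from p to j is a weighted average of the block mean and
  of a mean that starts at the next block. By induction the latter is at most the mean of that
  block, which is smaller. Hence the profit rate at the start of a block is the mean of the
  block.\<close>

lemma chain_upper:
  assumes "chain V e a ps" "sorted_wrt (\<lambda>p q. block_mean s e q < block_mean s e p) ps"
    "\<forall>p\<in>set ps. prefix_dominated s p (e p)" "p \<in> set ps" "j \<in> {p..V}"
  shows "mean s p j \<le> block_mean s e p"
  using assms
proof (induction ps arbitrary: a p)
  case (Cons r ps)
  show ?case
  proof (cases "p = r")
    case False
    then show ?thesis using Cons.IH[of "Suc (e r)" p] Cons.prems by simp
  next
    case True
    have r: "r = a" "a \<le> e a" "e a \<le> V" "chain V e (Suc (e a)) ps" using Cons.prems(1) by auto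
    show ?thesis
    proof (cases "j \<le> e p")
      case le: True
      then show ?thesis using Cons.prems True by (auto simp: prefix_dominated_def)
    next
      case False
      then obtain q qs where ps: "ps = q # qs" using r(4) Cons.prems(5) True r(1) by (cases ps) auto
      then have q: "q = Suc (e p)" using r True by simp
      have "mean s q j \<le> block_mean s e q"
        using Cons.IH[of "Suc (e r)" q] Cons.prems r False ps q by simp
      also have "\<dots> \<le> block_mean s e p" using Cons.prems(2) ps True by simp
      finally have "(\<Sum>k=q..j. s k) \<le> block_mean s e p * real (j - q + 1)"
        using mean_le_iff[of q j s] False q by simp
      moreover have "(\<Sum>k=p..j. s k) = (\<Sum>k=p..e p. s k) + (\<Sum>k=q..j. s k)"
        using sum_split[of p "e p" j s] False r True q by simp
      moreover have "real (j - p + 1) = real (e p - p + 1) + real (j - q + 1)" using False q r True by simp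
      ultimately have "(\<Sum>k=p..j. s k) \<le> block_mean s e p * real (j - p + 1)"
        using sum_eq_mean[of s p "e p"] by (simp add: distrib_left)
      then show ?thesis using mean_le_iff[of p j s] Cons.prems(5) by simp
    qed
  qed
qed simp

text \<open>What precedes i in the block has at most the mean of the block, so what is left has at
  least this mean. This bounds the profit rate inside a block from below.\<close>

lemma suffix_mean_ge:
  assumes "prefix_dominated s p b" "p \<le> i" "i \<le> b"
  shows "mean s p b \<le> mean s i b"
proof (cases "p = i")
  case False
  define M where "M = mean s p b"
  have "i - 1 \<in> {p..b}" using assms(2,3) False by auto
  then have "mean s p (i - 1) \<le> M" using assms(1) unfolding prefix_dominated_def M_def by blast
  then have "(\<Sum>k=p..i - 1. s k) \<le> M * real (i - 1 - p + 1)" using mean_le_iff[of p "i - 1" s M] assms False by simp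
  moreover have "(\<Sum>k=p..b. s k) = (\<Sum>k=p..i - 1. s k) + (\<Sum>k=i..b. s k)"
    using sum_split[of p "i - 1" b s] assms False by simp
  moreover have "(\<Sum>k=p..b. s k) = M * real (b - p + 1)" using sum_eq_mean[of s p b] by (simp add: M_def)
  moreover have "real (b - p + 1) = real (i - 1 - p + 1) + real (b - i + 1)" using assms False by simp
  then have "M * real (b - p + 1) = M * real (i - 1 - p + 1) + M * real (b - i + 1)" by (simp only: distrib_left)
  ultimately have "M * real (b - i + 1) \<le> (\<Sum>k=i..b. s k)" by linarith
  then show ?thesis unfolding M_def by (simp add: mean_def[of s i b] le_divide_eq)
qed simp

text \<open>At the start of a block the rate equals the block mean by \<open>chain_upper\<close>,
  and inside it is at least that by \<open>suffix_mean_ge\<close>; this gives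
  \<open>f_first\<close>. The strict decrease of the block means gives \<open>f_dec\<close>.\<close>

lemma segmentation_of_chain:
  assumes V: "2 \<le> V" and ch: "chain V e 2 ps"
    and dec: "sorted_wrt (\<lambda>p q. block_mean s e q < block_mean s e p) ps"
    and dom: "\<forall>p\<in>set ps. prefix_dominated s p (e p)"
    and kk: "kk 1 = 0" "\<And>i. i \<in> {2..V} \<Longrightarrow> Suc (kk i) \<in> set ps \<and> kk i < i \<and> i \<le> e (Suc (kk i))"
    and e1: "e 1 = 1"
  shows "lpr_segmentation V s kk (\<lambda>i. e (Suc (kk i)))"
proof -
  have rate: "profit_rate V s p = block_mean s e p" if "p \<in> set ps" for p
    unfolding profit_rate_def
    using chain_upper[OF ch dec dom that] chain_ge[OF ch that] by (intro Max_eqI) auto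
  have rate_ge: "block_mean s e (Suc (kk i)) \<le> profit_rate V s i" if i: "i \<in> {2..V}" for i
  proof -
    have "block_mean s e (Suc (kk i)) \<le> mean s i (e (Suc (kk i)))"
      using suffix_mean_ge[of s "Suc (kk i)"] dom kk(2)[OF i] by auto
    also have "\<dots> \<le> profit_rate V s i" unfolding profit_rate_def
      using kk(2)[OF i] chain_ge[OF ch, of "Suc (kk i)"] by (intro Max_ge) auto
    finally show ?thesis .
  qed
  have same: "kk j = kk i" if i: "i \<in> {2..V}" and j: "kk i < j" "j \<le> e (Suc (kk i))" for i j
  proof -
    have p: "2 \<le> Suc (kk i)" "e (Suc (kk i)) \<le> V" using kk(2)[OF i] chain_ge[OF ch, of "Suc (kk i)"] by auto
    then have jV: "j \<in> {2..V}" using j by simp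
    have "\<not> Suc (kk i) < Suc (kk j)" "\<not> Suc (kk j) < Suc (kk i)"
      using chain_disjoint[OF ch, of "Suc (kk i)" "Suc (kk j)"] chain_disjoint[OF ch, of "Suc (kk j)" "Suc (kk i)"]
        kk(2)[OF i] kk(2)[OF jV] j by linarith+
    then show ?thesis by simp
  qed
  show ?thesis
  proof (unfold_locales, goal_cases)
    case (4 i)
    then show ?case using kk e1 chain_ge[OF ch, of "Suc (kk i)"] V by (cases "i = 1") auto
  next
    case (5 i j)
    show ?case
    proof (cases "i = 1")
      case True
      then have "j = 1" using 5 kk(1) e1 by simp
      then show ?thesis using True by simp
    next
      case False
      then show ?thesis using 5 same[of i j] by simp
    qed
  next
    case (6 i)
    then show ?case using rate_ge[of i] rate[of "Suc (kk i)"] kk(2)[of i] by simp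
  next
    case (7 i j)
    then show ?case using chain_decreasing[OF ch dec, of "Suc (kk i)" "Suc (kk j)"] rate kk(2)[of i] kk(2)[of j] by simp
  qed (use V kk e1 in auto)
qed

section \<open>Pool adjacent violators as a program\<close>

lemma frame_rupd [simp]: "frame S \<sigma> (rupd a i v \<sigma>') \<longleftrightarrow> frame S \<sigma> \<sigma>'"
  by (simp add: frame_def)

text \<open>Equal means are merged too, so the means that survive decrease strictly.
  \<open>BAnd\<close> evaluates both sides: for the last block the comparison reads cells beyond V,
  but then the first conjunct already decides.\<close>

definition mergeable :: bexp where
  "mergeable = BAnd (WLess (Load ''en'' (Var ''i'')) (Var ''V''))
     (BNot (RLess
       (ROp RDiv (RLoad ''sm'' (Plus (Load ''en'' (Var ''i'')) (Num 1)))
         (OfWord (Minus (Load ''en'' (Plus (Load ''en'' (Var ''i'')) (Num 1))) (Load ''en'' (Var ''i'')))))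
       (ROp RDiv (RLoad ''sm'' (Var ''i''))
         (OfWord (Minus (Plus (Load ''en'' (Var ''i'')) (Num 1)) (Var ''i''))))))"

definition new_block :: com where
  "new_block = Block [Store ''en'' (Var ''i'') (Var ''i''), RStore ''sm'' (Var ''i'') (RLoad ''s'' (Var ''i''))]"

text \<open>The scan runs from right to left. The successor of the block at i starts at
  \<open>en i + 1\<close>, so the blocks form a linked list in \<open>en\<close> and no separate
  stack is required. Merging, starting a new block and stopping are alternatives within a single
  loop, which makes the linear bound a matter of one measure.\<close>

definition block_loop :: com where
  "block_loop = While (WLess (Num 0) (Var ''go''))
     (Cond mergeable
       (Block [RStore ''sm'' (Var ''i'') (ROp RAdd (RLoad ''sm'' (Var ''i''))
           (RLoad ''sm'' (Plus (Load ''en'' (Var ''i'')) (Num 1)))),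
         Store ''en'' (Var ''i'') (Load ''en'' (Plus (Load ''en'' (Var ''i'')) (Num 1)))])
       (Cond (WLess (Num 2) (Var ''i''))
         (Seq (Set ''i'' (Minus (Var ''i'') (Num 1))) new_block)
         (Set ''go'' (Num 0))))"

definition find_blocks :: com where
  "find_blocks = Block [Store ''en'' (Num 1) (Num 1), Set ''i'' (Var ''V''), new_block, Set ''go'' (Num 1), block_loop]"

text \<open>Makes the number of blocks a function of the memory, as required for the termination
  measure of \<open>block_loop\<close>.\<close>

lemma chain_unique: "chain V e a ps \<Longrightarrow> chain V e a qs \<Longrightarrow> ps = qs"
proof (induction ps arbitrary: a qs)
  case Nil
  then show ?case by (cases qs) auto
next
  case (Cons p ps)
  then show ?case by (cases qs) auto
qed

definition blocks_at :: "nat \<Rightarrow> (nat \<Rightarrow> real) \<Rightarrow> (nat \<Rightarrow> nat) \<Rightarrow> (nat \<Rightarrow> real) \<Rightarrow> nat \<Rightarrow> nat list \<Rightarrow> bool" where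
  "blocks_at V s e sm a ps \<longleftrightarrow> chain V e a ps \<and>
     (\<forall>p\<in>set ps. prefix_dominated s p (e p) \<and> sm p = (\<Sum>k=p..e p. s k))"

abbreviation decreasing :: "(nat \<Rightarrow> real) \<Rightarrow> (nat \<Rightarrow> nat) \<Rightarrow> nat list \<Rightarrow> bool" where
  "decreasing s e ps \<equiv> sorted_wrt (\<lambda>p q. block_mean s e q < block_mean s e p) ps"

lemma blocks_at_cong:
  "blocks_at V s e sm a ps \<Longrightarrow> (\<And>p. a \<le> p \<Longrightarrow> e' p = e p \<and> sm' p = sm p) \<Longrightarrow> blocks_at V s e' sm' a ps"
  unfolding blocks_at_def using chain_cong[of V e a ps e'] chain_ge[of V e a ps] by simp

lemma decreasing_cong:
  "decreasing s e ps \<Longrightarrow> (\<And>p. p \<in> set ps \<Longrightarrow> e' p = e p) \<Longrightarrow> decreasing s e' ps"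
  by (auto intro: sorted_wrt_mono_rel[rotated])

lemma blocks_new:
  assumes "blocks_at V s e sm (Suc i) ps" "i \<le> V"
  shows "blocks_at V s (e(i := i)) (sm(i := s i)) i (i # ps)"
proof -
  have "blocks_at V s (e(i := i)) (sm(i := s i)) (Suc i) ps"
    by (rule blocks_at_cong[OF assms(1)]) auto
  then show ?thesis using assms(2) by (simp add: blocks_at_def prefix_dominated_def)
qed

lemma blocks_merge:
  assumes b: "blocks_at V s e sm i (i # j # ps)" and le: "block_mean s e i \<le> block_mean s e j"
  shows "blocks_at V s (e(i := e j)) (sm(i := sm i + sm j)) i (i # ps)"
proof -
  have ch: "j = Suc (e i)" "i \<le> e i" "j \<le> e j" "e j \<le> V" "blocks_at V s e sm (Suc (e j)) ps"
    using b by (auto simp: blocks_at_def)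
  have "blocks_at V s (e(i := e j)) (sm(i := sm i + sm j)) (Suc (e j)) ps"
    by (rule blocks_at_cong[OF ch(5)]) (use ch in auto)
  moreover have "prefix_dominated s i (e j)"
    using prefix_dominated_merge[of s i "e i" "e j"] b le ch(1) by (simp add: blocks_at_def)
  moreover have "sm i + sm j = (\<Sum>k=i..e j. s k)"
    using sum_split[of i "e i" "e j" s] b ch by (simp add: blocks_at_def)
  ultimately show ?thesis using ch by (simp add: blocks_at_def)
qed

lemma block_mean_eq: "i \<le> e i \<Longrightarrow> (\<Sum>k=i..e i. s k) / real (Suc (e i) - i) = block_mean s e i"
  by (simp add: mean_def Suc_diff_le)

lemma wp_find_blocks:
  assumes V: "val \<sigma> ''V'' = V" "2 \<le> V" "V < W"
    and Q: "\<And>t \<sigma>' ps. t \<le> 500 * V + 500 \<Longrightarrow> chain V (words \<sigma>' ''en'') 2 ps \<Longrightarrow>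
      decreasing (reals \<sigma> ''s'') (words \<sigma>' ''en'') ps \<Longrightarrow>
      \<forall>p\<in>set ps. prefix_dominated (reals \<sigma> ''s'') p (words \<sigma>' ''en'' p) \<Longrightarrow>
      words \<sigma>' ''en'' 1 = 1 \<Longrightarrow> frame {''en'', ''i'', ''go''} \<sigma> \<sigma>' \<Longrightarrow> Q t \<sigma>'"
  shows "wp W find_blocks \<sigma> Q"
proof -
  define s where "s = reals \<sigma> ''s''"
  \<comment> \<open>Only the block at i may still violate the order; the later blocks already
    decrease. The flag \<open>go\<close> is 0 only after the block at 2 has passed the test as
    well.\<close>
  define J where "J \<tau> i ps \<longleftrightarrow> val \<tau> ''i'' = i \<and> 2 \<le> i \<and> i \<le> V \<and>
    blocks_at V s (words \<tau> ''en'') (reals \<tau> ''sm'') i (i # ps) \<and> decreasing s (words \<tau> ''en'') ps \<and>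
    words \<tau> ''en'' 1 = 1 \<and> reals \<tau> ''s'' = s \<and> frame {''en'', ''i'', ''go''} \<sigma> \<tau> \<and> val \<tau> ''go'' \<le> 1 \<and>
    (val \<tau> ''go'' = 0 \<longrightarrow> i = 2 \<and> decreasing s (words \<tau> ''en'') (i # ps))" for \<tau> i ps
  \<comment> \<open>A potential that drops by one in every round: a merge removes a block, a new
    block adds one but lowers \<open>2 * i\<close> by two, and the last round clears
    \<open>go\<close>. This gives the linear time bound.\<close>
  define \<mu> where "\<mu> \<tau> = 2 * val \<tau> ''i'' + length (THE ps. chain V (words \<tau> ''en'') (val \<tau> ''i'') ps) + val \<tau> ''go''" for \<tau>
  have \<mu>: "\<mu> \<tau> = 2 * i + Suc (length ps) + val \<tau> ''go''" if "J \<tau> i ps" for \<tau> i ps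
  proof -
    have c: "chain V (words \<tau> ''en'') i (i # ps)" using that by (simp add: J_def blocks_at_def)
    have "(THE ps. chain V (words \<tau> ''en'') i ps) = i # ps"
    proof (rule the_equality)
      show "chain V (words \<tau> ''en'') i (i # ps)" by (rule c)
      show "qs = i # ps" if "chain V (words \<tau> ''en'') i qs" for qs using chain_unique[OF that c] .
    qed
    then show ?thesis using that by (simp add: \<mu>_def J_def)
  qed
  define \<upsilon> where "\<upsilon> = upd ''go'' 0 1 (rupd ''sm'' V (s V) (upd ''en'' V V (upd ''i'' 0 V (upd ''en'' 1 1 \<sigma>))))"
  have start: "J \<upsilon> V []"
  proof -
    have "blocks_at V s ((words \<sigma> ''en'')(1 := 1, V := V)) ((reals \<sigma> ''sm'')(V := s V)) V [V]"
      using blocks_new[of V s _ _ V "[]"] by (simp add: blocks_at_def)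
    then show ?thesis using V by (simp add: J_def \<upsilon>_def s_def fun_upd_def)
  qed
  have loop: "wp W block_loop \<upsilon> (\<lambda>t \<sigma>'. t \<le> 200 * \<mu> \<upsilon> + 10 \<and> (\<exists>ps. J \<sigma>' 2 ps \<and> val \<sigma>' ''go'' = 0))"
    unfolding block_loop_def
  proof (rule wp_while_post[where I = "\<lambda>\<tau>. \<exists>i ps. J \<tau> i ps" and \<mu> = \<mu> and c = 100], goal_cases)
    case 1
    then show ?case using start by blast
  next
    case (2 \<tau>)
    then show ?case using V by simp
  next
    case (3 \<tau>)
    then obtain i ps where J: "J \<tau> i ps" and go: "val \<tau> ''go'' = 1" by (auto simp: J_def)
    define e where "e = words \<tau> ''en''"
    define sm where "sm = reals \<tau> ''sm''"
    note Jd = J[unfolded J_def, folded e_def sm_def]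
    have i: "val \<tau> ''i'' = i" "2 \<le> i" "i \<le> V" and b: "blocks_at V s e sm i (i # ps)" and dec: "decreasing s e ps"
      and fr: "frame {''en'', ''i'', ''go''} \<sigma> \<tau>" and s: "reals \<tau> ''s'' = s" and e1: "e 1 = 1"
      using Jd by auto
    have Vt: "val \<tau> ''V'' = V" using fr V(1) by (simp add: frame_def)
    have ei: "i \<le> e i" "e i \<le> V" "sm i = (\<Sum>k=i..e i. s k)" using b by (auto simp: blocks_at_def)
    have fits: "Suc (e i) \<le> W" "2 \<le> W" "i \<le> W" using V ei i by auto
    have safe: "bsafe W mergeable \<tau>" using fits i e_def by (simp add: mergeable_def)
    have cost: "bcost mergeable \<le> 60" by (simp add: mergeable_def)
    show ?case
    proof (cases "bval mergeable \<tau>")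
      case True
      then have "e i < V" by (simp add: mergeable_def e_def[symmetric] i Vt)
      then obtain j qs where ps: "ps = j # qs" using b by (cases ps) (auto simp: blocks_at_def)
      have j: "j = Suc (e i)" "j \<le> e j" "e j \<le> V" "sm j = (\<Sum>k=j..e j. s k)"
        using b by (auto simp: blocks_at_def ps)
      have "block_mean s e i \<le> block_mean s e j"
        using True block_mean_eq[of i e s] block_mean_eq[of j e s] ei j
        by (simp add: mergeable_def e_def[symmetric] sm_def[symmetric] i Vt)
      then have b': "blocks_at V s (e(i := e j)) (sm(i := sm i + sm j)) i (i # qs)" using blocks_merge b by (simp add: ps)
      define \<upsilon> where "\<upsilon> = upd ''en'' i (e j) (rupd ''sm'' i (sm i + sm j) \<tau>)"
      have dec': "decreasing s (e(i := e j)) qs"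
      proof (rule decreasing_cong)
        show "decreasing s e qs" using dec by (simp add: ps)
        fix p assume "p \<in> set qs"
        then have "Suc (e j) \<le> p" using chain_ge[of V e "Suc (e j)" qs p] b by (simp add: blocks_at_def ps)
        then show "(e(i := e j)) p = e p" using ei j by simp
      qed
      have J': "J \<upsilon> i qs"
        using Jd b' dec' go by (simp add: J_def \<upsilon>_def e_def[symmetric] sm_def[symmetric])
      have dec\<mu>: "\<mu> \<upsilon> < \<mu> \<tau>" using \<mu>[OF J] \<mu>[OF J'] by (simp add: ps \<upsilon>_def go)
      have \<upsilon>: "upd ''en'' i (e j) (rupd ''sm'' i (sm i + sm j) \<tau>) = \<upsilon>" by (simp add: \<upsilon>_def)
      show ?thesis using True safe fits cost J' dec\<mu>
        by (auto simp: e_def[symmetric] sm_def[symmetric] i \<upsilon> simp flip: j(1))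
    next
      case False
      have sorted: "decreasing s e (i # ps)"
      proof (cases ps)
        case (Cons j qs)
        have j: "j = Suc (e i)" "j \<le> e j" "e j \<le> V" "sm j = (\<Sum>k=j..e j. s k)"
          using b by (auto simp: blocks_at_def Cons)
        then have "block_mean s e j < block_mean s e i"
          using False block_mean_eq[of i e s] block_mean_eq[of j e s] ei
          by (simp add: mergeable_def e_def[symmetric] sm_def[symmetric] i Vt)
        then show ?thesis using dec by (auto simp: Cons)
      qed simp
      show ?thesis
      proof (cases "2 < i")
        case True
        define k where "k = i - 1"
        define \<upsilon> where "\<upsilon> = rupd ''sm'' k (s k) (upd ''en'' k k (upd ''i'' 0 k \<tau>))"
        have k: "i = Suc k" "2 \<le> k" "k \<le> V" using True i by (auto simp: k_def)
        have b': "blocks_at V s (e(k := k)) (sm(k := s k)) k (k # i # ps)"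
          using blocks_new[of V s e sm k "i # ps"] b k by simp
        have dec': "decreasing s (e(k := k)) (i # ps)"
        proof (rule decreasing_cong[OF sorted])
          fix p assume "p \<in> set (i # ps)"
          then have "i \<le> p" using chain_ge[of V e i "i # ps" p] b by (simp add: blocks_at_def)
          then show "(e(k := k)) p = e p" using k by simp
        qed
        have J': "J \<upsilon> k (i # ps)"
          using Jd b' dec' go k by (simp add: J_def \<upsilon>_def e_def[symmetric] sm_def[symmetric])
        have dec\<mu>: "\<mu> \<upsilon> < \<mu> \<tau>" using \<mu>[OF J] \<mu>[OF J'] k by (simp add: \<upsilon>_def go)
        have \<upsilon>: "rupd ''sm'' k (s k) (upd ''en'' k k (upd ''i'' 0 k \<tau>)) = \<upsilon>" by (simp add: \<upsilon>_def)
        show ?thesis using True False safe fits cost J' dec\<mu>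
          by (auto simp: new_block_def i(1) k(1) s \<upsilon>)
      next
        case le: False
        define \<upsilon> where "\<upsilon> = upd ''go'' 0 0 \<tau>"
        have J': "J \<upsilon> i ps"
          using Jd sorted le by (auto simp: J_def \<upsilon>_def e_def[symmetric] sm_def[symmetric])
        have dec\<mu>: "\<mu> \<upsilon> < \<mu> \<tau>" using \<mu>[OF J] \<mu>[OF J'] by (simp add: \<upsilon>_def go)
        show ?thesis using le False safe fits cost J' dec\<mu>
          by (auto simp: i simp flip: \<upsilon>_def)
      qed
    qed
  next
    case (4 t \<sigma>')
    then show ?case by (auto simp: J_def)
  qed
  show ?thesis using V
    apply (simp add: find_blocks_def new_block_def flip: s_def)
    apply (fold One_nat_def)
    apply (fold \<upsilon>_def)
    apply (rule wp_mono[OF loop])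
    apply (elim conjE exE)
    subgoal for t \<sigma>' ps
      apply (rule Q[of _ _ "2 # ps"])
      using \<mu>[OF start] apply (simp_all add: J_def blocks_at_def s_def)
      apply (simp add: \<upsilon>_def)
      done
    done
qed

definition label_loop :: com where
  "label_loop = While (WLess (Var ''d'') (Plus (Var ''V'') (Num 1)))
     (Block [Store ''kk'' (Var ''d'') (Minus (Var ''a'') (Num 1)),
       Cond (WLess (Var ''d'') (Load ''en'' (Var ''a''))) Skip (Set ''a'' (Plus (Var ''d'') (Num 1))),
       Set ''d'' (Plus (Var ''d'') (Num 1))])"

definition label_blocks :: com where
  "label_blocks = Block [Set ''a'' (Num 2), Set ''d'' (Num 2), label_loop]"

lemma wp_label_blocks:
  assumes V: "val \<sigma> ''V'' = V" "2 \<le> V" "V + 2 \<le> W" and ch: "chain V (words \<sigma> ''en'') 2 ps"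
    and Q: "\<And>t \<sigma>'. t \<le> 100 * V + 100 \<Longrightarrow>
      (\<And>i. i \<in> {2..V} \<Longrightarrow> Suc (words \<sigma>' ''kk'' i) \<in> set ps \<and> words \<sigma>' ''kk'' i < i \<and>
         i \<le> words \<sigma> ''en'' (Suc (words \<sigma>' ''kk'' i))) \<Longrightarrow>
      words \<sigma>' ''kk'' 1 = words \<sigma> ''kk'' 1 \<Longrightarrow> frame {''a'', ''d'', ''kk''} \<sigma> \<sigma>' \<Longrightarrow> Q t \<sigma>'"
  shows "wp W label_blocks \<sigma> Q"
proof -
  define e where "e = words \<sigma> ''en''"
  define J where "J \<tau> \<longleftrightarrow> 2 \<le> val \<tau> ''d'' \<and> val \<tau> ''d'' \<le> Suc V \<and>
    (\<exists>qs. chain V e (val \<tau> ''a'') qs \<and> set qs \<subseteq> set ps) \<and> 2 \<le> val \<tau> ''a'' \<and> val \<tau> ''a'' \<le> val \<tau> ''d'' \<and>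
    (val \<tau> ''d'' \<le> V \<longrightarrow> val \<tau> ''d'' \<le> e (val \<tau> ''a'')) \<and>
    (\<forall>i. 2 \<le> i \<and> i < val \<tau> ''d'' \<longrightarrow> Suc (words \<tau> ''kk'' i) \<in> set ps \<and> words \<tau> ''kk'' i < i \<and>
       i \<le> e (Suc (words \<tau> ''kk'' i))) \<and> words \<tau> ''kk'' 1 = words \<sigma> ''kk'' 1 \<and> frame {''a'', ''d'', ''kk''} \<sigma> \<tau>" for \<tau>
  define \<upsilon> where "\<upsilon> = upd ''d'' 0 2 (upd ''a'' 0 2 \<sigma>)"
  have loop: "wp W label_loop \<upsilon> (\<lambda>t \<sigma>'. t \<le> 50 * V + 50 \<and> J \<sigma>' \<and> val \<sigma>' ''d'' = Suc V)"
    unfolding label_loop_def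
  proof (rule wp_while_post[where I = J and \<mu> = "\<lambda>\<tau>. Suc V - val \<tau> ''d''" and c = 40], goal_cases)
    case 1
    have "2 \<le> e 2" using ch V by (cases ps) (auto simp: e_def)
    then show ?case using V ch by (auto simp: J_def \<upsilon>_def e_def)
  next
    case (2 \<tau>)
    then show ?case using V by (simp add: J_def frame_def)
  next
    case (3 \<tau>)
    define a d where "a = val \<tau> ''a''" and "d = val \<tau> ''d''"
    have fr: "frame {''a'', ''d'', ''kk''} \<sigma> \<tau>" using 3 by (simp add: J_def)
    then have eq: "val \<tau> ''V'' = V" "words \<tau> ''en'' = e" using V by (simp_all add: frame_def e_def)
    have dV: "d \<le> V" using 3(2) by (simp add: eq d_def)
    obtain qs where qs: "chain V e a qs" "set qs \<subseteq> set ps" using 3(1) by (auto simp: J_def a_def)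
    have ad: "2 \<le> a" "a \<le> d" "d \<le> e a" using 3(1) dV by (simp_all add: J_def a_def d_def)
    then obtain rs where rs: "qs = a # rs" using qs(1) dV by (cases qs) auto
    have a_ps: "a \<in> set ps" using qs rs by simp
    have next_block: "Suc d \<le> V \<longrightarrow> Suc d \<le> e (Suc d)" "chain V e (Suc d) rs" if "d = e a"
      using qs(1) that by (cases rs; auto simp: rs)+
    define \<upsilon> where "\<upsilon> = upd ''d'' 0 (Suc d) (if d < e a then upd ''kk'' d (a - 1) \<tau>
      else upd ''a'' 0 (Suc d) (upd ''kk'' d (a - 1) \<tau>))"
    have J: "J \<upsilon>"
    proof (cases "d < e a")
      case True
      show ?thesis using 3(1) True ad a_ps dV qs fr
        by (auto simp: J_def \<upsilon>_def a_def[symmetric] d_def[symmetric] less_Suc_eq)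
    next
      case False
      then have "d = e a" using ad by simp
      then show ?thesis using 3(1) False ad a_ps dV qs(2) rs fr next_block
        by (auto simp: J_def \<upsilon>_def a_def[symmetric] d_def[symmetric] less_Suc_eq)
    qed
    have \<mu>: "Suc V - val \<upsilon> ''d'' < Suc V - val \<tau> ''d''" using dV by (simp add: \<upsilon>_def d_def)
    show ?case
    proof (cases "d < e a")
      case True
      then have "upd ''d'' 0 (Suc d) (upd ''kk'' d (a - 1) \<tau>) = \<upsilon>" by (simp add: \<upsilon>_def)
      then show ?thesis using True J \<mu> dV V by (simp add: a_def[symmetric] d_def[symmetric] eq)
    next
      case False
      then have "upd ''d'' 0 (Suc d) (upd ''a'' 0 (Suc d) (upd ''kk'' d (a - 1) \<tau>)) = \<upsilon>" by (simp add: \<upsilon>_def)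
      then show ?thesis using False J \<mu> dV V by (simp add: a_def[symmetric] d_def[symmetric] eq)
    qed
  next
    case (4 t \<sigma>')
    have "val \<sigma>' ''V'' = V" using 4(2) V(1) by (simp add: J_def frame_def)
    then show ?case using 4 V by (auto simp: J_def \<upsilon>_def)
  qed
  show ?thesis using V
    apply (simp add: label_blocks_def)
    apply (fold \<upsilon>_def)
    apply (rule wp_mono[OF loop])
    apply (rule Q)
    apply (auto simp: J_def e_def)
    done
qed

definition power_loop :: com where
  "power_loop = While (WLess (Var ''P'') (Var ''V'')) (Set ''P'' (Plus (Var ''P'') (Var ''P'')))"

lemma wp_power_loop:
  assumes V: "val \<sigma> ''V'' = V" "1 \<le> V" "2 * V \<le> W" and P: "val \<sigma> ''P'' = 1"
    and Q: "\<And>t \<sigma>' p. t \<le> 20 * V + 20 \<Longrightarrow> val \<sigma>' ''P'' = 2 ^ p \<Longrightarrow> V \<le> 2 ^ p \<Longrightarrow> 2 ^ p < 2 * V \<Longrightarrow>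
      frame {''P''} \<sigma> \<sigma>' \<Longrightarrow> Q t \<sigma>'"
  shows "wp W power_loop \<sigma> Q"
  unfolding power_loop_def
proof (rule wp_while_post[where I = "\<lambda>\<tau>. frame {''P''} \<sigma> \<tau> \<and> (\<exists>p. val \<tau> ''P'' = 2 ^ p \<and> 2 ^ p < 2 * V)"
      and \<mu> = "\<lambda>\<tau>. V - val \<tau> ''P''" and c = 8], goal_cases)
  case 1
  then show ?case using V P by (auto intro!: exI[of _ 0])
next
  case (2 \<tau>)
  then show ?case by simp
next
  case (3 \<tau>)
  then obtain p where p: "val \<tau> ''P'' = 2 ^ p" "2 ^ p < 2 * V" and fr: "frame {''P''} \<sigma> \<tau>" by blast
  have VV: "val \<tau> ''V'' = V" using fr V by (simp add: frame_def)
  then have lt: "2 ^ p < V" using 3(2) p by simp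
  have "\<exists>q. 2 ^ p + 2 ^ p = (2 :: nat) ^ q \<and> 2 ^ q < 2 * V" by (rule exI[of _ "Suc p"]) (use lt in simp)
  moreover have "V - (2 ^ p + 2 ^ p) < V - 2 ^ p"
  proof -
    have "(0 :: nat) < 2 ^ p" by simp
    then show ?thesis using lt by linarith
  qed
  ultimately show ?case using lt V p(2) fr by (simp add: p(1))
next
  case (4 t \<sigma>')
  then obtain p where p: "val \<sigma>' ''P'' = 2 ^ p" "2 ^ p < 2 * V" and fr: "frame {''P''} \<sigma> \<sigma>'" by blast
  have VV: "val \<sigma>' ''V'' = V" using fr V by (simp add: frame_def)
  show ?case by (rule Q[of _ _ p]) (use 4 p fr VV P in auto)
qed

section \<open>Time stamps\<close>

definition touch_find :: com where
  "touch_find = Block [Set ''key'' (Load ''last'' (Var ''it'')), Set ''cur'' (Var ''lr''), find_rank]"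

definition touch_delete :: com where
  "touch_delete = Seq (Set ''cur'' (Var ''lr''))
     (Cond (WLess (Num 0) (Var ''key'')) (Seq (Set ''idx'' (Var ''acc'')) delete_at) Skip)"

definition touch_insert :: com where
  "touch_insert = Block [Set ''idx'' (Num 0), Set ''val'' (Var ''t''), insert_at,
     Set ''lr'' (Var ''cur''), Store ''last'' (Var ''it'') (Var ''t'')]"

definition touch :: com where
  "touch = Seq touch_find (Seq touch_delete touch_insert)"

definition touch_vars :: "vname set" where
  "touch_vars = {''key'', ''acc'', ''val'', ''lr'', ''last''} \<union> edit_vars"

lemma edit_vars_notin:
  "a \<in> {''key'', ''acc'', ''val'', ''lr'', ''last'', ''it'', ''t'', ''K'', ''n'', ''h'', ''c'', ''ac'', ''d'', ''sl'',
     ''root'', ''hd'', ''snap'', ''hist'', ''cnt'', ''V'', ''N'', ''P'', ''en'', ''kk'', ''trace'', ''v''} \<Longrightarrow> a \<notin> edit_vars"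
  by (auto simp: edit_vars_def descend_vars_def ascend_vars_def balance_vars_def)

lemma frame_edit:
  assumes "frame edit_vars \<sigma> \<sigma>'"
  shows "words \<sigma>' ''key'' = words \<sigma> ''key''" "words \<sigma>' ''acc'' = words \<sigma> ''acc''" "words \<sigma>' ''val'' = words \<sigma> ''val''"
    "words \<sigma>' ''lr'' = words \<sigma> ''lr''" "words \<sigma>' ''last'' = words \<sigma> ''last''" "words \<sigma>' ''it'' = words \<sigma> ''it''"
    "words \<sigma>' ''t'' = words \<sigma> ''t''" "words \<sigma>' ''K'' = words \<sigma> ''K''" "words \<sigma>' ''n'' = words \<sigma> ''n''"
    "words \<sigma>' ''h'' = words \<sigma> ''h''" "words \<sigma>' ''c'' = words \<sigma> ''c''" "words \<sigma>' ''ac'' = words \<sigma> ''ac''"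
    "words \<sigma>' ''d'' = words \<sigma> ''d''" "words \<sigma>' ''sl'' = words \<sigma> ''sl''" "words \<sigma>' ''root'' = words \<sigma> ''root''"
    "words \<sigma>' ''hd'' = words \<sigma> ''hd''" "words \<sigma>' ''snap'' = words \<sigma> ''snap''" "words \<sigma>' ''hist'' = words \<sigma> ''hist''"
  using assms by (auto intro!: frame_words[OF assms] edit_vars_notin)

lemma wp_touch_find:
  assumes T: "tree_at \<sigma> (val \<sigma> ''lr'') T" "sorted_wrt (>) (elems T)"
    and k: "k < siz T" "words \<sigma> ''last'' (val \<sigma> ''it'') = elems T ! k"
    and fits: "siz T \<le> W"
    and Q: "\<And>t \<sigma>'. t \<le> 60 * hgt T + 40 \<Longrightarrow> val \<sigma>' ''acc'' = k \<Longrightarrow> val \<sigma>' ''key'' = elems T ! k \<Longrightarrow>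
      frame {''acc'', ''cur'', ''key''} \<sigma> \<sigma>' \<Longrightarrow> Q t \<sigma>'"
  shows "wp W touch_find \<sigma> Q"
proof -
  define \<rho> where "\<rho> = upd ''cur'' 0 (val \<sigma> ''lr'') (upd ''key'' 0 (elems T ! k) \<sigma>)"
  have "wp W find_rank \<rho> (\<lambda>t \<sigma>'. t \<le> 60 * hgt T + 20 \<and> val \<sigma>' ''acc'' = k \<and> val \<sigma>' ''key'' = elems T ! k \<and>
      frame {''acc'', ''cur'', ''key''} \<sigma> \<sigma>')"
  proof (rule wp_find_rank[of _ T k], goal_cases)
    case (6 t \<tau>)
    have "frame {''cur'', ''key''} \<sigma> \<rho>" by (simp add: \<rho>_def)
    from frame_trans[OF this 6(3), of "{''acc'', ''cur'', ''key''}"]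
    have "frame {''acc'', ''cur'', ''key''} \<sigma> \<tau>" by simp
    moreover have "val \<tau> ''key'' = elems T ! k" using 6(3) by (simp add: frame_def \<rho>_def)
    ultimately show ?case using 6 by simp
  qed (use T k fits in \<open>simp_all add: \<rho>_def\<close>)
  note find = this
  show ?thesis
    apply (simp add: touch_find_def k)
    apply (fold \<rho>_def)
    apply (rule wp_mono[OF find])
    apply (rule Q)
    apply simp_all
    done
qed

lemma wp_touch_delete:
  assumes T: "tree_at \<sigma> (val \<sigma> ''lr'') T" "avl T" and k: "val \<sigma> ''acc'' < siz T"
    and two: "0 < val \<sigma> ''key'' \<Longrightarrow> 2 \<le> siz T" and fits: "siz T < W" "val \<sigma> ''nx'' + 3 * hgt T \<le> W"
    and Q: "\<And>t \<sigma>' T'. t \<le> 500 * hgt T + 120 \<Longrightarrow> tree_at \<sigma>' (val \<sigma>' ''cur'') T' \<Longrightarrow> avl T' \<Longrightarrow>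
      elems T' = (if 0 < val \<sigma> ''key'' then take (val \<sigma> ''acc'') (elems T) @ drop (Suc (val \<sigma> ''acc'')) (elems T) else elems T) \<Longrightarrow>
      val \<sigma>' ''nx'' \<le> val \<sigma> ''nx'' + 3 * hgt T \<Longrightarrow> extends \<sigma> \<sigma>' \<Longrightarrow> frame edit_vars \<sigma> \<sigma>' \<Longrightarrow> Q t \<sigma>'"
  shows "wp W touch_delete \<sigma> Q"
proof (cases "0 < val \<sigma> ''key''")
  case True
  define \<rho> where "\<rho> = upd ''idx'' 0 (val \<sigma> ''acc'') (upd ''cur'' 0 (val \<sigma> ''lr'') \<sigma>)"
  have \<rho>: "extends \<sigma> \<rho>" "frame edit_vars \<sigma> \<rho>" by (simp_all add: \<rho>_def edit_vars_def descend_vars_def)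
  have "wp W delete_at \<rho> (\<lambda>t \<sigma>'. Q (t + 13) \<sigma>')"
  proof (rule wp_delete_at[of _ T], goal_cases)
    case (7 t \<tau> T')
    show ?case
      by (rule Q[OF _ 7(2,3) _ _ extends_trans[OF \<rho>(1) 7(8)] frame_trans[OF \<rho>(2) 7(9)]])
        (use 7 True in \<open>simp_all add: \<rho>_def\<close>)
  qed (use T k two True fits in \<open>simp_all add: \<rho>_def\<close>)
  then show ?thesis using True by (simp add: touch_delete_def \<rho>_def eval_nat_numeral)
next
  case False
  show ?thesis using False T(1)
    by (simp add: touch_delete_def) (rule Q[OF _ _ T(2)]; simp add: edit_vars_def descend_vars_def)
qed

lemma wp_touch_insert:
  assumes T: "tree_at \<sigma> (val \<sigma> ''cur'') T" "avl T"
    and fits: "siz T < W" "val \<sigma> ''nx'' + 3 * hgt T + 2 \<le> W"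
    and Q: "\<And>t \<sigma>' T'. t \<le> 500 * hgt T + 240 \<Longrightarrow> tree_at \<sigma>' (val \<sigma>' ''lr'') T' \<Longrightarrow> avl T' \<Longrightarrow>
      elems T' = val \<sigma> ''t'' # elems T \<Longrightarrow>
      words \<sigma>' ''last'' = (words \<sigma> ''last'')(val \<sigma> ''it'' := val \<sigma> ''t'') \<Longrightarrow>
      val \<sigma>' ''acc'' = val \<sigma> ''acc'' \<Longrightarrow> val \<sigma>' ''key'' = val \<sigma> ''key'' \<Longrightarrow>
      val \<sigma>' ''nx'' \<le> val \<sigma> ''nx'' + 3 * hgt T + 2 \<Longrightarrow> extends \<sigma> \<sigma>' \<Longrightarrow> frame touch_vars \<sigma> \<sigma>' \<Longrightarrow> Q t \<sigma>'"
  shows "wp W touch_insert \<sigma> Q"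
proof -
  define \<rho> where "\<rho> = upd ''val'' 0 (val \<sigma> ''t'') (upd ''idx'' 0 0 \<sigma>)"
  have \<rho>: "extends \<sigma> \<rho>" "frame touch_vars \<sigma> \<rho>" by (simp_all add: \<rho>_def touch_vars_def edit_vars_def descend_vars_def)
  have "wp W insert_at \<rho> (\<lambda>t \<sigma>'. Q (t + 16) (upd ''last'' (val \<sigma>' ''it'') (val \<sigma>' ''t'') (upd ''lr'' 0 (val \<sigma>' ''cur'') \<sigma>')))"
  proof (rule wp_insert_at[of _ T], goal_cases)
    case (6 t \<tau> T')
    have fr: "frame touch_vars \<sigma> \<tau>" by (rule frame_trans[OF \<rho>(2) 6(7)]) (auto simp: touch_vars_def)
    have ext: "extends \<sigma> \<tau>" using extends_trans[OF \<rho>(1) 6(6)] .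
    show ?case
      by (rule Q[of _ _ T']) (use 6 fr ext frame_edit[OF 6(7)] in \<open>simp_all add: \<rho>_def touch_vars_def\<close>)
  qed (use T fits in \<open>simp_all add: \<rho>_def\<close>)
  note ins = this
  show ?thesis
    apply (simp add: touch_insert_def)
    apply (fold \<rho>_def)
    apply (rule wp_mono[OF ins])
    apply (simp add: eval_nat_numeral)
    done
qed

text \<open>An item that was never accessed has stamp 0, which is always present as the last
  element; its position is found by the same search, but the 0 must remain for the other such items.
  A positive stamp coexists with this 0, so deleting it never empties the tree.\<close>

lemma wp_touch:
  assumes T: "tree_at \<sigma> (val \<sigma> ''lr'') T" "avl T" "sorted_wrt (>) (elems T)"
    and k: "k < siz T" "words \<sigma> ''last'' (val \<sigma> ''it'') = elems T ! k"
    and two: "0 < elems T ! k \<Longrightarrow> 2 \<le> siz T"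
    and H: "\<And>T. avl T \<Longrightarrow> siz T \<le> M \<Longrightarrow> hgt T \<le> H"
    and fits: "siz T \<le> M" "M < W" "val \<sigma> ''nx'' + 6 * H + 2 \<le> W"
    and Q: "\<And>t \<sigma>' T'. t \<le> 1200 * H + 500 \<Longrightarrow> tree_at \<sigma>' (val \<sigma>' ''lr'') T' \<Longrightarrow> avl T' \<Longrightarrow>
      elems T' = val \<sigma> ''t'' # (if 0 < elems T ! k then take k (elems T) @ drop (Suc k) (elems T) else elems T) \<Longrightarrow>
      val \<sigma>' ''acc'' = k \<Longrightarrow> val \<sigma>' ''key'' = elems T ! k \<Longrightarrow>
      words \<sigma>' ''last'' = (words \<sigma> ''last'')(val \<sigma> ''it'' := val \<sigma> ''t'') \<Longrightarrow>
      val \<sigma>' ''nx'' \<le> val \<sigma> ''nx'' + 6 * H + 2 \<Longrightarrow> extends \<sigma> \<sigma>' \<Longrightarrow> frame touch_vars \<sigma> \<sigma>' \<Longrightarrow> Q t \<sigma>'"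
  shows "wp W touch \<sigma> Q"
proof -
  have hT: "hgt T \<le> H" using H T(2) fits(1) .
  show ?thesis unfolding touch_def wp.simps(4)
  proof (rule wp_touch_find[OF T(1,3) k], goal_cases)
    case (2 t1 \<tau>1)
    have ext1: "extends \<sigma> \<tau>1" by (rule frame_extends[OF 2(4)]) simp
    have T1: "tree_at \<tau>1 (val \<tau>1 ''lr'') T" using tree_at_extends[OF ext1 T(1)] 2(4) by (simp add: frame_def)
    have fr1: "frame touch_vars \<sigma> \<tau>1"
      by (rule frame_mono[OF 2(4)]) (simp add: touch_vars_def edit_vars_def descend_vars_def)
    have nx1: "val \<tau>1 ''nx'' = val \<sigma> ''nx''" "val \<tau>1 ''it'' = val \<sigma> ''it''" "val \<tau>1 ''t'' = val \<sigma> ''t''"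
        "words \<tau>1 ''last'' = words \<sigma> ''last''" using 2(4) by (simp_all add: frame_def)
    show ?case
    proof (rule wp_touch_delete[OF T1 T(2)], goal_cases)
      case (5 t2 \<tau>2 T')
      have fr2: "frame touch_vars \<sigma> \<tau>2" by (rule frame_trans[OF fr1 5(7)]) (auto simp: touch_vars_def)
      have sT': "siz T' \<le> M" using 5(4) fits(1) k(1) by (simp split: if_splits)
      have hT': "hgt T' \<le> H" using H 5(3) sT' .
      show ?case
      proof (rule wp_touch_insert[OF 5(2,3)], goal_cases)
        case (3 t3 \<tau>3 T'')
        have fr3: "frame touch_vars \<sigma> \<tau>3" by (rule frame_trans[OF fr2 3(10)]) auto
        show ?case
          by (rule Q[OF _ 3(2,3) _ _ _ _ _ extends_trans[OF ext1 extends_trans[OF 5(6) 3(9)]] fr3])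
            (use 2 3 5 hT hT' nx1 frame_edit[OF 5(7)] in simp_all)
      qed (use sT' hT' hT fits nx1 5(5) in simp_all)
    qed (use 2 k two fits nx1 hT in simp_all)
  qed (use fits in simp)
qed

section \<open>Moving slots within a segment\<close>

text \<open>\<open>ac\<close> minus the snapshot is the number of rotations still owed by the
  segment. Carrying them out moves its head backwards by that number modulo n; n is added first
  because subtraction of words truncates. The slot of the accessed item then lies
  \<open>acc - K\<close> places after the head, cyclically.\<close>

definition locate :: com where
  "locate = Block
     [Set ''d'' (Plus (Var ''acc'') (Num 1)),
      Set ''K'' (Load ''kk'' (Var ''d'')),
      Set ''n'' (Minus (Load ''en'' (Plus (Var ''K'') (Num 1))) (Var ''K'')),
      suffix_count,
      Set ''ac'' (Var ''q''),
      Set ''h'' (WOp WMod (Minus (Plus (Load ''hd'' (Var ''K'')) (Var ''n''))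
        (WOp WMod (Minus (Var ''ac'') (Load ''snap'' (Var ''K''))) (Var ''n''))) (Var ''n'')),
      Set ''c'' (WOp WMod (Plus (Var ''h'') (Minus (Var ''acc'') (Var ''K''))) (Var ''n''))]"

definition locate_vars :: "vname set" where
  "locate_vars = {''d'', ''K'', ''n'', ''v'', ''q'', ''ac'', ''h'', ''c''}"

lemma wp_locate:
  assumes cnt: "count_tree p (words \<sigma> ''cnt'') ks" and ks: "\<And>k. k \<in> set ks \<Longrightarrow> k < 2 ^ p"
    and P: "val \<sigma> ''P'' = 2 ^ p"
    and K: "K = words \<sigma> ''kk'' (Suc (val \<sigma> ''acc''))" "K < 2 ^ p" and n: "n = words \<sigma> ''en'' (Suc K) - K"
    and fits: "length ks \<le> W" "2 * 2 ^ p < W" "Suc (val \<sigma> ''acc'') \<le> W" "words \<sigma> ''hd'' K + n \<le> W" "n + val \<sigma> ''acc'' \<le> W"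
      "0 < n"
    and A: "A = length (filter (\<lambda>k. K < k) ks)"
    and h: "h = (words \<sigma> ''hd'' K + n - (A - words \<sigma> ''snap'' K) mod n) mod n"
    and Q: "\<And>t \<sigma>'. t \<le> 40 * p + 200 \<Longrightarrow> val \<sigma>' ''d'' = Suc (val \<sigma> ''acc'') \<Longrightarrow> val \<sigma>' ''K'' = K \<Longrightarrow>
      val \<sigma>' ''ac'' = A \<Longrightarrow> val \<sigma>' ''h'' = h \<Longrightarrow> val \<sigma>' ''c'' = (h + (val \<sigma> ''acc'' - K)) mod n \<Longrightarrow>
      frame locate_vars \<sigma> \<sigma>' \<Longrightarrow> Q t \<sigma>'"
  shows "wp W locate \<sigma> Q"
proof -
  define \<rho> where "\<rho> = upd ''n'' 0 n (upd ''K'' 0 K (upd ''d'' 0 (Suc (val \<sigma> ''acc'')) \<sigma>))"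
  have KW: "Suc K \<le> W" "1 \<le> W" using K(2) fits(2) by linarith+
  have hn: "h < n" using fits(6) by (simp add: h)
  have hacc: "h + (val \<sigma> ''acc'' - K) \<le> W" using hn fits(5) by linarith
  have "wp W suffix_count \<rho> (\<lambda>t \<sigma>'. t \<le> 40 * p + 100 \<and> val \<sigma>' ''q'' = A \<and> frame {''v'', ''q''} \<rho> \<sigma>')"
    by (rule wp_suffix_count[of p _ ks]) (use cnt ks P K fits A in \<open>simp_all add: \<rho>_def\<close>)
  note suf = this
  show ?thesis using KW fits
    apply (simp add: locate_def flip: K(1) n)
    apply (fold \<rho>_def)
    apply (rule wp_mono[OF suf])
    apply (elim conjE)
    subgoal for t \<tau>
    proof -
      assume t: "t \<le> 40 * p + 100" "val \<tau> ''q'' = A" and fr: "frame {''v'', ''q''} \<rho> \<tau>"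
      have eqs: "words \<tau> ''hd'' = words \<sigma> ''hd''" "words \<tau> ''snap'' = words \<sigma> ''snap''" "val \<tau> ''K'' = K" "val \<tau> ''n'' = n"
          "val \<tau> ''acc'' = val \<sigma> ''acc''" "val \<tau> ''d'' = Suc (val \<sigma> ''acc'')"
        using fr by (simp_all add: frame_def \<rho>_def)
      have fr': "frame locate_vars \<sigma> \<tau>"
        by (rule frame_trans[of "{''n'', ''K'', ''d''}" \<sigma> \<rho>, OF _ fr]) (simp_all add: \<rho>_def locate_vars_def)
      show ?thesis using fits hacc
        by (simp add: eqs t(2) flip: h) (rule Q, use t fr' in \<open>simp_all add: eqs locate_vars_def\<close>)
    qed
    done
qed

definition moved :: "nat \<Rightarrow> nat \<Rightarrow> 'a list \<Rightarrow> 'a list" where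
  "moved c h E = (let E1 = take c E @ drop (Suc c) E in take h E1 @ E ! c # drop h E1)"

text \<open>E is the list as stored, L the list as meant, starting at the head h. To bring entry j
  of L to the front, the element at c is deleted and inserted again just before the old head. If c
  lies before h, that is, if counting from the head has wrapped around, the deletion shifts the head
  one place down; hence the index \<open>h - 1\<close>.\<close>

lemma rotate_moved:
  assumes h: "h < length E" and j: "j < length E" and c: "c = (h + j) mod length E"
    and L: "L = rotate h E"
  shows "rotate (if c < h then h - 1 else h) (moved c (if c < h then h - 1 else h) E) = L ! j # take j L @ drop (Suc j) L"
    and "E ! c = L ! j"
proof -
  show nth: "E ! c = L ! j" using j nth_rotate[of j E h] by (simp add: L c add.commute)
  have LE: "L = drop h E @ take h E" using h by (simp add: L rotate_drop_take)
  have cl: "c < length E" using j c by (metis gr_implies_not_zero mod_less_divisor neq0_conv)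
  show "rotate (if c < h then h - 1 else h) (moved c (if c < h then h - 1 else h) E) = L ! j # take j L @ drop (Suc j) L"
  proof (cases "h + j < length E")
    case True
    then have ch: "c = h + j" by (simp add: c)
    have E1: "take h (take c E @ drop (Suc c) E) = take h E"
      using cl by (simp add: ch)
    have E2: "drop h (take c E @ drop (Suc c) E) = take j (drop h E) @ drop (Suc c) E"
      using cl by (simp add: ch drop_take)
    have m: "moved c h E = take h E @ E ! c # take j (drop h E) @ drop (Suc c) E"
      by (simp only: moved_def Let_def E1 E2 append_Cons)
    have lm: "length (moved c h E) = length E" using cl by (simp add: moved_def Let_def)
    have "rotate h (moved c h E) = drop h (moved c h E) @ take h (moved c h E)"
      using h lm by (simp add: rotate_drop_take)
    also have "\<dots> = E ! c # (take j (drop h E) @ drop (Suc c) E) @ take h E"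
      using h by (simp add: m)
    also have "\<dots> = L ! j # take j L @ drop (Suc j) L"
    proof -
      have "take j L = take j (drop h E)" "drop (Suc j) L = drop (Suc c) E @ take h E"
        using True by (simp_all add: LE ch add.commute)
      then show ?thesis by (simp add: nth)
    qed
    finally show ?thesis by (simp add: ch)
  next
    case False
    then have cj: "h + j = c + length E"
    proof -
      have "c = (h + j - length E) mod length E" using False unfolding c by (intro le_mod_geq) simp
      then show ?thesis using False h j by simp
    qed
    then have lt: "c < h" using j by linarith
    define g where "g = h - 1"
    have g: "h = Suc g" "c \<le> g" using lt by (auto simp: g_def)
    have E1: "take g (take c E @ drop (Suc c) E) = take c E @ take (g - c) (drop (Suc c) E)"
      using cl g by (simp add: min_def)
    have E2: "drop g (take c E @ drop (Suc c) E) = drop h E"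
      using cl g by (simp add: add.commute)
    have lm: "length (moved c g E) = length E" using cl by (simp add: moved_def Let_def)
    have "rotate g (moved c g E) = drop g (moved c g E) @ take g (moved c g E)"
      using h g lm by (simp add: rotate_drop_take)
    also have "\<dots> = E ! c # drop h E @ take c E @ take (g - c) (drop (Suc c) E)"
    proof -
      define X where "X = take c E @ take (g - c) (drop (Suc c) E)"
      have m: "moved c g E = X @ E ! c # drop h E"
        by (simp only: moved_def Let_def E1 E2 X_def)
      have "length X = g" using cl g h by (simp add: X_def)
      then have "drop g (moved c g E) @ take g (moved c g E) = (E ! c # drop h E) @ X" by (simp add: m)
      then show ?thesis by (simp add: X_def)
    qed
    also have "\<dots> = L ! j # take j L @ drop (Suc j) L"
    proof -
      have jj: "j - (length E - h) = c" "length E - h \<le> j" "Suc j - (length E - h) = Suc c" using cj h by linarith+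
      have "take j L = drop h E @ take c E" using jj lt by (simp add: LE min_def)
      moreover have "drop (Suc j) L = take (g - c) (drop (Suc c) E)" using jj g by (simp add: LE drop_take)
      ultimately show ?thesis by (simp add: nth)
    qed
    finally show ?thesis using lt by (simp add: g_def)
  qed
qed

definition move_slot :: com where
  "move_slot = Block
     [Set ''idx'' (Var ''c''), delete_at,
      Set ''sl'' (Var ''out''),
      Cond (WLess (Var ''c'') (Var ''h'')) (Set ''h'' (Minus (Var ''h'') (Num 1))) Skip,
      Set ''idx'' (Var ''h''), Set ''val'' (Var ''sl''), insert_at,
      Store ''root'' (Var ''K'') (Var ''cur''),
      Store ''hd'' (Var ''K'') (Var ''h''),
      Store ''snap'' (Var ''K'') (Var ''ac'')]"

definition slot_vars :: "vname set" where
  "slot_vars = {''sl'', ''h'', ''val'', ''root'', ''hd'', ''snap''} \<union> edit_vars"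

lemma wp_move_slot:
  assumes T: "tree_at \<sigma> (val \<sigma> ''cur'') T" "avl T" "2 \<le> siz T"
    and c: "val \<sigma> ''c'' < siz T" "val \<sigma> ''h'' < siz T"
    and H: "\<And>T. avl T \<Longrightarrow> siz T \<le> M \<Longrightarrow> hgt T \<le> H"
    and fits: "siz T \<le> M" "M < W" "val \<sigma> ''nx'' + 6 * H + 2 \<le> W"
    and h': "h' = (if val \<sigma> ''c'' < val \<sigma> ''h'' then val \<sigma> ''h'' - 1 else val \<sigma> ''h'')"
    and Q: "\<And>t \<sigma>' T'. t \<le> 1000 * H + 500 \<Longrightarrow> tree_at \<sigma>' (words \<sigma>' ''root'' (val \<sigma> ''K'')) T' \<Longrightarrow> avl T' \<Longrightarrow>
      elems T' = moved (val \<sigma> ''c'') h' (elems T) \<Longrightarrow> val \<sigma>' ''sl'' = elems T ! val \<sigma> ''c'' \<Longrightarrow>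
      words \<sigma>' ''root'' = (words \<sigma> ''root'')(val \<sigma> ''K'' := words \<sigma>' ''root'' (val \<sigma> ''K'')) \<Longrightarrow>
      words \<sigma>' ''hd'' = (words \<sigma> ''hd'')(val \<sigma> ''K'' := h') \<Longrightarrow>
      words \<sigma>' ''snap'' = (words \<sigma> ''snap'')(val \<sigma> ''K'' := val \<sigma> ''ac'') \<Longrightarrow>
      val \<sigma>' ''nx'' \<le> val \<sigma> ''nx'' + 6 * H + 2 \<Longrightarrow> extends \<sigma> \<sigma>' \<Longrightarrow> frame slot_vars \<sigma> \<sigma>' \<Longrightarrow> Q t \<sigma>'"
  shows "wp W move_slot \<sigma> Q"
proof -
  have hT: "hgt T \<le> H" using H T(2) fits(1) .
  define \<rho> where "\<rho> = upd ''idx'' 0 (val \<sigma> ''c'') \<sigma>"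
  have \<rho>: "extends \<sigma> \<rho>" "frame slot_vars \<sigma> \<rho>" by (simp_all add: \<rho>_def slot_vars_def edit_vars_def descend_vars_def)
  have W1: "1 \<le> W" using fits by linarith
  show ?thesis unfolding move_slot_def Block.simps wp.simps(2,4) wsafe.simps wval.simps \<rho>_def[symmetric]
  proof (intro conjI, simp, simp, rule wp_delete_at[of _ T], goal_cases)
    case (7 t1 \<tau> T1)
    have eq: "words \<tau> ''c'' = words \<sigma> ''c''" "words \<tau> ''h'' = words \<sigma> ''h''" "words \<tau> ''K'' = words \<sigma> ''K''"
        "words \<tau> ''ac'' = words \<sigma> ''ac''" "words \<tau> ''root'' = words \<sigma> ''root''" "words \<tau> ''hd'' = words \<sigma> ''hd''"
        "words \<tau> ''snap'' = words \<sigma> ''snap''"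
      using frame_edit[OF 7(9)] by (simp_all add: \<rho>_def)
    define \<upsilon> where "\<upsilon> = upd ''val'' 0 (val \<tau> ''out'') (upd ''idx'' 0 h'
      (if val \<sigma> ''c'' < val \<sigma> ''h'' then upd ''h'' 0 h' (upd ''sl'' 0 (val \<tau> ''out'') \<tau>) else upd ''sl'' 0 (val \<tau> ''out'') \<tau>))"
    have E1: "elems T1 = take (val \<sigma> ''c'') (elems T) @ drop (Suc (val \<sigma> ''c'')) (elems T)" and out: "val \<tau> ''out'' = elems T ! val \<sigma> ''c''"
      using 7(4,5) by (simp_all add: \<rho>_def)
    have s1: "Suc (siz T1) = siz T" using E1 c(1) by simp
    have hT1: "hgt T1 \<le> H" using H[OF 7(3)] s1 fits(1) by simp
    have frT: "frame slot_vars \<sigma> \<tau>" by (rule frame_trans[OF \<rho>(2) 7(9)]) (auto simp: slot_vars_def)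
    then have fr: "frame slot_vars \<sigma> \<upsilon>" by (simp add: \<upsilon>_def slot_vars_def edit_vars_def descend_vars_def)
    have ext: "extends \<sigma> \<upsilon>" using extends_trans[OF \<rho>(1) 7(8)] by (simp add: \<upsilon>_def)
    have v: "val \<upsilon> ''sl'' = elems T ! val \<sigma> ''c''" "val \<upsilon> ''h'' = h'" "val \<upsilon> ''K'' = val \<sigma> ''K''" "val \<upsilon> ''ac'' = val \<sigma> ''ac''"
        "words \<upsilon> ''root'' = words \<sigma> ''root''" "words \<upsilon> ''hd'' = words \<sigma> ''hd''" "words \<upsilon> ''snap'' = words \<sigma> ''snap''"
        "val \<upsilon> ''idx'' = h'" "val \<upsilon> ''val'' = elems T ! val \<sigma> ''c''" "val \<upsilon> ''nx'' = val \<tau> ''nx''"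
        "tree_at \<upsilon> (val \<upsilon> ''cur'') T1"
      using out 7(2) by (simp_all add: \<upsilon>_def eq h')
    have "h' \<le> val \<sigma> ''h''" by (simp add: h')
    then have h'_le: "h' \<le> siz T1" using s1 c(2) by linarith
    have nx\<rho>: "val \<rho> ''nx'' = val \<sigma> ''nx''" by (simp add: \<rho>_def)
    have "wp W insert_at \<upsilon> (\<lambda>t \<sigma>'. \<forall>u. t1 + t \<le> u \<longrightarrow> u \<le> t1 + t + 100 \<longrightarrow> Q u (upd ''snap'' (val \<sigma>' ''K'') (val \<sigma>' ''ac'')
        (upd ''hd'' (val \<sigma>' ''K'') (val \<sigma>' ''h'') (upd ''root'' (val \<sigma>' ''K'') (val \<sigma>' ''cur'') \<sigma>'))))"
    proof (rule wp_insert_at[of _ T1], goal_cases)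
      case (6 t2 \<tau>2 T2)
      have fr2: "frame slot_vars \<sigma> \<tau>2" by (rule frame_trans[OF fr 6(7)]) (auto simp: slot_vars_def)
      have ext2: "extends \<sigma> \<tau>2" using extends_trans[OF ext 6(6)] .
      have eq2: "words \<tau>2 ''sl'' = words \<upsilon> ''sl''" "words \<tau>2 ''h'' = words \<upsilon> ''h''" "words \<tau>2 ''K'' = words \<upsilon> ''K''"
        "words \<tau>2 ''ac'' = words \<upsilon> ''ac''" "words \<tau>2 ''root'' = words \<upsilon> ''root''" "words \<tau>2 ''hd'' = words \<upsilon> ''hd''"
        "words \<tau>2 ''snap'' = words \<upsilon> ''snap''"
        using frame_edit[OF 6(7)] by simp_all
      have el: "elems T2 = moved (val \<sigma> ''c'') h' (elems T)"
        using 6(4) by (simp add: v E1 moved_def Let_def)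
      have nx: "val \<tau>2 ''nx'' \<le> val \<sigma> ''nx'' + 6 * H + 2"
        using 6(5) 7(7) hT hT1 by (simp add: v nx\<rho>)
      show ?case
      proof (intro allI impI)
        fix u :: nat assume "u \<le> t1 + t2 + 100"
        then show "Q u (upd ''snap'' (val \<tau>2 ''K'') (val \<tau>2 ''ac'')
            (upd ''hd'' (val \<tau>2 ''K'') (val \<tau>2 ''h'') (upd ''root'' (val \<tau>2 ''K'') (val \<tau>2 ''cur'') \<tau>2)))"
          using 6(1-3) 7(1) hT hT1 el nx ext2 fr2
          by (intro Q[of _ _ T2]) (simp_all add: eq2 v slot_vars_def)
      qed
    qed (use 7(3,7) s1 h'_le hT hT1 fits v in \<open>simp_all add: nx\<rho>\<close>)
    note ins = this
    show ?case
    proof (cases "val \<sigma> ''c'' < val \<sigma> ''h''")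
      case True
      have \<upsilon>: "\<upsilon> = upd ''val'' 0 (val \<tau> ''out'') (upd ''idx'' 0 (val \<sigma> ''h'' - 1) (upd ''h'' 0 (val \<sigma> ''h'' - 1) (upd ''sl'' 0 (val \<tau> ''out'') \<tau>)))"
        using True by (simp add: \<upsilon>_def h')
      show ?thesis using True W1
        apply (simp add: eq)
        apply (fold One_nat_def)
        apply (fold \<upsilon>)
        apply (rule wp_mono[OF ins])
        apply simp
        done
    next
      case False
      have \<upsilon>: "\<upsilon> = upd ''val'' 0 (val \<tau> ''out'') (upd ''idx'' 0 (val \<sigma> ''h'') (upd ''sl'' 0 (val \<tau> ''out'') \<tau>))"
        using False by (simp add: \<upsilon>_def h')
      show ?thesis using False W1
        apply (simp add: eq)
        apply (fold \<upsilon>)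
        apply (rule wp_mono[OF ins])
        apply simp
        done
    qed
  qed (use T c fits hT in \<open>simp_all add: \<rho>_def\<close>)
qed

definition new_slot :: com where
  "new_slot = Block
     [Set ''val'' (Var ''d''),
      Cond (WLess (Num 0) (Var ''cur'')) (Seq (Set ''idx'' (Num 0)) insert_at) (mk_leaf ''val'' ''cur''),
      Store ''root'' (Var ''K'') (Var ''cur'')]"

lemma wp_new_slot:
  assumes T: "0 < val \<sigma> ''cur'' \<Longrightarrow> tree_at \<sigma> (val \<sigma> ''cur'') T" "avl T" and nx: "0 < val \<sigma> ''nx''"
    and H: "\<And>T. avl T \<Longrightarrow> siz T \<le> M \<Longrightarrow> hgt T \<le> H"
    and fits: "siz T \<le> M" "M < W" "val \<sigma> ''nx'' + 3 * H + 2 \<le> W"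
    and Q: "\<And>t \<sigma>' T'. t \<le> 500 * H + 300 \<Longrightarrow> tree_at \<sigma>' (words \<sigma>' ''root'' (val \<sigma> ''K'')) T' \<Longrightarrow> avl T' \<Longrightarrow>
      elems T' = val \<sigma> ''d'' # (if 0 < val \<sigma> ''cur'' then elems T else []) \<Longrightarrow>
      words \<sigma>' ''root'' = (words \<sigma> ''root'')(val \<sigma> ''K'' := words \<sigma>' ''root'' (val \<sigma> ''K'')) \<Longrightarrow>
      words \<sigma>' ''hd'' = words \<sigma> ''hd'' \<Longrightarrow> words \<sigma>' ''snap'' = words \<sigma> ''snap'' \<Longrightarrow>
      val \<sigma>' ''nx'' \<le> val \<sigma> ''nx'' + 3 * H + 2 \<Longrightarrow> extends \<sigma> \<sigma>' \<Longrightarrow> frame slot_vars \<sigma> \<sigma>' \<Longrightarrow> Q t \<sigma>'"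
  shows "wp W new_slot \<sigma> Q"
proof -
  have hT: "hgt T \<le> H" using H T(2) fits(1) .
  have W1: "1 \<le> W" using fits by linarith
  show ?thesis
  proof (cases "0 < val \<sigma> ''cur''")
    case True
    define \<rho> where "\<rho> = upd ''idx'' 0 0 (upd ''val'' 0 (val \<sigma> ''d'') \<sigma>)"
    have \<rho>: "extends \<sigma> \<rho>" "frame slot_vars \<sigma> \<rho>" by (simp_all add: \<rho>_def slot_vars_def edit_vars_def descend_vars_def)
    have "wp W insert_at \<rho> (\<lambda>t \<sigma>'. \<forall>u. t \<le> u \<longrightarrow> u \<le> t + 100 \<longrightarrow> Q u (upd ''root'' (val \<sigma>' ''K'') (val \<sigma>' ''cur'') \<sigma>'))"
    proof (rule wp_insert_at[of _ T], goal_cases)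
      case (6 t \<tau> T')
      have fr: "frame slot_vars \<sigma> \<tau>" by (rule frame_trans[OF \<rho>(2) 6(7)]) (auto simp: slot_vars_def)
      have ext: "extends \<sigma> \<tau>" using extends_trans[OF \<rho>(1) 6(6)] .
      have eq: "val \<tau> ''K'' = val \<sigma> ''K''" "words \<tau> ''root'' = words \<sigma> ''root''" "words \<tau> ''hd'' = words \<sigma> ''hd''"
          "words \<tau> ''snap'' = words \<sigma> ''snap''" using frame_edit[OF 6(7)] by (simp_all add: \<rho>_def)
      show ?case using 6 True hT ext fr
        by (intro allI impI Q[of _ _ T']) (simp_all add: \<rho>_def eq slot_vars_def)
    qed (use T True hT fits in \<open>simp_all add: \<rho>_def\<close>)
    note ins = this
    show ?thesis using True W1
      apply (simp add: new_slot_def)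
      apply (fold \<rho>_def)
      apply (rule wp_mono[OF ins])
      apply simp
      done
  next
    case False
    define \<rho> where "\<rho> = upd ''val'' 0 (val \<sigma> ''d'') \<sigma>"
    have \<rho>: "extends \<sigma> \<rho>" "frame slot_vars \<sigma> \<rho>" by (simp_all add: \<rho>_def slot_vars_def edit_vars_def descend_vars_def)
    have "wp W (mk_leaf ''val'' ''cur'') \<rho> (\<lambda>t \<sigma>'. \<forall>u. t \<le> u \<longrightarrow> u \<le> t + 100 \<longrightarrow> Q u (upd ''root'' (val \<sigma>' ''K'') (val \<sigma>' ''cur'') \<sigma>'))"
    proof (rule wp_mk_leaf, goal_cases)
      case (5 t \<tau>)
      have fr: "frame slot_vars \<sigma> \<tau>"
        by (rule frame_trans[OF \<rho>(2) 5(5)])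
          (auto simp: slot_vars_def edit_vars_def ascend_vars_def balance_vars_def simp del: node_arrays_iff)
      have ext: "extends \<sigma> \<tau>" using extends_trans[OF \<rho>(1) 5(4)] .
      have eq: "val \<tau> ''K'' = val \<sigma> ''K''" "words \<tau> ''root'' = words \<sigma> ''root''" "words \<tau> ''hd'' = words \<sigma> ''hd''"
          "words \<tau> ''snap'' = words \<sigma> ''snap''" using 5(5) by (simp_all add: frame_def \<rho>_def)
      show ?case using 5 False hT ext fr
        by (intro allI impI Q[of _ _ "Lf (val \<sigma> ''d'')"]) (simp_all add: \<rho>_def eq slot_vars_def)
    qed (use nx fits in \<open>simp_all add: \<rho>_def\<close>)
    note leaf = this
    show ?thesis using False W1
      apply (simp add: new_slot_def)
      apply (fold \<rho>_def)
      apply (rule wp_mono[OF leaf])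
      apply simp
      done
  qed
qed

section \<open>Stamp lists and slot lists under one access\<close>

context segmentation
begin

text \<open>The final \<open>0\<close> stands for all items not accessed yet.\<close>

definition stamps :: "(nat \<Rightarrow> nat) \<Rightarrow> (nat \<Rightarrow> nat) \<Rightarrow> nat \<Rightarrow> nat list" where
  "stamps la \<Lambda> m = map (\<lambda>i. la (\<Lambda> i)) [1..<Suc m] @ [0]"

definition stamped :: "(nat \<Rightarrow> nat) \<Rightarrow> (nat \<Rightarrow> nat) \<Rightarrow> nat \<Rightarrow> nat \<Rightarrow> bool" where
  "stamped la \<Lambda> m j \<longleftrightarrow> sorted_wrt (>) (stamps la \<Lambda> m) \<and> (\<forall>x. la x \<le> j) \<and> (\<forall>i\<in>{m<..V}. la (\<Lambda> i) = 0)"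

lemma length_stamps [simp]: "length (stamps la \<Lambda> m) = Suc m"
  by (simp add: stamps_def)

lemma stamps_nth: "i < m \<Longrightarrow> stamps la \<Lambda> m ! i = la (\<Lambda> (Suc i))"
  by (simp add: stamps_def nth_append del: upt_Suc)

lemma stamps_nth_m: "stamps la \<Lambda> m ! m = 0"
  by (simp add: stamps_def nth_append del: upt_Suc)

context
  fixes la \<Lambda> m j x D d
  assumes \<Lambda>: "bij_betw \<Lambda> {1..V} {1..V}" and m: "m \<le> V" and x: "x \<in> {1..V}" and st: "stamped la \<Lambda> m j"
  defines "D \<equiv> depth V \<Lambda> x" and "d \<equiv> eff_depth \<Lambda> m x"
begin

lemma D_props: "1 \<le> D" "D \<le> V" "\<Lambda> D = x" "d = (if D \<le> m then D else Suc m)" "1 \<le> d" "d \<le> Suc m" "d \<le> V"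
  using stack_depth[OF \<Lambda> x] m by (auto simp: D_def d_def eff_depth_def)

lemma stamp_pos: "i \<in> {1..m} \<Longrightarrow> 0 < la (\<Lambda> i)"
  using st by (auto simp: stamped_def stamps_def sorted_wrt_append)

text \<open>The position of the stamp gives the effective depth in both cases: for an item never
  accessed the stamp 0 stands at position m, which is right for \<open>d = m + 1\<close>.\<close>

lemma stamp_rank: "stamps la \<Lambda> m ! (d - 1) = la x" "d - 1 < length (stamps la \<Lambda> m)" "0 < la x \<longleftrightarrow> D \<le> m"
proof -
  have z: "la x = 0" if "\<not> D \<le> m" using st D_props(2,3) that by (auto simp: stamped_def)
  show "0 < la x \<longleftrightarrow> D \<le> m" using z stamp_pos[of D] D_props(1,3) by (cases "D \<le> m") auto
  show "d - 1 < length (stamps la \<Lambda> m)" using D_props by simp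
  show "stamps la \<Lambda> m ! (d - 1) = la x"
  proof (cases "D \<le> m")
    case True
    then show ?thesis using D_props stamps_nth[of "D - 1" m la \<Lambda>] by simp
  next
    case False
    then show ?thesis using D_props z stamps_nth_m by simp
  qed
qed

lemma last_upd: "i \<in> {1..V} \<Longrightarrow> i \<noteq> D \<Longrightarrow> (la(x := Suc j)) (\<Lambda> i) = la (\<Lambda> i)"
  using \<Lambda> D_props by (auto simp: bij_betw_def dest: inj_onD[of \<Lambda> _ i D])

text \<open>A first access deletes nothing, as the final 0 keeps standing for the remaining items;
  any other access moves an entry to the front and renews it.\<close>

lemma stamps_access:
  "stamps (la(x := Suc j)) (lru_access V \<Lambda> x) (max m d) =
   Suc j # (if 0 < la x then take (d - 1) (stamps la \<Lambda> m) @ drop (Suc (d - 1)) (stamps la \<Lambda> m) else stamps la \<Lambda> m)"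
    (is "?l = ?r")
proof (rule nth_equalityI)
  have pos: "0 < la x \<longleftrightarrow> D \<le> m" by (rule stamp_rank(3))
  show "length ?l = length ?r" using D_props pos by auto
  fix i assume "i < length ?l"
  then have i: "i \<le> max m d" by simp
  have acc: "lru_access V \<Lambda> x (Suc i) = (if i = 0 then x else if Suc i \<le> D then \<Lambda> i else \<Lambda> (Suc i))"
    by (simp add: lru_access_def D_def)
  show "?l ! i = ?r ! i"
  proof (cases "D \<le> m")
    case True
    then have dD: "d = D" "max m d = m" using D_props by auto
    consider "i = 0" | "0 < i" "i < D" | "D \<le> i" "i < m" | "i = m" "D \<le> i" using i dD(2) by linarith
    then show ?thesis
    proof cases
      case 1
      then show ?thesis using True dD D_props stamps_nth[of 0 m] acc by simp
    next
      case 2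
      have "?l ! i = la (\<Lambda> i)" using 2 True m stamps_nth[of i m] acc last_upd[of i] dD by simp
      moreover have "i - Suc 0 < D - Suc 0" using 2 by linarith
      then have "?r ! i = stamps la \<Lambda> m ! (i - 1)" using 2 True pos dD by (simp add: nth_append nth_Cons')
      ultimately show ?thesis using 2 True stamps_nth[of "i - 1" m la \<Lambda>] by simp
    next
      case 3
      have "?l ! i = la (\<Lambda> (Suc i))" using 3 True m stamps_nth[of i m] acc last_upd[of "Suc i"] dD D_props by simp
      moreover have "\<not> i - Suc 0 < D - Suc 0" using 3 by linarith
      then have "?r ! i = stamps la \<Lambda> m ! i" using 3 True pos dD D_props by (simp add: nth_append nth_Cons')
      ultimately show ?thesis using 3 True stamps_nth[of i m la \<Lambda>] by simp
    next
      case 4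
      then show ?thesis using True pos dD D_props stamps_nth_m[of _ _ m] by (simp add: nth_append nth_Cons')
    qed
  next
    case False
    then have dD: "d = Suc m" "max m d = Suc m" using D_props by auto
    consider "i = 0" | "0 < i" "i \<le> m" | "i = Suc m" using i dD(2) by linarith
    then show ?thesis
    proof cases
      case 1
      then show ?thesis using False dD pos stamps_nth[of 0 "Suc m"] acc by simp
    next
      case 2
      have "?l ! i = la (\<Lambda> i)" using 2 False m stamps_nth[of i "Suc m"] acc last_upd[of i] dD by simp
      moreover have "?r ! i = stamps la \<Lambda> m ! (i - 1)" using 2 False pos by (simp add: nth_Cons')
      ultimately show ?thesis using 2 stamps_nth[of "i - 1" m la \<Lambda>] by simp
    next
      case 3
      then show ?thesis using False pos dD stamps_nth_m by simp
    qed
  qed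
qed

lemma stamped_access: "stamped (la(x := Suc j)) (lru_access V \<Lambda> x) (max m d) (Suc j)"
proof -
  let ?S = "stamps la \<Lambda> m"
  have le: "\<forall>y\<in>set ?S. y < Suc j" using st by (auto simp: stamped_def stamps_def less_Suc_eq_le)
  have sorted: "sorted_wrt (>) ?S" using st by (simp add: stamped_def)
  then have "sorted_wrt (>) (take (d - 1) ?S @ drop (d - 1) ?S)" by simp
  then have "sorted_wrt (>) (take (d - 1) ?S @ drop (Suc (d - 1)) ?S)"
    unfolding sorted_wrt_append using sorted sorted_wrt_drop set_drop_subset_set_drop[of "d - 1" "Suc (d - 1)" ?S] by (simp; blast)
  moreover have "\<forall>y\<in>set (take (d - 1) ?S @ drop (Suc (d - 1)) ?S). y < Suc j"
    using le by (auto dest: in_set_takeD in_set_dropD)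
  ultimately have "sorted_wrt (>) (stamps (la(x := Suc j)) (lru_access V \<Lambda> x) (max m d))"
    unfolding stamps_access using le sorted by simp
  moreover have "(la(x := Suc j)) y \<le> Suc j" for y using st by (auto simp: stamped_def le_SucI)
  moreover have "(la(x := Suc j)) (lru_access V \<Lambda> x i) = 0" if i: "i \<in> {max m d<..V}" for i
  proof -
    have acc: "lru_access V \<Lambda> x i = (if i \<le> D then \<Lambda> (i - 1) else \<Lambda> i)"
      using i D_props by (auto simp: lru_access_def D_def)
    define r where "r = (if i \<le> D then i - 1 else i)"
    have r: "r \<in> {m<..V}" "r \<noteq> D" using i D_props by (auto simp: r_def split: if_splits)
    then have "(la(x := Suc j)) (\<Lambda> r) = la (\<Lambda> r)" using last_upd[of r] by auto
    moreover have "la (\<Lambda> r) = 0" using st r by (simp add: stamped_def)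
    ultimately show ?thesis by (simp add: acc r_def split: if_splits)
  qed
  ultimately show ?thesis by (simp add: stamped_def)
qed

end

abbreviation segment_slots :: "(nat \<Rightarrow> nat) \<Rightarrow> nat \<Rightarrow> nat \<Rightarrow> nat list" where
  "segment_slots \<tau> K r \<equiv> map \<tau> [Suc K..<Suc r]"

text \<open>An access beyond the segment moves its last slot to the front, which a rotation to the
  left undoes. So the stored list remains correct if one more rotation is recorded as owed.\<close>

lemma rotate1_segment:
  assumes i: "1 \<le> i" "i \<le> V" and d: "ll i < d"
  shows "rotate1 (segment_slots (\<tau> \<circ> source d) (kk i) (ll i)) = segment_slots \<tau> (kk i) (ll i)"
proof -
  define K L where "K = kk i" and "L = ll i"
  have KL: "K < L" using seg[OF i] by (simp add: K_def L_def)
  have first: "source d (Suc K) = L" using d kk_Suc_kk[OF i] KL by (simp add: source_def K_def L_def)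
  have rest: "source d r = r - 1" if "Suc K < r" "r \<le> L" for r
  proof -
    have "kk r = K" using seg_same[OF i, of r] that by (simp add: K_def L_def)
    then show ?thesis using that d by (simp add: source_def L_def)
  qed
  have "[Suc K..<Suc L] = Suc K # [Suc (Suc K)..<Suc L]" using KL by (simp add: upt_rec)
  then have "rotate1 (segment_slots (\<tau> \<circ> source d) K L) = map (\<tau> \<circ> source d) [Suc (Suc K)..<Suc L] @ [\<tau> L]"
    using first by simp
  also have "map (\<tau> \<circ> source d) [Suc (Suc K)..<Suc L] = map \<tau> [Suc K..<L]"
    by (rule nth_equalityI) (use rest in \<open>simp_all del: upt_Suc\<close>)
  also have "map \<tau> [Suc K..<L] @ [\<tau> L] = segment_slots \<tau> K L" using KL by simp
  finally show ?thesis unfolding K_def L_def .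
qed

lemma segment_slots_below: "d \<le> K \<Longrightarrow> segment_slots (\<tau> \<circ> source d) K r = segment_slots \<tau> K r"
  by (simp add: source_def)

text \<open>The end r is free because the segment of d may be filled only in part: it is cut at m
  for an item seen before and at d for a first access.\<close>

lemma segment_slots_front:
  fixes \<tau> :: "nat \<Rightarrow> nat"
  assumes d: "1 \<le> d" "d \<le> V" "d \<le> r" "r \<le> ll d"
  defines "j \<equiv> d - 1 - kk d" and "S \<equiv> segment_slots \<tau> (kk d) r"
  shows "segment_slots (\<tau> \<circ> source d) (kk d) r = S ! j # take j S @ drop (Suc j) S" and "S ! j = \<tau> d" "j < length S"
proof -
  note upt_Suc [simp del]
  define K where "K = kk d"
  have K: "K < d" using seg[OF d(1,2)] by (simp add: K_def)
  have len: "length S = r - K" by (simp add: S_def K_def)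
  have nth: "S ! i = \<tau> (Suc K + i)" if "i < r - K" for i using that by (simp add: S_def K_def del: upt_Suc)
  show j: "j < length S" using K d(3) by (simp add: len j_def K_def)
  show Sj: "S ! j = \<tau> d" using nth[of j] j K by (simp add: len j_def K_def)
  have seg_kk: "kk s = K" if "K < s" "s \<le> r" for s
    using seg_same[OF d(1,2), of s] that d(4) by (simp add: K_def)
  show "segment_slots (\<tau> \<circ> source d) (kk d) r = S ! j # take j S @ drop (Suc j) S"
  proof (rule nth_equalityI)
    show "length (segment_slots (\<tau> \<circ> source d) (kk d) r) = length (S ! j # take j S @ drop (Suc j) S)"
      using j by (simp add: len K_def)
    fix i assume "i < length (segment_slots (\<tau> \<circ> source d) (kk d) r)"
    then have i: "i < r - K" by (simp add: K_def)
    have l: "segment_slots (\<tau> \<circ> source d) (kk d) r ! i = \<tau> (source d (Suc K + i))"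
      using i by (simp add: K_def del: upt_Suc)
    have kki: "kk (Suc K + i) = K" using seg_kk[of "Suc K + i"] i by simp
    have jK: "j = d - 1 - K" by (simp add: j_def K_def)
    consider "i = 0" | "0 < i" "i \<le> j" | "j < i" by linarith
    then show "segment_slots (\<tau> \<circ> source d) (kk d) r ! i = (S ! j # take j S @ drop (Suc j) S) ! i"
    proof cases
      case 1
      have "ll (Suc K) = ll d" using kk_Suc_kk[OF d(1,2)] by (simp add: K_def)
      then have "source d (Suc K) = d" using K kki 1 d by (simp add: source_def)
      then show ?thesis using 1 l Sj by simp
    next
      case 2
      then have "source d (Suc K + i) = K + i" using kki K by (simp add: source_def jK)
      moreover have "S ! (i - 1) = \<tau> (K + i)" using nth[of "i - 1"] 2 i by simp
      moreover have "i - Suc 0 < j" using 2 by linarith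
      ultimately show ?thesis using l 2 j by (simp add: nth_Cons' nth_append)
    next
      case 3
      then have "d < Suc K + i" using K jK by linarith
      then have "source d (Suc K + i) = Suc K + i" by (simp add: source_def)
      moreover have "S ! i = \<tau> (Suc K + i)" using nth[of i] i by simp
      moreover have "\<not> i - Suc 0 < j" using 3 by linarith
      ultimately show ?thesis using l 3 j i by (simp add: nth_Cons' nth_append len)
    qed
  qed
qed

definition deeper :: "nat list \<Rightarrow> nat \<Rightarrow> nat" where
  "deeper ks K = length (filter (\<lambda>k. K < k) ks)"

text \<open>The tree of a segment \<open>(K, L]\<close> lists its slots up to rotations: the accesses since the last update
  that went beyond the segment (\<open>deeper ks K\<close> minus the snapshot) have not been carried out yet, and
  the first rank is found at position \<open>hd K\<close> of the tree.\<close>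

definition segment_ok :: "mem \<Rightarrow> (nat \<Rightarrow> nat) \<Rightarrow> nat \<Rightarrow> nat list \<Rightarrow> nat \<Rightarrow> nat \<Rightarrow> bool" where
  "segment_ok \<sigma> \<tau> m ks K L \<longleftrightarrow>
     (if m \<le> K then words \<sigma> ''root'' K = 0 \<and> words \<sigma> ''hd'' K = 0 \<and> words \<sigma> ''snap'' K = 0 \<and> deeper ks K = 0
      else \<exists>T. tree_at \<sigma> (words \<sigma> ''root'' K) T \<and> avl T \<and> words \<sigma> ''hd'' K < L - K \<and>
        words \<sigma> ''snap'' K \<le> deeper ks K \<and>
        rotate (deeper ks K - words \<sigma> ''snap'' K) (segment_slots \<tau> K (min L m)) = rotate (words \<sigma> ''hd'' K) (elems T) \<and>
        (m < L \<longrightarrow> deeper ks K = 0 \<and> words \<sigma> ''hd'' K = 0))"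

text \<open>This is the reason why one access costs no work in the other segments. A segment before
  that of d is full; its slots turn by one, and \<open>deeper\<close> grows by one to match. A
  segment after that of d sees neither its slots nor its count change.\<close>

lemma segment_ok_other:
  assumes ok: "segment_ok \<sigma> \<tau> m ks (kk i) (ll i)" and i: "1 \<le> i" "i \<le> V"
    and d: "1 \<le> d" "d \<le> V" "d \<le> Suc m" and neq: "kk i \<noteq> kk d" and ext: "extends \<sigma> \<sigma>'"
    and eq: "words \<sigma>' ''root'' (kk i) = words \<sigma> ''root'' (kk i)" "words \<sigma>' ''hd'' (kk i) = words \<sigma> ''hd'' (kk i)"
      "words \<sigma>' ''snap'' (kk i) = words \<sigma> ''snap'' (kk i)"
  shows "segment_ok \<sigma>' (\<tau> \<circ> source d) (max m d) (kk d # ks) (kk i) (ll i)"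
proof (cases "kk i < kk d")
  case True
  have "ll i < d"
  proof (rule ccontr)
    assume "\<not> ll i < d"
    then have "kk d = kk i" using seg_same[OF i, of d] True seg[OF d(1,2)] by simp
    then show False using neq by simp
  qed
  then have Lm: "ll i \<le> m" "kk i < m" "kk i < ll i" "min (ll i) m = ll i" "min (ll i) (max m d) = ll i"
    using d(3) seg[OF i] by auto
  have nm: "\<not> m \<le> kk i" using Lm(2) by simp
  obtain T where T: "tree_at \<sigma> (words \<sigma> ''root'' (kk i)) T" "avl T" "words \<sigma> ''hd'' (kk i) < ll i - kk i"
      "words \<sigma> ''snap'' (kk i) \<le> deeper ks (kk i)"
      "rotate (deeper ks (kk i) - words \<sigma> ''snap'' (kk i)) (segment_slots \<tau> (kk i) (ll i)) = rotate (words \<sigma> ''hd'' (kk i)) (elems T)"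
    using ok unfolding segment_ok_def if_not_P[OF nm] Lm(4) by blast
  have dp: "deeper (kk d # ks) (kk i) = Suc (deeper ks (kk i))" using True by (simp add: deeper_def)
  define q where "q = deeper ks (kk i) - words \<sigma> ''snap'' (kk i)"
  have q: "Suc (deeper ks (kk i)) - words \<sigma> ''snap'' (kk i) = Suc q" using T(4) by (simp add: q_def)
  have "rotate (Suc q) (segment_slots (\<tau> \<circ> source d) (kk i) (ll i)) =
      rotate q (rotate1 (segment_slots (\<tau> \<circ> source d) (kk i) (ll i)))"
    by (simp only: rotate_def funpow_Suc_right comp_apply)
  also have "\<dots> = rotate (words \<sigma> ''hd'' (kk i)) (elems T)"
    using rotate1_segment[OF i \<open>ll i < d\<close>] T(5) by (simp only: q_def)
  finally have rot: "rotate (Suc q) (segment_slots (\<tau> \<circ> source d) (kk i) (ll i)) = rotate (words \<sigma> ''hd'' (kk i)) (elems T)" .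
  have nle: "\<not> max m d \<le> kk i" "\<not> max m d < ll i" "words \<sigma> ''snap'' (kk i) \<le> Suc (deeper ks (kk i))" using Lm T(4) by auto
  show ?thesis unfolding segment_ok_def dp eq q Lm(5) if_not_P[OF nle(1)]
    using tree_at_extends[OF ext T(1)] T(2,3) nle rot by blast
next
  case False
  then have kd: "kk d < kk i" using neq by simp
  have dK: "d \<le> kk i"
  proof (rule ccontr)
    assume "\<not> d \<le> kk i"
    then have "ll i < d" using kd seg_same[OF i, of d] by force
    then have "ll i \<le> kk d" using kk_ge[OF i _ d(2)] by simp
    then show False using kd seg[OF i] by linarith
  qed
  have dp: "deeper (kk d # ks) (kk i) = deeper ks (kk i)" using False by (simp add: deeper_def)
  have m: "max m d \<le> kk i \<longleftrightarrow> m \<le> kk i" "\<not> m \<le> kk i \<Longrightarrow> max m d = m" using dK d by auto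
  show ?thesis
  proof (cases "m \<le> kk i")
    case True
    then show ?thesis using ok m(1) unfolding segment_ok_def dp eq by simp
  next
    case nle: False
    then obtain T where T: "tree_at \<sigma> (words \<sigma> ''root'' (kk i)) T" "avl T \<and> words \<sigma> ''hd'' (kk i) < ll i - kk i \<and>
        words \<sigma> ''snap'' (kk i) \<le> deeper ks (kk i) \<and>
        rotate (deeper ks (kk i) - words \<sigma> ''snap'' (kk i)) (segment_slots \<tau> (kk i) (min (ll i) m)) = rotate (words \<sigma> ''hd'' (kk i)) (elems T) \<and>
        (m < ll i \<longrightarrow> deeper ks (kk i) = 0 \<and> words \<sigma> ''hd'' (kk i) = 0)"
      using ok unfolding segment_ok_def if_not_P[OF nle] by blast
    then show ?thesis using tree_at_extends[OF ext T(1)]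
      unfolding segment_ok_def dp eq segment_slots_below[OF dK] m(2)[OF nle] if_not_P[OF nle] by blast
  qed
qed

text \<open>Positions are computed modulo the full length n, although the tree of a segment filled
  only in part is shorter. This is sound because no access has gone beyond such a segment: nothing
  is owed, the head is 0, and \<open>j\<close> itself is a position in the tree.\<close>

lemma segment_head:
  fixes \<tau> :: "nat \<Rightarrow> nat"
  assumes d: "1 \<le> d" "d \<le> V" and m: "kk d < m" and n: "n = ll d - kk d"
    and g: "g < n" and sn: "sn \<le> A"
    and rot: "rotate (A - sn) (segment_slots \<tau> (kk d) (min (ll d) m)) = rotate g E"
    and part: "m < ll d \<longrightarrow> A = 0 \<and> g = 0"
    and h: "h = (g + n - (A - sn) mod n) mod n" and j: "j < min (ll d) m - kk d"
  shows "segment_slots \<tau> (kk d) (min (ll d) m) = rotate h E" "length E = min (ll d) m - kk d" "h < length E"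
    "(h + j) mod n = (h + j) mod length E" "m < ll d \<Longrightarrow> h = 0"
proof -
  note upt_Suc [simp del]
  define S where "S = segment_slots \<tau> (kk d) (min (ll d) m)"
  have kl: "kk d < ll d" using seg[OF d] by simp
  have "length (rotate (A - sn) S) = length (rotate g E)" using rot by (simp add: S_def)
  then show len: "length E = min (ll d) m - kk d" by (simp add: S_def)
  show h0: "h = 0" if "m < ll d" using that part n kl by (simp add: h)
  have "S = rotate h E \<and> h < length E \<and> (h + j) mod n = (h + j) mod length E"
  proof (cases "m < ll d")
    case True
    then have "h = 0" "A - sn = 0" "g = 0" using part h0 by auto
    then show ?thesis using rot len m kl j n by (simp add: S_def)
  next
    case False
    then have lens: "length S = n" "length E = n" "0 < n" using len kl by (simp_all add: n S_def min_def)
    define q where "q = A - sn"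
    have ql: "q mod n < n" using lens by simp
    \<comment> \<open>Rotating by \<open>n - q mod n\<close> completes the owed rotation by q to
      full turns.\<close>
    have "rotate (n - q mod n) (rotate q S) = rotate (n - q mod n) (rotate g E)" using rot by (simp add: S_def q_def)
    then have "rotate (n - q mod n + q) S = rotate (n - q mod n + g) E" by (simp add: rotate_rotate)
    moreover have "(n - q mod n + q) mod n = 0"
    proof -
      have "n - q mod n + q = n + n * (q div n)"
        using ql minus_mod_eq_mult_div[of q n] mod_less_eq_dividend[of q n] by linarith
      then show ?thesis by simp
    qed
    then have "rotate (n - q mod n + q) S = S" using rotate_conv_mod[of "n - q mod n + q" S] lens by simp
    moreover have "rotate (n - q mod n + g) E = rotate h E"
    proof -
      have "g + n - q mod n = n - q mod n + g" using ql by simp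
      then show ?thesis using rotate_conv_mod[of "n - q mod n + g" E] lens by (simp add: h q_def)
    qed
    ultimately show ?thesis using lens by (simp add: h)
  qed
  then show "segment_slots \<tau> (kk d) (min (ll d) m) = rotate h E" "h < length E" "(h + j) mod n = (h + j) mod length E"
    by (simp_all add: S_def)
qed

end

section \<open>Updating the slots in one access\<close>

definition update_slot :: com where
  "update_slot = Cond (WLess (Num 0) (Var ''key''))
     (Block [Set ''cur'' (Load ''root'' (Var ''K'')),
        Cond (WLess (Load ''sz'' (Var ''cur'')) (Num 2)) (Set ''sl'' (Load ''ky'' (Var ''cur''))) move_slot,
        Store ''hist'' (Var ''sl'') (Plus (Load ''hist'' (Var ''sl'')) (Num 1))])
     (Seq (Set ''cur'' (Load ''root'' (Var ''K''))) new_slot)"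

definition access :: com where
  "access = Block [Set ''it'' (Load ''trace'' (Var ''t'')), touch, locate, update_slot, add_point,
     Set ''t'' (Plus (Var ''t'') (Num 1))]"

definition update_vars :: "vname set" where
  "update_vars = insert ''hist'' slot_vars"

context segmentation
begin

text \<open>For an item seen before, its slot moves to the front of its segment. For a first access
  the new slot \<open>m + 1\<close> is put in front; the segment is not yet full then, so nothing is
  owed, its head is 0, and the front of the tree is the front of the segment.\<close>

lemma wp_update_slot:
  fixes \<tau> :: "nat \<Rightarrow> nat"
  assumes ok: "segment_ok \<sigma> \<tau> m ks (kk d) (ll d)" and \<tau>: "slot_map m \<tau>" and m: "m \<le> V"
    and d: "1 \<le> d" "d \<le> V" "d \<le> Suc m" and key: "0 < val \<sigma> ''key'' \<longleftrightarrow> d \<le> m"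
    and vals: "val \<sigma> ''d'' = d" "val \<sigma> ''K'' = kk d" "val \<sigma> ''ac'' = deeper ks (kk d)" "n = ll d - kk d"
      "val \<sigma> ''h'' = (words \<sigma> ''hd'' (kk d) + n - (deeper ks (kk d) - words \<sigma> ''snap'' (kk d)) mod n) mod n"
      "val \<sigma> ''c'' = (val \<sigma> ''h'' + (d - 1 - kk d)) mod n"
    and nx: "0 < val \<sigma> ''nx''"
    and H: "\<And>T. avl T \<Longrightarrow> siz T \<le> Suc V \<Longrightarrow> hgt T \<le> H"
    and fits: "Suc V < W" "val \<sigma> ''nx'' + 6 * H + 2 \<le> W" "words \<sigma> ''hist'' (\<tau> d) < W"
    and Q: "\<And>t \<sigma>'. t \<le> 1000 * H + 600 \<Longrightarrow> segment_ok \<sigma>' (\<tau> \<circ> source d) (max m d) (kk d # ks) (kk d) (ll d) \<Longrightarrow>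
      (\<And>K. K \<noteq> kk d \<Longrightarrow> words \<sigma>' ''root'' K = words \<sigma> ''root'' K \<and> words \<sigma>' ''hd'' K = words \<sigma> ''hd'' K \<and>
         words \<sigma>' ''snap'' K = words \<sigma> ''snap'' K) \<Longrightarrow>
      words \<sigma>' ''hist'' = (if d \<le> m then (words \<sigma> ''hist'')(\<tau> d := Suc (words \<sigma> ''hist'' (\<tau> d))) else words \<sigma> ''hist'') \<Longrightarrow>
      val \<sigma>' ''nx'' \<le> val \<sigma> ''nx'' + 6 * H + 2 \<Longrightarrow> extends \<sigma> \<sigma>' \<Longrightarrow> frame update_vars \<sigma> \<sigma>' \<Longrightarrow> Q t \<sigma>'"
  shows "wp W update_slot \<sigma> Q"
proof -
  note upt_Suc [simp del]
  define K L j where "K = kk d" and "L = ll d" and "j = d - 1 - K"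
  have KL: "K < d" "d \<le> L" "L \<le> V" using seg[OF d(1,2)] by (auto simp: K_def L_def)
  define A where "A = deeper ks K"
  \<comment> \<open>An access inside the segment does not go beyond it, so the snapshot taken before
    \<open>add_point\<close> remains exact.\<close>
  have A': "deeper (K # ks) K = A" by (simp add: deeper_def A_def)
  define \<rho> where "\<rho> = upd ''cur'' 0 (words \<sigma> ''root'' K) \<sigma>"
  have \<rho>: "extends \<sigma> \<rho>" "frame update_vars \<sigma> \<rho>"
    by (simp_all add: \<rho>_def update_vars_def slot_vars_def edit_vars_def descend_vars_def)
  have W2: "2 \<le> W" "1 \<le> W" using fits(1) d by linarith+
  show ?thesis
  proof (cases "d \<le> m")
    case True
    define S where "S = segment_slots \<tau> K (min L m)"
    have mK: "\<not> m \<le> K" "\<not> max m d \<le> K" "max m d = m" using True KL by auto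
    obtain T where T: "tree_at \<sigma> (words \<sigma> ''root'' K) T" "avl T" "words \<sigma> ''hd'' K < L - K"
        "words \<sigma> ''snap'' K \<le> A" "rotate (A - words \<sigma> ''snap'' K) S = rotate (words \<sigma> ''hd'' K) (elems T)"
        "m < L \<longrightarrow> A = 0 \<and> words \<sigma> ''hd'' K = 0"
      using ok[folded K_def L_def] unfolding segment_ok_def if_not_P[OF mK(1)] A_def S_def by blast
    define h where "h = val \<sigma> ''h''"
    have h: "h = (words \<sigma> ''hd'' K + n - (A - words \<sigma> ''snap'' K) mod n) mod n" using vals(5) by (simp add: h_def A_def K_def)
    have n: "n = L - K" using vals(4) by (simp add: K_def L_def)
    have jl: "j < min L m - K" using True KL by (auto simp: j_def)
    have Km: "K < m" using mK by simp
    note head = segment_head[OF d(1,2), folded K_def L_def, of m n _ _ _ \<tau>, folded S_def,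
        OF Km n T(3)[folded n] T(4,5,6) h jl]
    have ST: "S = rotate h (elems T)" "siz T = min L m - K" "h < siz T" "(h + j) mod n = (h + j) mod siz T" "m < L \<Longrightarrow> h = 0"
      by (fact head)+
    define c where "c = (h + j) mod siz T"
    have c: "val \<sigma> ''c'' = c" using vals(6) ST(4) by (simp add: c_def h_def j_def K_def)
    have jT: "j < siz T" using jl ST(2) by simp
    have cT: "c < siz T" using jT by (simp add: c_def)
    define h' where "h' = (if c < h then h - 1 else h)"
    have front: "segment_slots (\<tau> \<circ> source d) K (min L m) = S ! j # take j S @ drop (Suc j) S" "S ! j = \<tau> d"
      using segment_slots_front[OF d(1,2), of "min L m" \<tau>] True KL by (simp_all add: K_def L_def S_def j_def)
    have moved: "rotate h' (moved c h' (elems T)) = segment_slots (\<tau> \<circ> source d) K (min L m)" "elems T ! c = \<tau> d"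
      using rotate_moved[OF ST(3) jT c_def ST(1)] front by (simp_all add: h'_def)
    have sizT: "siz T \<le> Suc V" using ST(2) KL by simp
    have key0: "0 < val \<sigma> ''key''" using key True by simp
    have T\<rho>: "tree_at \<rho> (val \<rho> ''cur'') T" using T(1) by (simp add: \<rho>_def)
    have sz: "words \<sigma> ''sz'' (words \<sigma> ''root'' K) = siz T" "words \<sigma> ''ky'' (words \<sigma> ''root'' K) = last (elems T)"
      using tree_at_root[OF T(1)] by simp_all
    show ?thesis
    proof (cases "siz T < 2")
      \<comment> \<open>A tree cannot become empty, so a single slot is read in place. Head and
        snapshot may stay as they are because every rotation fixes a list of length one.\<close>
      case one: True
      then have "siz T = 1" using jT by linarith
      then obtain u where u: "elems T = [u]" by (auto simp: length_Suc_conv)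
      have "j = 0" "c = 0" using jT cT \<open>siz T = 1\<close> by simp_all
      then have ky: "last (elems T) = \<tau> d" using moved(2) by (simp add: u)
      have "rotate k [u] = [u]" for k by (induction k) (simp_all add: rotate_Suc)
      then have S1: "S = [u]" using ST(1) by (simp only: u)
      have same: "segment_slots (\<tau> \<circ> source d) K (min L m) = S" using front \<open>j = 0\<close> S1 by simp
      define \<upsilon> where "\<upsilon> = upd ''hist'' (\<tau> d) (Suc (words \<sigma> ''hist'' (\<tau> d))) (upd ''sl'' 0 (\<tau> d) \<rho>)"
      have ext: "extends \<sigma> \<upsilon>" using \<rho>(1) by (simp add: \<upsilon>_def)
      have seg_ok: "segment_ok \<upsilon> (\<tau> \<circ> source d) (max m d) (kk d # ks) (kk d) (ll d)"
        unfolding K_def[symmetric] L_def[symmetric] segment_ok_def mK(3) if_not_P[OF mK(1)] A' same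
        using T tree_at_extends[OF ext T(1)] by (intro exI[of _ T]) (simp add: \<upsilon>_def \<rho>_def)
      have fr: "frame update_vars \<sigma> \<upsilon>" using \<rho>(2) by (simp add: \<upsilon>_def update_vars_def slot_vars_def)
      have "Q t \<upsilon>" if "t \<le> 1000 * H + 600" for t
        by (rule Q[OF that seg_ok _ _ _ ext fr]) (use True in \<open>simp_all add: \<upsilon>_def \<rho>_def\<close>)
      moreover have "words \<rho> ''sz'' (val \<rho> ''cur'') = siz T" "words \<rho> ''ky'' (val \<rho> ''cur'') = \<tau> d"
          "words \<rho> ''hist'' = words \<sigma> ''hist''"
        using sz ky by (simp_all add: \<rho>_def)
      ultimately show ?thesis using key0 W2 fits(3) one
        by (simp add: update_slot_def vals(2) K_def[symmetric] \<rho>_def[symmetric] flip: \<upsilon>_def)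
    next
      case False
      have "wp W move_slot \<rho> (\<lambda>t \<sigma>'. Suc (words \<sigma>' ''hist'' (val \<sigma>' ''sl'')) \<le> W \<and> (\<forall>u. t \<le> u \<longrightarrow> u \<le> t + 60 \<longrightarrow>
          Q u (upd ''hist'' (val \<sigma>' ''sl'') (Suc (words \<sigma>' ''hist'' (val \<sigma>' ''sl''))) \<sigma>')))"
      proof (rule wp_move_slot[where h' = h' and H = H, OF T\<rho> T(2) _ _ _ _ sizT fits(1)], goal_cases)
        case (7 t \<omega> T')
        define \<upsilon> where "\<upsilon> = upd ''hist'' (\<tau> d) (Suc (words \<sigma> ''hist'' (\<tau> d))) \<omega>"
        have sl: "val \<omega> ''sl'' = \<tau> d" using 7(5) c moved(2) by (simp add: \<rho>_def)
        have hist: "words \<omega> ''hist'' = words \<sigma> ''hist''"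
          using frame_words[OF 7(11), of "''hist''"] edit_vars_notin[of "''hist''"] by (simp add: slot_vars_def \<rho>_def)
        have ext: "extends \<sigma> \<upsilon>" using extends_trans[OF \<rho>(1) 7(10)] by (simp add: \<upsilon>_def)
        have fr: "frame update_vars \<sigma> \<upsilon>"
          using frame_trans[OF \<rho>(2) 7(11), of update_vars] by (auto simp: \<upsilon>_def update_vars_def)
        have T': "tree_at \<upsilon> (words \<upsilon> ''root'' K) T'" using 7(2) by (simp add: \<upsilon>_def \<rho>_def vals(2) K_def[symmetric])
        have hd': "words \<upsilon> ''hd'' K = h'" "words \<upsilon> ''snap'' K = A" using 7(7,8)
          by (simp_all add: \<upsilon>_def \<rho>_def vals(2,3) K_def[symmetric] A_def)
        have "h' \<le> h" by (simp add: h'_def)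
        then have h'L: "h' < L - K" using ST(2,3) by linarith
        have el: "elems T' = moved c h' (elems T)" using 7(4) c by (simp add: \<rho>_def)
        have seg_ok: "segment_ok \<upsilon> (\<tau> \<circ> source d) (max m d) (kk d # ks) (kk d) (ll d)"
          unfolding K_def[symmetric] L_def[symmetric] segment_ok_def mK(3) if_not_P[OF mK(1)] A'
          using T' 7(3) h'L moved(1) T(6) ST(5)
          by (intro exI[of _ T']) (simp add: hd' el h'_def)
        have others: "words \<upsilon> ''root'' k = words \<sigma> ''root'' k \<and> words \<upsilon> ''hd'' k = words \<sigma> ''hd'' k \<and>
            words \<upsilon> ''snap'' k = words \<sigma> ''snap'' k" if "k \<noteq> kk d" for k
          using fun_cong[OF 7(6), of k] 7(7,8) that by (simp add: \<upsilon>_def \<rho>_def vals(2))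
        have "Q u \<upsilon>" if "u \<le> 1000 * H + 600" for u
          by (rule Q[OF that seg_ok others]) (use 7(9) ext fr True in \<open>simp_all add: \<upsilon>_def \<rho>_def hist\<close>)
        then show ?case using 7(1) fits(3) by (simp add: sl hist \<upsilon>_def)
      qed (use False c cT ST(3) fits(2) in \<open>simp_all add: \<rho>_def h_def[symmetric] h'_def H\<close>)
      note mv = this
      show ?thesis using key0 W2 False
        apply (simp add: update_slot_def vals(2) K_def[symmetric] sz)
        apply (fold \<rho>_def)
        apply (rule wp_mono[OF mv])
        apply simp
        done
    qed
  next
    case False
    then have dm: "d = Suc m" "max m d = d" using d by auto
    have td: "\<tau> d = d" using \<tau> d dm by (auto simp: slot_map_def)
    have mL: "m < L" "K \<le> m" "min L d = d" using KL dm by auto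
    have key0: "val \<sigma> ''key'' = 0" using key False by simp
    have d_seg: "segment_slots (\<tau> \<circ> source d) K d = d # segment_slots \<tau> K m"
    proof -
      have S: "segment_slots \<tau> K d = segment_slots \<tau> K m @ [d]" using mL dm td by (simp add: upt_Suc_append)
      have len: "length (segment_slots \<tau> K m) = d - 1 - K" using dm by simp
      show ?thesis using segment_slots_front[OF d(1,2), of d \<tau>] KL td len unfolding L_def[symmetric] K_def[symmetric] S
        by simp
    qed
    obtain T where T: "0 < words \<sigma> ''root'' K \<longrightarrow> tree_at \<sigma> (words \<sigma> ''root'' K) T" "avl T" "siz T \<le> Suc V"
        "(if 0 < words \<sigma> ''root'' K then elems T else []) = segment_slots \<tau> K m"
      and zero: "words \<sigma> ''hd'' K = 0" "words \<sigma> ''snap'' K = 0" "A = 0"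
    proof (cases "m \<le> K")
      case True
      then have "m = K" using mL by simp
      \<comment> \<open>The root 0 stands for an empty list of slots, which no tree represents;
        \<open>Lf 0\<close> is a placeholder.\<close>
      then show ?thesis using that[of "Lf 0"] ok[folded K_def L_def] d unfolding segment_ok_def if_P[OF True] A_def by simp
    next
      case False
      then obtain T where T: "tree_at \<sigma> (words \<sigma> ''root'' K) T" "avl T" "words \<sigma> ''snap'' K \<le> A"
          "rotate (A - words \<sigma> ''snap'' K) (segment_slots \<tau> K (min L m)) = rotate (words \<sigma> ''hd'' K) (elems T)"
          "A = 0 \<and> words \<sigma> ''hd'' K = 0"
        using ok[folded K_def L_def] mL(1) unfolding segment_ok_def if_not_P[OF False] A_def by blast
      then have el: "elems T = segment_slots \<tau> K m" using mL by simp
      then have "siz T \<le> Suc V" using m by simp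
      then show ?thesis using that[of T] T el tree_at_root[OF T(1)] by simp
    qed
    have "wp W new_slot \<rho> (\<lambda>t \<sigma>'. \<forall>u. t \<le> u \<longrightarrow> u \<le> t + 60 \<longrightarrow> Q u \<sigma>')"
    proof (rule wp_new_slot[where H = H, OF _ T(2) _ _ T(3) fits(1)], goal_cases)
      case (5 t \<omega> T')
      have ext: "extends \<sigma> \<omega>" using extends_trans[OF \<rho>(1) 5(9)] .
      have fr: "frame update_vars \<sigma> \<omega>"
        using frame_trans[OF \<rho>(2) 5(10), of update_vars] by (auto simp: update_vars_def)
      have hist: "words \<omega> ''hist'' = words \<sigma> ''hist''"
        using frame_words[OF 5(10), of "''hist''"] edit_vars_notin[of "''hist''"] by (simp add: slot_vars_def \<rho>_def)
      have T': "tree_at \<omega> (words \<omega> ''root'' K) T'" "elems T' = d # segment_slots \<tau> K m" using 5(2,4) T(4)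
        by (simp_all add: \<rho>_def vals(1,2) K_def[symmetric])
      have hd': "words \<omega> ''hd'' = words \<sigma> ''hd''" "words \<omega> ''snap'' = words \<sigma> ''snap''" using 5(6,7) by (simp_all add: \<rho>_def)
      have nK: "\<not> d \<le> K" using KL by simp
      have seg_ok: "segment_ok \<omega> (\<tau> \<circ> source d) (max m d) (kk d # ks) (kk d) (ll d)"
        unfolding K_def[symmetric] L_def[symmetric] segment_ok_def dm(2) if_not_P[OF nK] A' mL(3) d_seg
        using T' 5(3) zero KL by (intro exI[of _ T']) (simp add: hd')
      have others: "words \<omega> ''root'' k = words \<sigma> ''root'' k \<and> words \<omega> ''hd'' k = words \<sigma> ''hd'' k \<and>
          words \<omega> ''snap'' k = words \<sigma> ''snap'' k" if "k \<noteq> kk d" for k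
        using fun_cong[OF 5(5), of k] that hd' by (simp add: \<rho>_def vals(2))
      have "Q u \<omega>" if "u \<le> 1000 * H + 600" for u
        by (rule Q[OF that seg_ok others]) (use 5(8) ext fr False in \<open>simp_all add: \<rho>_def hist\<close>)
      then show ?case using 5(1) by simp
    qed (use T(1) fits(2) nx in \<open>simp_all add: \<rho>_def H\<close>)
    note new = this
    show ?thesis using key0 W2
      apply (simp add: update_slot_def vals(2) K_def[symmetric])
      apply (fold \<rho>_def)
      apply (rule wp_mono[OF new])
      apply simp
      done
  qed
qed

end

section \<open>The program\<close>

definition prepare :: com where
  "prepare = Block [find_blocks, label_blocks, Set ''P'' (Num 1), power_loop,
     Store ''sz'' (Num 1) (Num 1), Set ''lr'' (Num 1), Set ''nx'' (Num 2), Set ''t'' (Num 1)]"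

definition main_loop :: com where
  "main_loop = While (WLess (Var ''t'') (Plus (Var ''N'') (Num 1))) access"

definition output_loop :: com where
  "output_loop = While (WLess (Var ''C'') (Plus (Var ''V'') (Num 1)))
     (Block [Set ''acc'' (Minus (Var ''acc'') (Load ''hist'' (Var ''C''))),
       Store ''misses'' (Var ''C'') (Var ''acc''),
       Set ''C'' (Plus (Var ''C'') (Num 1))])"

definition lpr_program :: com where
  "lpr_program = Block [prepare, main_loop, Set ''acc'' (Var ''N''), Set ''C'' (Num 1), output_loop]"

definition access_vars :: "vname set" where
  "access_vars = {''t'', ''it'', ''v'', ''cnt''} \<union> touch_vars \<union> locate_vars \<union> update_vars"

lemma consts_notin:
  assumes "a \<in> {''V'', ''N'', ''P'', ''en'', ''kk'', ''trace''}"
  shows "a \<notin> access_vars"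
  using assms edit_vars_notin[of a] by (elim insertE emptyE) (simp_all add: access_vars_def touch_vars_def locate_vars_def update_vars_def slot_vars_def)

lemma touch_notin:
  assumes "a \<in> {''t'', ''V'', ''N'', ''P'', ''en'', ''kk'', ''trace'', ''cnt'', ''hist'', ''root'', ''hd'', ''snap''}"
  shows "a \<notin> touch_vars"
  using assms edit_vars_notin[of a] by (elim insertE emptyE) (simp_all add: touch_vars_def)

lemma update_notin:
  assumes "a \<in> {''t'', ''V'', ''N'', ''P'', ''K'', ''cnt'', ''last'', ''lr''}"
  shows "a \<notin> update_vars"
  using assms edit_vars_notin[of a] by (elim insertE emptyE) (simp_all add: update_vars_def slot_vars_def)

lemma (in segmentation) segment_ok_cong:
  assumes "segment_ok \<sigma> \<tau> m ks K L" "extends \<sigma> \<sigma>'" "words \<sigma>' ''root'' K = words \<sigma> ''root'' K"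
    "words \<sigma>' ''hd'' K = words \<sigma> ''hd'' K" "words \<sigma>' ''snap'' K = words \<sigma> ''snap'' K"
  shows "segment_ok \<sigma>' \<tau> m ks K L"
  using assms(1) tree_at_extends[OF assms(2)] unfolding segment_ok_def assms(3-5) by (cases "m \<le> K") (simp_all only: if_True if_False, blast)

text \<open>H bounds the height p of the counting tree and the height of all AVL trees of at most
  \<open>V + 1\<close> elements, the largest one being that of the stamps with its extra 0. An
  access allocates at most \<open>20 * H\<close> nodes, which is what the second bound on W provides
  for, with one access to spare.\<close>

locale lpr_run = lpr_segmentation V s kk ll for V s kk ll +
  fixes e :: "nat \<Rightarrow> nat" and \<Lambda>\<^sub>0 :: "nat \<Rightarrow> nat" and xs :: "nat list" and p W H :: nat
  assumes V2: "2 \<le> V" and ll_e: "ll i = e (Suc (kk i))"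
    and \<Lambda>\<^sub>0: "bij_betw \<Lambda>\<^sub>0 {1..V} {1..V}" and xs: "set xs \<subseteq> {1..V}"
    and p: "V \<le> 2 ^ p" "2 ^ p < 2 * V" "p \<le> H" and H: "avl T \<Longrightarrow> siz T \<le> Suc V \<Longrightarrow> hgt T \<le> H" and H1: "1 \<le> H"
    and W: "4 * V + length xs + 10 \<le> W" "2 + 20 * H * Suc (length xs) \<le> W"
begin

definition constants :: "mem \<Rightarrow> bool" where
  "constants \<sigma> \<longleftrightarrow> val \<sigma> ''V'' = V \<and> val \<sigma> ''N'' = length xs \<and> val \<sigma> ''P'' = 2 ^ p \<and> words \<sigma> ''en'' = e \<and>
     words \<sigma> ''kk'' = kk \<and> (\<forall>i<length xs. words \<sigma> ''trace'' (Suc i) = xs ! i)"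

text \<open>The list \<open>ks\<close> holds, for every access so far, the left end
  \<open>kk d\<close> of the segment of its effective depth d. It exists only in the proof; the
  memory knows it through the counting tree.\<close>

definition counters :: "mem \<Rightarrow> nat \<Rightarrow> (nat \<Rightarrow> nat) \<Rightarrow> nat \<Rightarrow> (nat \<Rightarrow> nat) \<Rightarrow> (nat \<Rightarrow> nat) \<Rightarrow> nat list \<Rightarrow> bool" where
  "counters \<sigma> j \<Lambda> m \<tau> h ks \<longleftrightarrow> simulate \<Lambda>\<^sub>0 (take j xs) = (\<Lambda>, m, \<tau>, h) \<and> length ks = j \<and> (\<forall>k\<in>set ks. k < V) \<and>
     count_tree p (words \<sigma> ''cnt'') ks \<and> words \<sigma> ''hist'' = h \<and> stamped (words \<sigma> ''last'') \<Lambda> m j \<and>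
     (\<exists>T. tree_at \<sigma> (val \<sigma> ''lr'') T \<and> avl T \<and> elems T = stamps (words \<sigma> ''last'') \<Lambda> m) \<and>
     (\<forall>i\<in>{1..V}. segment_ok \<sigma> \<tau> m ks (kk i) (ll i))"

definition run_inv :: "mem \<Rightarrow> nat \<Rightarrow> bool" where
  "run_inv \<sigma> j \<longleftrightarrow> j \<le> length xs \<and> val \<sigma> ''t'' = Suc j \<and> constants \<sigma> \<and> 2 \<le> val \<sigma> ''nx'' \<and> val \<sigma> ''nx'' \<le> 2 + 20 * H * j \<and>
     (\<exists>\<Lambda> m \<tau> h ks. counters \<sigma> j \<Lambda> m \<tau> h ks)"

lemma constants_frame: "constants \<sigma> \<Longrightarrow> frame access_vars \<sigma> \<sigma>' \<Longrightarrow> constants \<sigma>'"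
  unfolding constants_def using consts_notin frame_words[of access_vars \<sigma> \<sigma>'] by simp

lemma wp_access:
  assumes I: "run_inv \<sigma> j" and j: "j < length xs"
  shows "wp W access \<sigma> (\<lambda>t \<sigma>'. t \<le> 4000 * H \<and> run_inv \<sigma>' (Suc j))"
proof -
  obtain \<Lambda> m \<tau> h ks where cnts: "counters \<sigma> j \<Lambda> m \<tau> h ks" using I by (auto simp: run_inv_def)
  have I': "val \<sigma> ''t'' = Suc j" "constants \<sigma>" "2 \<le> val \<sigma> ''nx''" "val \<sigma> ''nx'' \<le> 2 + 20 * H * j" using I by (auto simp: run_inv_def)
  have sim: "simulate \<Lambda>\<^sub>0 (take j xs) = (\<Lambda>, m, \<tau>, h)" and ks: "length ks = j" "\<And>k. k \<in> set ks \<Longrightarrow> k < V"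
    and cnt: "count_tree p (words \<sigma> ''cnt'') ks" and hist: "words \<sigma> ''hist'' = h"
    and st: "stamped (words \<sigma> ''last'') \<Lambda> m j"
    and segs: "\<And>i. 1 \<le> i \<Longrightarrow> i \<le> V \<Longrightarrow> segment_ok \<sigma> \<tau> m ks (kk i) (ll i)"
    using cnts by (auto simp: counters_def)
  obtain T where T: "tree_at \<sigma> (val \<sigma> ''lr'') T" "avl T" "elems T = stamps (words \<sigma> ''last'') \<Lambda> m"
    using cnts by (auto simp: counters_def)
  have cs: "val \<sigma> ''V'' = V" "val \<sigma> ''N'' = length xs" "val \<sigma> ''P'' = 2 ^ p" "words \<sigma> ''en'' = e" "words \<sigma> ''kk'' = kk"
      "words \<sigma> ''trace'' (Suc j) = xs ! j"
    using I'(2) j by (auto simp: constants_def)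
  define x where "x = xs ! j"
  have "x \<in> set xs" using j by (simp add: x_def)
  then have x: "x \<in> {1..V}" using xs by blast
  have "set (take j xs) \<subseteq> {1..V}" using subset_trans[OF set_take_subset xs] .
  note inv0 = simulate_invariant[OF \<Lambda>\<^sub>0 this sim]
  have \<Lambda>: "bij_betw \<Lambda> {1..V} {1..V}" and m: "m \<le> V" and \<tau>: "slot_map m \<tau>" using inv0 by auto
  define d where "d = eff_depth \<Lambda> m x"
  define la where "la = words \<sigma> ''last''"
  note st' = st[folded la_def]
  note dp = D_props[OF \<Lambda> m x st', folded d_def] and rank = stamp_rank[OF \<Lambda> m x st', folded d_def]
  have d: "1 \<le> d" "d \<le> V" "d \<le> Suc m" using dp by auto
  have dm: "0 < la x \<longleftrightarrow> d \<le> m" using rank(3) dp(4) by auto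
  define K where "K = kk d"
  have K: "K < d" "K < V" "d \<le> ll d" "ll d \<le> V" using seg[OF d(1,2)] d by (auto simp: K_def)
  \<comment> \<open>The hits of one slot number at most the accesses so far, so incrementing the
    histogram stays within the word bound.\<close>
  have hist_le: "h (\<tau> d) \<le> j"
  proof -
    obtain k where "k + (\<Sum>q = 1..V. h q) = j" using inv0 V2 j by (metis atLeastAtMost_iff length_take min.absorb4 order_refl V_pos)
    moreover have "h (\<tau> d) \<le> (\<Sum>q = 1..V. h q)" using slot_bounds(3,4)[OF \<tau> d(1,2)] by (intro member_le_sum) auto
    ultimately show ?thesis by linarith
  qed
  have sizT: "siz T \<le> Suc V" using T(3) m by simp
  have VW: "Suc V < W" "2 * 2 ^ p < W" "j < W" "Suc j < W" "2 \<le> W" using W(1) p(2) j V2 by linarith+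
  have jW: "20 * H * Suc j \<le> 20 * H * length xs" using j by (intro mult_le_mono2) simp
  \<comment> \<open>The edits of the stamps and of the slots allocate at most
    \<open>6 * H + 2\<close> nodes each: three per level for a deletion and for an insertion, and
    two for the new leaf and its parent.\<close>
  have nxW: "val \<sigma> ''nx'' + 12 * H + 4 \<le> W"
  proof -
    have "20 * H * Suc j = 20 * H * j + 20 * H" by simp
    moreover have "20 * H * Suc j \<le> 20 * H * Suc (length xs)" using j by (intro mult_le_mono2) simp
    ultimately show ?thesis using I'(4) W(2) H1 by linarith
  qed
  have ksp: "\<And>k. k \<in> set ks \<Longrightarrow> k < 2 ^ p" using ks(2) p(1) by (meson order.strict_trans2)
  define \<sigma>1 where "\<sigma>1 = upd ''it'' 0 x \<sigma>"
  have fr1: "frame access_vars \<sigma> \<sigma>1" "extends \<sigma> \<sigma>1" by (simp_all add: \<sigma>1_def access_vars_def)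
  have step: "wp W (Seq touch (Seq locate (Seq update_slot (Seq add_point (Set ''t'' (Plus (Var ''t'') (Num 1)))))))
     \<sigma>1 (\<lambda>t \<sigma>'. t + 6 \<le> 4000 * H \<and> run_inv \<sigma>' (Suc j))"
    unfolding wp.simps(4)
  proof (rule wp_touch[where T = T and k = "d - 1" and M = "Suc V" and H = H], goal_cases)
    case (11 t2 \<sigma>2 T2)
    have e2: "words \<sigma>2 ''t'' = words \<sigma> ''t''" "words \<sigma>2 ''V'' = words \<sigma> ''V''" "words \<sigma>2 ''P'' = words \<sigma> ''P''"
      "words \<sigma>2 ''en'' = e" "words \<sigma>2 ''kk'' = kk" "words \<sigma>2 ''cnt'' = words \<sigma> ''cnt''" "words \<sigma>2 ''hist'' = h"
      "words \<sigma>2 ''root'' = words \<sigma> ''root''" "words \<sigma>2 ''hd'' = words \<sigma> ''hd''" "words \<sigma>2 ''snap'' = words \<sigma> ''snap''"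
      using frame_words[OF 11(10)] touch_notin by (simp_all add: \<sigma>1_def cs hist)
    have ext2: "extends \<sigma> \<sigma>2" using extends_trans[OF fr1(2) 11(9)] .
    have fr2: "frame access_vars \<sigma> \<sigma>2" by (rule frame_trans[OF fr1(1) 11(10)]) (auto simp: access_vars_def)
    have acc: "Suc (val \<sigma>2 ''acc'') = d" using 11(5) d by simp
    have key: "val \<sigma>2 ''key'' = la x" using 11(6) rank(1) by (simp add: T(3) la_def)
    have hdK: "words \<sigma> ''hd'' K + (ll d - K) \<le> W"
    proof -
      have "words \<sigma> ''hd'' K \<le> V" using segs[OF d(1,2)] K by (auto simp: segment_ok_def K_def split: if_splits)
      then show ?thesis using W(1) K by linarith
    qed
    have ld: "ll d = e (Suc K)" by (simp add: ll_e K_def)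
    show ?case
    proof (rule wp_locate[where p = p and ks = ks and K = K and n = "ll d - K" and A = "deeper ks K"
          and h = "(words \<sigma> ''hd'' K + (ll d - K) - (deeper ks K - words \<sigma> ''snap'' K) mod (ll d - K)) mod (ll d - K)"], goal_cases)
      case (15 t3 \<sigma>3)
      have e3: "words \<sigma>3 ''t'' = words \<sigma> ''t''" "words \<sigma>3 ''P'' = words \<sigma> ''P''" "words \<sigma>3 ''cnt'' = words \<sigma> ''cnt''"
        "words \<sigma>3 ''hist'' = h" "words \<sigma>3 ''root'' = words \<sigma> ''root''" "words \<sigma>3 ''hd'' = words \<sigma> ''hd''"
        "words \<sigma>3 ''snap'' = words \<sigma> ''snap''" "val \<sigma>3 ''key'' = la x" "words \<sigma>3 ''last'' = words \<sigma>2 ''last''"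
        "words \<sigma>3 ''lr'' = words \<sigma>2 ''lr''" "val \<sigma>3 ''nx'' = val \<sigma>2 ''nx''"
        using 15(7) e2 key by (simp_all add: frame_def locate_vars_def)
      have ext23: "extends \<sigma>2 \<sigma>3" by (rule frame_extends[OF 15(7)]) (simp add: locate_vars_def)
      have ext3: "extends \<sigma> \<sigma>3" using extends_trans[OF ext2 ext23] .
      have fr3: "frame access_vars \<sigma> \<sigma>3" by (rule frame_trans[OF fr2 15(7)]) (auto simp: access_vars_def)
      have nx3: "2 \<le> val \<sigma>3 ''nx''" "val \<sigma>3 ''nx'' \<le> val \<sigma> ''nx'' + 6 * H + 2"
        using ext3 I'(3) 11(8) e3(11) by (simp_all add: extends_def \<sigma>1_def)
      have ok3: "segment_ok \<sigma>3 \<tau> m ks (kk d) (ll d)"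
        by (rule segment_ok_cong[OF segs[OF d(1,2)] ext3]) (simp_all add: e3)
      show ?case
      proof (rule wp_update_slot[where H = H and n = "ll d - kk d", OF ok3 \<tau> m d], goal_cases)
        case (13 t4 \<sigma>4)
        have e4: "words \<sigma>4 ''t'' = words \<sigma> ''t''" "val \<sigma>4 ''P'' = 2 ^ p" "words \<sigma>4 ''cnt'' = words \<sigma> ''cnt''"
          "val \<sigma>4 ''K'' = K" "words \<sigma>4 ''last'' = words \<sigma>2 ''last''" "words \<sigma>4 ''lr'' = words \<sigma>2 ''lr''"
          using frame_words[OF 13(7)] update_notin e3 15(3) by (simp_all add: cs)
        have ext4: "extends \<sigma> \<sigma>4" using extends_trans[OF ext3 13(6)] .
        have fr4: "frame access_vars \<sigma> \<sigma>4" by (rule frame_trans[OF fr3 13(7)]) (auto simp: access_vars_def)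
        show ?case
        proof (rule wp_add_point[where p = p and ks = ks], goal_cases)
          case (6 t5 \<sigma>5)
          define \<sigma>6 where "\<sigma>6 = upd ''t'' 0 (Suc (Suc j)) \<sigma>5"
          have e5: "words \<sigma>5 a = words \<sigma>4 a" if "a \<noteq> ''v''" "a \<noteq> ''cnt''" for a using 6(3) that by (simp add: frame_def)
          have ext45: "extends \<sigma>4 \<sigma>6" using frame_extends[OF 6(3)] by (simp add: \<sigma>6_def)
          have ext6: "extends \<sigma> \<sigma>6" using extends_trans[OF ext4 ext45] .
          have "frame access_vars \<sigma> \<sigma>5" by (rule frame_trans[OF fr4 6(3)]) (auto simp: access_vars_def)
          then have fr6: "frame access_vars \<sigma> \<sigma>6" by (simp add: \<sigma>6_def access_vars_def)
          have e6: "val \<sigma>6 ''t'' = Suc (Suc j)" "words \<sigma>6 ''cnt'' = words \<sigma>5 ''cnt''" "words \<sigma>6 ''hist'' = words \<sigma>4 ''hist''"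
            "words \<sigma>6 ''last'' = la(x := Suc j)" "words \<sigma>6 ''lr'' = words \<sigma>2 ''lr''" "words \<sigma>6 ''root'' = words \<sigma>4 ''root''"
            "words \<sigma>6 ''hd'' = words \<sigma>4 ''hd''" "words \<sigma>6 ''snap'' = words \<sigma>4 ''snap''" "val \<sigma>6 ''nx'' = val \<sigma>4 ''nx''"
            using e5 e4 11(7) by (simp_all add: \<sigma>6_def \<sigma>1_def la_def I'(1))
          have sim': "simulate \<Lambda>\<^sub>0 (take (Suc j) xs) =
              (lru_access V \<Lambda> x, max m d, \<tau> \<circ> source d, words \<sigma>4 ''hist'')"
          proof -
            have "take (Suc j) xs = take j xs @ [x]" using j by (simp add: take_Suc_conv_app_nth x_def)
            moreover have "words \<sigma>4 ''hist'' = (if depth V \<Lambda> x \<le> m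
                then h(\<tau> (depth V \<Lambda> x) := Suc (h (\<tau> (depth V \<Lambda> x)))) else h)"
              using 13(4) e3(4) dp(4) by (cases "depth V \<Lambda> x \<le> m") auto
            ultimately show ?thesis by (simp add: simulate_snoc sim d_def)
          qed
          have T6: "tree_at \<sigma>6 (val \<sigma>6 ''lr'') T2"
            using tree_at_extends[OF extends_trans[OF ext23 extends_trans[OF 13(6) ext45]] 11(2)] e6(5) by simp
          have el6: "elems T2 = stamps (la(x := Suc j)) (lru_access V \<Lambda> x) (max m d)"
            using 11(4) rank(1) stamps_access[OF \<Lambda> m x st', folded d_def]
            by (simp add: T(3) la_def[symmetric] \<sigma>1_def I'(1))
          have segs6: "segment_ok \<sigma>6 (\<tau> \<circ> source d) (max m d) (K # ks) (kk i) (ll i)" if i: "1 \<le> i" "i \<le> V" for i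
          proof (cases "kk i = kk d")
            case True
            have "ll i = ll d" using ll_eq[OF i d(1,2) True] .
            then show ?thesis using segment_ok_cong[OF 13(2) ext45] True e6 by (simp add: K_def)
          next
            case False
            have eqs: "words \<sigma>4 ''root'' (kk i) = words \<sigma> ''root'' (kk i)" "words \<sigma>4 ''hd'' (kk i) = words \<sigma> ''hd'' (kk i)"
              "words \<sigma>4 ''snap'' (kk i) = words \<sigma> ''snap'' (kk i)" using 13(3)[OF False] e3 by simp_all
            show ?thesis
              using segment_ok_other[OF segs[OF i] i d False ext6] e6 eqs by (simp add: K_def)
          qed
          have "counters \<sigma>6 (Suc j) (lru_access V \<Lambda> x) (max m d) (\<tau> \<circ> source d) (words \<sigma>4 ''hist'') (K # ks)"
            unfolding counters_def
            using sim' ks K 6(2) e4(4) e6 stamped_access[OF \<Lambda> m x st', folded d_def] T6 11(3) el6 segs6 by auto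
          moreover have "val \<sigma>6 ''nx'' \<le> 2 + 20 * H * Suc j"
            using e6(9) 13(5) nx3(2) I'(4) H1 by simp
          moreover have "2 \<le> val \<sigma>6 ''nx''" using ext6 I'(3) by (simp add: extends_def)
          ultimately have "run_inv \<sigma>6 (Suc j)" using Suc_leI[OF j] e6(1) constants_frame[OF I'(2) fr6] unfolding run_inv_def by blast
          moreover have "val \<sigma>5 ''t'' = Suc j" using e5 e4 I'(1) by simp
          \<comment> \<open>The terms in p are absorbed since p is at most H, and the additive
            constants since H is at least 1.\<close>
          moreover have "t2 + (t3 + (t4 + (t5 + 6))) + 6 \<le> 4000 * H"
            using 11(1) 15(1) 13(1) 6(1) p(3) H1 by linarith
          ultimately show ?case using VW by (simp add: \<sigma>6_def)
        qed (use cnt p VW K e4 ks in \<open>simp_all add: order.strict_trans2[OF _ p(1)]\<close>)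
      next
        case 1
        show ?case using dm e3(8) by simp
      next
        case 6
        show ?case using 15(5) e3 by (simp add: K_def)
      next
        case 7
        show ?case using 15(5,6) 11(5) by (simp add: K_def)
      next
        case (9 T)
        then show ?case using H by blast
      next
        case 11
        then show ?case using nx3 nxW by linarith
      next
        case 12
        then show ?case using hist_le VW e3(4) by simp
      next
        case 2
        show ?case using 15(2) acc by simp
      next
        case 3
        show ?case using 15(3) by (simp add: K_def)
      next
        case 4
        show ?case using 15(4) by (simp add: K_def)
      next
        case 8
        show ?case using nx3(1) by simp
      qed (use VW in simp_all)
    qed (use cnt ksp p VW K e2 acc hdK ks W cs in \<open>simp_all add: K_def[symmetric] ld[symmetric] deeper_def order.strict_trans2[OF _ p(1)]\<close>)
  next
    case 3
    show ?case using st T(3) by (simp add: stamped_def)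
  next
    case 5
    show ?case using rank(1) by (simp add: \<sigma>1_def T(3) la_def)
  next
    case 6
    then show ?case using rank(1) dm d T(3) by (simp add: la_def)
  next
    case (7 T)
    then show ?case using H by blast
  qed (use T rank sizT VW nxW in \<open>simp_all add: \<sigma>1_def la_def\<close>)
  have it: "wval (Load ''trace'' (Var ''t'')) \<sigma> = x" by (simp add: I'(1) cs x_def)
  show ?thesis unfolding access_def Block.simps
    apply (subst wp.simps(4))
    apply (subst wp.simps(2))
    apply (subst it)
    apply (simp only: wval.simps wsafe.simps)
    apply (fold \<sigma>1_def)
    apply (intro conjI le0 wp_mono[OF step])
     apply simp_all
    done
qed

end

section \<open>The loop over the trace and the output\<close>

context lpr_run
begin

lemma wp_main_loop:
  assumes "run_inv \<sigma> 0"
    and Q: "\<And>t \<sigma>'. t \<le> 4010 * H * length xs + 20 \<Longrightarrow> run_inv \<sigma>' (length xs) \<Longrightarrow> Q t \<sigma>'"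
  shows "wp W main_loop \<sigma> Q"
  unfolding main_loop_def
proof (rule wp_while_post[where I = "\<lambda>\<sigma>. \<exists>j. run_inv \<sigma> j" and \<mu> = "\<lambda>\<sigma>. Suc (length xs) - val \<sigma> ''t''" and c = "4000 * H"], goal_cases)
  case 1
  then show ?case using assms(1) by blast
next
  case (2 \<tau>)
  then show ?case using W(1) by (auto simp: run_inv_def constants_def)
next
  case (3 \<tau>)
  then obtain j where j: "run_inv \<tau> j" by blast
  then have lt: "j < length xs" using 3(2) by (simp add: run_inv_def constants_def)
  show ?case
  proof (rule wp_mono[OF wp_access[OF j lt]], elim conjE, intro conjI)
    fix t \<tau>' assume t: "t \<le> 4000 * H" "run_inv \<tau>' (Suc j)"
    show "\<exists>j. run_inv \<tau>' j" using t by blast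
    show "Suc (length xs) - val \<tau>' ''t'' < Suc (length xs) - val \<tau> ''t''"
      using t(2) j lt by (simp add: run_inv_def)
  qed
next
  case (4 t \<sigma>')
  then obtain j where j: "run_inv \<sigma>' j" by blast
  then have "j = length xs" using 4(3) by (simp add: run_inv_def constants_def)
  have "val \<sigma> ''t'' = 1" using assms(1) by (simp add: run_inv_def)
  then have "t \<le> (8 + 4000 * H) * length xs + 8" using 4(1) by (simp add: algebra_simps)
  also have "\<dots> \<le> 4010 * H * length xs + 20"
  proof -
    have "8 + 4000 * H \<le> 4010 * H" using H1 by simp
    then have "(8 + 4000 * H) * length xs \<le> 4010 * H * length xs" by (rule mult_le_mono1)
    then show ?thesis by linarith
  qed
  finally show ?case using j \<open>j = length xs\<close> by (intro Q) simp_all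
qed

lemma wp_output:
  assumes I: "run_inv \<upsilon> (length xs)" and eq: "words \<sigma> ''hist'' = words \<upsilon> ''hist''" "val \<sigma> ''V'' = V"
    and acc: "val \<sigma> ''acc'' = length xs" "val \<sigma> ''C'' = 1"
    and Q: "\<And>t \<sigma>'. t \<le> 60 * V + 60 \<Longrightarrow> (\<And>C. C \<in> {1..V} \<Longrightarrow> words \<sigma>' ''misses'' C = lpr_misses V s C \<Lambda>\<^sub>0 xs) \<Longrightarrow> Q t \<sigma>'"
  shows "wp W output_loop \<sigma> Q"
proof -
  obtain \<Lambda> m \<tau> h ks where "counters \<upsilon> (length xs) \<Lambda> m \<tau> h ks"
    using I unfolding run_inv_def by blast
  then have sim: "simulate \<Lambda>\<^sub>0 xs = (\<Lambda>, m, \<tau>, h)" and hist: "words \<sigma> ''hist'' = h"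
    by (simp_all add: counters_def eq(1))
  have miss: "lpr_misses V s C \<Lambda>\<^sub>0 xs = length xs - (\<Sum>p = 1..C. h p)" if "C \<in> {1..V}" for C
    using lpr_misses_simulate[OF \<Lambda>\<^sub>0 xs sim that] .
  define J where "J \<tau> \<longleftrightarrow> 1 \<le> val \<tau> ''C'' \<and> val \<tau> ''C'' \<le> Suc V \<and> val \<tau> ''V'' = V \<and> words \<tau> ''hist'' = h \<and>
    val \<tau> ''acc'' = length xs - (\<Sum>p = 1..<val \<tau> ''C''. h p) \<and>
    (\<forall>C. 1 \<le> C \<and> C < val \<tau> ''C'' \<longrightarrow> words \<tau> ''misses'' C = length xs - (\<Sum>p = 1..C. h p))" for \<tau>
  show ?thesis unfolding output_loop_def
  proof (rule wp_while_post[where I = J and \<mu> = "\<lambda>\<tau>. Suc V - val \<tau> ''C''" and c = 50], goal_cases)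
    case 1
    show ?case using acc eq(2) hist V2 by (simp add: J_def)
  next
    case (2 \<tau>)
    then show ?case using W(1) by (simp add: J_def)
  next
    case (3 \<tau>)
    define C where "C = val \<tau> ''C''"
    have C: "1 \<le> C" "C \<le> V" using 3 by (simp_all add: J_def C_def)
    have VW: "Suc C \<le> W" "1 \<le> W" using C W(1) by linarith+
    have "{1..<Suc C} = {1..C}" by auto
    moreover have "{1..C} = insert C {1..<C}" using C(1) by auto
    ultimately have sums: "(\<Sum>p = 1..<Suc C. h p) = (\<Sum>p = 1..<C. h p) + h C" "(\<Sum>p = 1..C. h p) = (\<Sum>p = 1..<C. h p) + h C"
      by simp_all
    define a where "a = length xs - (\<Sum>p = 1..C. h p)"
    have acc': "val \<tau> ''acc'' - h C = a" using 3(1) sums by (simp add: J_def C_def[symmetric] a_def)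
    have J': "J (upd ''C'' 0 (Suc C) (upd ''misses'' C a (upd ''acc'' 0 a \<tau>)))"
      using 3(1) C sums by (simp add: J_def C_def[symmetric] less_Suc_eq a_def)
    have "val \<tau> ''V'' = V" "words \<tau> ''hist'' = h" using 3(1) by (simp_all add: J_def)
    then show ?case using VW C J' by (simp add: C_def[symmetric] acc')
  next
    case (4 t \<sigma>')
    then have "val \<sigma>' ''C'' = Suc V" by (simp add: J_def)
    then show ?case using 4 acc miss by (intro Q) (auto simp: J_def)
  qed
qed

end

lemma wp_prepare:
  fixes \<sigma> :: mem
  assumes V: "val \<sigma> ''V'' = V" "2 \<le> V" "4 * V + 10 \<le> W"
    and Q: "\<And>t \<sigma>' ps p. t \<le> 700 * V + 700 \<Longrightarrow> chain V (words \<sigma>' ''en'') 2 ps \<Longrightarrow>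
      decreasing (reals \<sigma> ''s'') (words \<sigma>' ''en'') ps \<Longrightarrow>
      \<forall>q\<in>set ps. prefix_dominated (reals \<sigma> ''s'') q (words \<sigma>' ''en'' q) \<Longrightarrow> words \<sigma>' ''en'' 1 = 1 \<Longrightarrow>
      (\<And>i. i \<in> {2..V} \<Longrightarrow> Suc (words \<sigma>' ''kk'' i) \<in> set ps \<and> words \<sigma>' ''kk'' i < i \<and>
         i \<le> words \<sigma>' ''en'' (Suc (words \<sigma>' ''kk'' i))) \<Longrightarrow>
      words \<sigma>' ''kk'' 1 = words \<sigma> ''kk'' 1 \<Longrightarrow> val \<sigma>' ''P'' = 2 ^ p \<Longrightarrow> V \<le> 2 ^ p \<Longrightarrow> 2 ^ p < 2 * V \<Longrightarrow>
      words \<sigma>' ''sz'' 1 = 1 \<Longrightarrow> val \<sigma>' ''lr'' = 1 \<Longrightarrow> val \<sigma>' ''nx'' = 2 \<Longrightarrow> val \<sigma>' ''t'' = 1 \<Longrightarrow>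
      frame {''en'', ''i'', ''go'', ''a'', ''d'', ''kk'', ''P'', ''sz'', ''lr'', ''nx'', ''t''} \<sigma> \<sigma>' \<Longrightarrow> Q t \<sigma>'"
  shows "wp W prepare \<sigma> Q"
proof -
  have W2: "2 \<le> W" "1 \<le> W" "V < W" "V + 2 \<le> W" "2 * V \<le> W" using V by linarith+
  show ?thesis unfolding prepare_def Block.simps wp.simps(4)
  proof (rule wp_find_blocks[OF V(1,2) W2(3)], goal_cases)
    case (1 t1 \<tau>1 ps)
    note blocks = 1
    have V1: "val \<tau>1 ''V'' = V" using blocks(6) V(1) by (simp add: frame_def)
    show ?case
    proof (rule wp_label_blocks[OF V1 V(2) W2(4) blocks(2)], goal_cases)
      case (1 t2 \<tau>2)
      note lab = 1
      have e2: "words \<tau>2 ''en'' = words \<tau>1 ''en''" "val \<tau>2 ''V'' = V" "words \<tau>1 ''kk'' = words \<sigma> ''kk''"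
        using lab(4) V1 blocks(6) by (simp_all add: frame_def)
      define \<tau> where "\<tau> = upd ''P'' 0 1 \<tau>2"
      show ?case unfolding wp.simps(2) wsafe.simps wval.simps \<tau>_def[symmetric]
      proof (intro conjI, simp, rule W2(2), rule wp_power_loop[of _ V], goal_cases)
        case (5 t3 \<tau>3 p)
        have fr: "frame {''en'', ''i'', ''go'', ''a'', ''d'', ''kk'', ''P''} \<sigma> \<tau>3"
          using blocks(6) lab(4) 5(5) by (simp add: frame_def \<tau>_def)
        have e3: "words \<tau>3 ''en'' = words \<tau>1 ''en''" "words \<tau>3 ''kk'' = words \<tau>2 ''kk''" using 5(5) e2 by (simp_all add: frame_def \<tau>_def)
        have fr': "frame {''en'', ''i'', ''go'', ''a'', ''d'', ''kk'', ''P'', ''sz'', ''lr'', ''nx'', ''t''} \<sigma> \<tau>3"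
          by (rule frame_mono[OF fr]) (simp add: insert_commute)
        have fin: "Q u (upd ''t'' 0 1 (upd ''nx'' 0 2 (upd ''lr'' 0 1 (upd ''sz'' 1 1 \<tau>3))))"
          if u: "u \<le> t1 + (t2 + (3 + t3)) + 30" for u
        proof (rule Q[where ps = ps and p = p], goal_cases)
          case 1
          show ?case using u blocks(1) lab(1) 5(1) by linarith
        next
          case (6 i)
          then show ?case using lab(2)[of i] by (simp add: e3)
        qed (use blocks(2-5) lab(3) 5(2-4) fr' in \<open>simp_all add: e3 e2\<close>)
        show ?case using W2
          apply (simp del: One_nat_def)
          apply (rule fin)
          apply simp
          done
      qed (use e2 W2 V in \<open>simp_all add: \<tau>_def\<close>)
    qed
  qed
qed

section \<open>Numerical bounds and conclusion\<close>

lemma floorlog2_bounds: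
  assumes "1 \<le> V"
  shows "V < 2 ^ floorlog 2 V" "2 ^ (floorlog 2 V - 1) \<le> V" "1 \<le> floorlog 2 V"
  using floorlog_bounds[of V 2] assms by (auto simp: floorlog_def Suc_le_eq)

lemma avl_hgt_le:
  assumes "avl T" "siz T \<le> 2 ^ F"
  shows "hgt T \<le> 2 * F"
proof -
  have "2 ^ hgt T \<le> (siz T)\<^sup>2" using avl_size assms(1) .
  also have "\<dots> \<le> (2 ^ F)\<^sup>2" using assms(2) by (rule power_mono) simp
  also have "\<dots> = 2 ^ (2 * F)" by (simp add: power_mult mult.commute)
  finally show ?thesis by (rule power_le_imp_le_exp[rotated]) simp
qed

lemma bounded_input_mem:
  assumes "\<Lambda> ` {1..V} \<subseteq> {1..V}" "set xs \<subseteq> {1..V}" "V \<le> W" "length xs \<le> W"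
  shows "bounded_mem W (input_mem V s \<Lambda> xs)"
proof -
  have "\<Lambda> i \<le> W" if "i \<in> {1..V}" for i using assms(1,3) that by force
  moreover have "xs ! (i - 1) \<le> W" if "i \<in> {1..length xs}" for i
  proof -
    have "xs ! (i - 1) \<in> set xs" using that by (intro nth_mem) auto
    then show ?thesis using assms(2,3) by force
  qed
  ultimately show ?thesis using assms(3,4) by (simp add: bounded_mem_def input_mem_def)
qed

text \<open>Origin of the exponent 10: since X is at least 2, a constant \<open>2 ^ i\<close> is at
  most \<open>X ^ i\<close>. The linear quantity is at most \<open>2 ^ 9 * X\<close>, and the number
  of addresses, a product of two linear ones, at most \<open>2 ^ 8 * X ^ 2\<close>.\<close>

lemma word_bound:
  fixes X :: nat
  assumes "V + N = X" "2 \<le> X" "H \<le> 2 * V"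
  shows "4 * V + N + 10 \<le> X ^ 10" "2 + 20 * H * Suc N \<le> X ^ 10"
proof -
  have pow: "2 ^ i * X ^ (10 - i) \<le> X ^ 10" if "i \<le> 10" for i
  proof -
    have "2 ^ i * X ^ (10 - i) \<le> X ^ i * X ^ (10 - i)" using assms(2) by (intro mult_le_mono1 power_mono) auto
    then show ?thesis using that by (simp flip: power_add)
  qed
  have "4 * V + N + 10 \<le> 512 * X" using assms(1,2) by linarith
  then show "4 * V + N + 10 \<le> X ^ 10" using pow[of 9] by simp
  have "H * Suc N \<le> (2 * X) * (2 * X)" using assms by (intro mult_le_mono) auto
  then have "20 * (H * Suc N) \<le> 80 * X\<^sup>2" by (simp add: power2_eq_square)
  moreover have "2 \<le> X\<^sup>2" using assms(2) power_mono[of 2 X 2] by simp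
  ultimately have "2 + 20 * (H * Suc N) \<le> 256 * X\<^sup>2" by linarith
  then show "2 + 20 * H * Suc N \<le> X ^ 10" using pow[of 8] by (simp add: mult.assoc)
qed

lemma lpr_program_correct:
  fixes s :: "nat \<Rightarrow> real"
  assumes V: "2 \<le> V" and s: "\<And>i. i \<notin> {1..V} \<Longrightarrow> s i = 0" and \<Lambda>\<^sub>0: "bij_betw \<Lambda>\<^sub>0 {1..V} {1..V}" and xs: "set xs \<subseteq> {1..V}"
  shows "\<exists>t \<sigma>. exec ((V + length xs) ^ 10) lpr_program (input_mem V s \<Lambda>\<^sub>0 xs) t \<sigma> \<and>
    t \<le> 2000 * V + 4010 * (2 * floorlog 2 V) * length xs \<and>
    (\<forall>C\<in>{1..V}. words \<sigma> ''misses'' C = lpr_misses V s C \<Lambda>\<^sub>0 xs)"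
proof -
  define F where "F = floorlog 2 V"
  \<comment> \<open>F is the number of binary digits of V, so \<open>V + 1\<close> is at most
    \<open>2 ^ F\<close>; by \<open>avl_size\<close>, a tree of so many elements has height at most
    \<open>2 * F\<close>.\<close>
  define H where "H = 2 * F"
  define W where "W = (V + length xs) ^ 10"
  define \<sigma> where "\<sigma> = input_mem V s \<Lambda>\<^sub>0 xs"
  have F: "V < 2 ^ F" "2 ^ (F - 1) \<le> V" "1 \<le> F" using floorlog2_bounds[of V] V by (auto simp: F_def)
  have "F - 1 < 2 ^ (F - 1)" by (rule less_exp)
  then have "F \<le> V" using F(2) by linarith
  then have W: "4 * V + length xs + 10 \<le> W" "2 + 20 * H * Suc (length xs) \<le> W"
    using word_bound[of V "length xs" "V + length xs" H] V by (simp_all add: W_def H_def)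
  have W': "4 * V + 10 \<le> W" using W(1) by linarith
  have bnd: "bounded_mem W \<sigma>" unfolding \<sigma>_def
    by (rule bounded_input_mem) (use \<Lambda>\<^sub>0 xs W in \<open>auto simp: bij_betw_def\<close>)
  have inp: "val \<sigma> ''V'' = V" "val \<sigma> ''N'' = length xs" "\<And>i. i < length xs \<Longrightarrow> words \<sigma> ''trace'' (Suc i) = xs ! i"
    by (simp_all add: \<sigma>_def input_mem_def)
  have zero: "words \<sigma> a i = 0" if "a \<notin> {''V'', ''N'', ''stack'', ''trace''}" for a i
    using that by (simp add: \<sigma>_def input_mem_def)
  \<comment> \<open>The input stores s on \<open>{1..V}\<close> and 0 elsewhere; as s vanishes
    there, the array is s itself.\<close>
  have rs: "reals \<sigma> ''s'' = s" using s by (auto simp: \<sigma>_def input_mem_def)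
  have "wp W lpr_program \<sigma> (\<lambda>t \<sigma>'. t \<le> 2000 * V + 4010 * H * length xs \<and>
      (\<forall>C\<in>{1..V}. words \<sigma>' ''misses'' C = lpr_misses V s C \<Lambda>\<^sub>0 xs))"
    unfolding lpr_program_def Block.simps wp.simps(4)
  proof (rule wp_prepare[OF inp(1) V W'], goal_cases)
    case (1 t1 \<tau> ps p)
    define e where "e = words \<tau> ''en''"
    define kk where "kk = words \<tau> ''kk''"
    \<comment> \<open>The label of rank 1 is never written: the initial 0 of its cell is the correct
      value.\<close>
    have kk1: "kk 1 = 0" using 1(7) zero[of "''kk''"] by (simp add: kk_def)
    have pF: "p \<le> H"
    proof -
      have "(2 :: nat) ^ p < 2 ^ Suc F" using 1(10) F(1) by simp
      then have "p < Suc F" by (rule power_less_imp_less_exp[rotated]) simp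
      then show ?thesis using F(3) by (simp add: H_def)
    qed
    interpret lpr_segmentation V s kk "\<lambda>i. e (Suc (kk i))"
      by (rule segmentation_of_chain[where ps = ps]) (use V 1(2-6) kk1 in \<open>simp_all add: e_def kk_def rs\<close>)
    interpret lpr_run V s kk "\<lambda>i. e (Suc (kk i))" e \<Lambda>\<^sub>0 xs p W H
    proof
      show "hgt T \<le> H" if "avl T" "siz T \<le> Suc V" for T
        using avl_hgt_le[of T F] that F(1) by (simp add: H_def)
    qed (use V \<Lambda>\<^sub>0 xs 1(9,10) pF W F in \<open>simp_all add: H_def\<close>)
    have unch: "words \<tau> a = words \<sigma> a" if "a \<notin> {''en'', ''i'', ''go'', ''a'', ''d'', ''kk'', ''P'', ''sz'', ''lr'', ''nx'', ''t''}" for a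
      using frame_words[OF 1(15) that] .
    have zero': "words \<tau> a i = 0" if "a \<in> {''ht'', ''ky'', ''cnt'', ''hist'', ''last'', ''root'', ''hd'', ''snap''}" for a i
      using that unch[of a] zero[of a i] by (elim insertE emptyE) simp_all
    have init: "constants \<tau>" unfolding constants_def using inp unch 1(8) by (simp add: e_def kk_def)
    \<comment> \<open>Node 1 becomes the leaf of stamp 0 by setting its size; its height and key are
      the initial zeros.\<close>
    have lf: "tree_at \<tau> (val \<tau> ''lr'') (Lf 0) \<and> avl (Lf 0) \<and> elems (Lf 0) = stamps (words \<tau> ''last'') \<Lambda>\<^sub>0 0"
      using zero' 1(11-13) by (simp add: tree_at_def stamps_def)
    have "count_tree p (words \<tau> ''cnt'') []" using zero' by (simp add: count_tree_def)
    moreover have "words \<tau> ''hist'' = (\<lambda>_. 0)" using zero' by auto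
    moreover have "stamped (words \<tau> ''last'') \<Lambda>\<^sub>0 0 0" using zero' by (simp add: stamped_def stamps_def)
    moreover have "segment_ok \<tau> id 0 [] (kk i) (e (Suc (kk i)))" for i using zero' by (simp add: segment_ok_def deeper_def)
    ultimately have "counters \<tau> 0 \<Lambda>\<^sub>0 0 id (\<lambda>_. 0) []"
      unfolding counters_def using lf by (auto simp: simulate_def)
    then have "\<exists>\<Lambda> m \<tau>' h ks. counters \<tau> 0 \<Lambda> m \<tau>' h ks" by blast
    then have run: "run_inv \<tau> 0" unfolding run_inv_def using init 1(13,14) by simp
    show ?case
    proof (rule wp_main_loop[OF run], goal_cases)
      case (1 t2 \<upsilon>)
      define \<omega> where "\<omega> = upd ''C'' 0 1 (upd ''acc'' 0 (val \<upsilon> ''N'') \<upsilon>)"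
      have N: "val \<upsilon> ''N'' = length xs" and VV: "val \<upsilon> ''V'' = V" using 1(2) by (simp_all add: run_inv_def constants_def)
      have out: "wp W output_loop \<omega> (\<lambda>t \<sigma>'. t \<le> 60 * V + 60 \<and>
          (\<forall>C\<in>{1..V}. words \<sigma>' ''misses'' C = lpr_misses V s C \<Lambda>\<^sub>0 xs))"
        by (rule wp_output[OF 1(2)]) (use N VV in \<open>simp_all add: \<omega>_def\<close>)
      have "1 \<le> W" using W(1) by linarith
      then show ?case using \<open>t1 \<le> _\<close> 1(1) V
        by (simp del: One_nat_def flip: \<omega>_def) (rule wp_mono[OF out], simp)
    qed
  qed
  then obtain t \<sigma>' where "exec W lpr_program \<sigma> t \<sigma>'" "t \<le> 2000 * V + 4010 * H * length xs"
      "\<forall>C\<in>{1..V}. words \<sigma>' ''misses'' C = lpr_misses V s C \<Lambda>\<^sub>0 xs"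
    using wp_terminates bnd unfolding terminates_def by blast
  then show ?thesis unfolding W_def H_def F_def \<sigma>_def by auto
qed

theorem theorem5:
  "\<exists>(prog :: com) (c :: real) (k :: nat).
     \<forall>(V :: nat) (s :: nat pmf) (\<Lambda>\<^sub>0 :: nat \<Rightarrow> nat) (xs :: nat list).
       2 \<le> V \<and> set_pmf s \<subseteq> {1..V} \<and> 0 < pmf s V \<and>
       bij_betw \<Lambda>\<^sub>0 {1..V} {1..V} \<and> set xs \<subseteq> {1..V} \<longrightarrow>
       (\<exists>t \<sigma>. exec ((V + length xs) ^ k) prog (input_mem V (pmf s) \<Lambda>\<^sub>0 xs) t \<sigma> \<and>
              real t \<le> c * (real V + real (length xs) * log 2 (real V)) \<and>
              (\<forall>C\<in>{1..V}. words \<sigma> ''misses'' C = lpr_misses V (pmf s) C \<Lambda>\<^sub>0 xs))"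
proof (rule exI[of _ lpr_program], rule exI[of _ 20000], rule exI[of _ 10], intro allI impI, elim conjE)
  fix V :: nat and s :: "nat pmf" and \<Lambda>\<^sub>0 :: "nat \<Rightarrow> nat" and xs :: "nat list"
  assume V: "2 \<le> V" and s: "set_pmf s \<subseteq> {1..V}" and \<Lambda>\<^sub>0: "bij_betw \<Lambda>\<^sub>0 {1..V} {1..V}" and xs: "set xs \<subseteq> {1..V}"
  have "pmf s i = 0" if "i \<notin> {1..V}" for i using s that by (auto simp: pmf_eq_0_set_pmf)
  then obtain t \<sigma> where t: "exec ((V + length xs) ^ 10) lpr_program (input_mem V (pmf s) \<Lambda>\<^sub>0 xs) t \<sigma>"
      "t \<le> 2000 * V + 4010 * (2 * floorlog 2 V) * length xs"
      "\<forall>C\<in>{1..V}. words \<sigma> ''misses'' C = lpr_misses V (pmf s) C \<Lambda>\<^sub>0 xs"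
    using lpr_program_correct[OF V _ \<Lambda>\<^sub>0 xs] by blast
  define F where "F = floorlog 2 V"
  have F: "2 ^ (F - 1) \<le> V" "1 \<le> F" using floorlog2_bounds[of V] V by (simp_all add: F_def)
  have log_V: "1 \<le> log 2 (real V)" using V by simp
  have "real (2 ^ (F - 1)) \<le> real V" using F(1) by (simp only: of_nat_le_iff)
  then have "log 2 (2 ^ (F - 1)) \<le> log 2 (real V)" using V by (intro log_mono) simp_all
  \<comment> \<open>The number of digits is at most one plus the logarithm, and V at least 2 makes
    the logarithm at least 1. The factor \<open>4010 * 2\<close> of F thus becomes 16040, below
    20000.\<close>
  then have "real F \<le> 2 * log 2 (real V)" using F(2) log_V by (simp add: log_nat_power of_nat_diff)
  then have "real (4010 * (2 * F) * length xs) \<le> 20000 * (real (length xs) * log 2 (real V))"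
    using mult_right_mono[of "8020 * real F" "20000 * log 2 (real V)" "real (length xs)"] log_V by (simp add: mult_ac)
  moreover have "real t \<le> real (2000 * V + 4010 * (2 * F) * length xs)" using t(2) unfolding F_def by (simp only: of_nat_le_iff)
  ultimately have "real t \<le> 20000 * (real V + real (length xs) * log 2 (real V))" by (simp add: algebra_simps)
  with t show "\<exists>t \<sigma>. exec ((V + length xs) ^ 10) lpr_program (input_mem V (pmf s) \<Lambda>\<^sub>0 xs) t \<sigma> \<and>
      real t \<le> 20000 * (real V + real (length xs) * log 2 (real V)) \<and>
      (\<forall>C\<in>{1..V}. words \<sigma> ''misses'' C = lpr_misses V (pmf s) C \<Lambda>\<^sub>0 xs)" by blast
qed

end
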